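(* Let $M_0$ be a minimal $n$-noid. If the space of bounded Jacobi fields on $M_0$ has real dimension $3$, then the differential at $\mathbf{x}_0$ of the period map $P=(P_1,\dots,P_{n-1})$ has complex rank $3n-3$.
   Context: A minimal $n$-noid is a complete immersed minimal surface in $\mathbb{R}^3$ of genus zero with $n$ catenoidal ends. A Jacobi field is a solution $u$ of the Jacobi equation $\Delta u+|A|^2u=0$ on the surface ($A$ the second fundamental form). After a rotation, the Weierstrass data of $M_0$ can be written on $\Sigma=\mathbb{C}\cup\{\infty\}\setminus\{p_1,\dots,p_n\}$ (with $g\neq 0,\infty$ at the $p_i$) as $g=A(z)/B(z)$, $\omega=B(z)^2dz/\prod_{i=1}^n(z-p_i)^2$, with $A(z)=\sum_{i=1}^n a_iz^{n-i}$, $B(z)=\sum_{i=1}^n b_iz^{n-i}$, the surface being parametrized by $\mathrm{Re}\int_{z_0}^z\left(\frac12(1-g^2)\omega,\frac{i}{2}(1+g^2)\omega,g\omega\right)$. Regard $\mathbf{x}=(a_i,b_i,p_i)_{1\le i\le n}\in\mathbb{C}^{3n}$ as complex parameters with value $\mathbf{x}_0$ for $M_0$, define $g_{\mathbf x},\omega_{\mathbf x}$ by the same formulas, and set $P_{i,k}(\mathbf{x})=\int_{\gamma_i}g_{\mathbf x}^k\omega_{\mathbf x}$ for $0\le k\le 2$, where $\gamma_i$ is a small circle around $p_i$, $P_i=(P_{i,0},P_{i,1},P_{i,2})$, $P=(P_1,\dots,P_{n-1})$. *)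

theory Defs
  imports "HOL-Complex_Analysis.Complex_Analysis" "HOL-Library.Function_Algebras" "Jordan_Normal_Form.DL_Rank"
begin

text \<open>The parameter vector x in C^(3n) is encoded as a function x :: nat => complex,
  using 0-based indices i < n:  a_(i+1) = x (3*i), b_(i+1) = x (3*i+1), p_(i+1) = x (3*i+2).
  Only the values x 0, ..., x (3*n-1) are relevant.\<close>

definition coef_a :: "(nat \<Rightarrow> complex) \<Rightarrow> nat \<Rightarrow> complex" where
  "coef_a x i = x (3*i)"
definition coef_b :: "(nat \<Rightarrow> complex) \<Rightarrow> nat \<Rightarrow> complex" where
  "coef_b x i = x (3*i+1)"
definition pt :: "(nat \<Rightarrow> complex) \<Rightarrow> nat \<Rightarrow> complex" where
  "pt x i = x (3*i+2)"

definition polyA :: "nat \<Rightarrow> (nat \<Rightarrow> complex) \<Rightarrow> complex \<Rightarrow> complex" where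
  "polyA n x z = (\<Sum>i<n. coef_a x i * z ^ (n - 1 - i))"
definition polyB :: "nat \<Rightarrow> (nat \<Rightarrow> complex) \<Rightarrow> complex \<Rightarrow> complex" where
  "polyB n x z = (\<Sum>i<n. coef_b x i * z ^ (n - 1 - i))"

definition prodP :: "nat \<Rightarrow> (nat \<Rightarrow> complex) \<Rightarrow> complex \<Rightarrow> complex" where
  "prodP n x z = (\<Prod>i<n. (z - pt x i) ^ 2)"

definition gW :: "nat \<Rightarrow> (nat \<Rightarrow> complex) \<Rightarrow> complex \<Rightarrow> complex" where
  "gW n x z = polyA n x z / polyB n x z"
definition fW :: "nat \<Rightarrow> (nat \<Rightarrow> complex) \<Rightarrow> complex \<Rightarrow> complex" where
  "fW n x z = (polyB n x z) ^ 2 / prodP n x z"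

definition PhiW :: "nat \<Rightarrow> (nat \<Rightarrow> complex) \<Rightarrow> nat \<Rightarrow> complex \<Rightarrow> complex" where
  "PhiW n x j z =
     (if j = 0 then (1/2) * (1 - (gW n x z)^2) * fW n x z
      else if j = 1 then (\<i>/2) * (1 + (gW n x z)^2) * fW n x z
      else gW n x z * fW n x z)"

definition small_radius :: "nat \<Rightarrow> (nat \<Rightarrow> complex) \<Rightarrow> real \<Rightarrow> bool" where
  "small_radius n x r \<longleftrightarrow> 0 < r \<and>
     (\<forall>i<n. \<forall>j<n. i \<noteq> j \<longrightarrow> r < cmod (pt x i - pt x j))"

text \<open>The Weierstrass data given by x define a minimal n-noid: the p_i are distinct,
  the induced metric (|A|^2+|B|^2)|dz|/(2|prod (z-p_i)|^2) is regular on the sphere minus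
  the p_i (A and B have no common zero in C, nor at infinity, i.e. (a_1,b_1) \<noteq> 0),
  g \<noteq> 0, \<infinity> at the p_i, the surface is well defined (real periods vanish), and every
  end is catenoidal (nonzero flux/residue, the end being embedded since omega has a
  double pole and g(p_i) is finite and nonzero).\<close>
definition nnoid_data :: "nat \<Rightarrow> (nat \<Rightarrow> complex) \<Rightarrow> bool" where
  "nnoid_data n x \<longleftrightarrow>
     2 \<le> n \<and>
     inj_on (pt x) {..<n} \<and>
     (\<forall>z. \<not> (polyA n x z = 0 \<and> polyB n x z = 0)) \<and>
     (coef_a x 0 \<noteq> 0 \<or> coef_b x 0 \<noteq> 0) \<and>
     (\<forall>i<n. polyA n x (pt x i) \<noteq> 0 \<and> polyB n x (pt x i) \<noteq> 0) \<and>
     (\<forall>r. small_radius n x r \<longrightarrow>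
        (\<forall>i<n.
           (\<forall>j<3. Re (contour_integral (circlepath (pt x i) r) (PhiW n x j)) = 0) \<and>
           (\<exists>j<3. contour_integral (circlepath (pt x i) r) (PhiW n x j) \<noteq> 0)))"

definition C2_on :: "complex set \<Rightarrow> (complex \<Rightarrow> real) \<Rightarrow> bool" where
  "C2_on S u \<longleftrightarrow>
     (\<exists>(Du :: complex \<Rightarrow> complex \<Rightarrow>\<^sub>L real) (D2u :: complex \<Rightarrow> complex \<Rightarrow>\<^sub>L (complex \<Rightarrow>\<^sub>L real)).
        (\<forall>z\<in>S. (u has_derivative blinfun_apply (Du z)) (at z) \<and>
                (Du has_derivative blinfun_apply (D2u z)) (at z)) \<and>
        continuous_on S D2u)"

definition flat_lap :: "(complex \<Rightarrow> real) \<Rightarrow> complex \<Rightarrow> real" where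
  "flat_lap u z =
     deriv (\<lambda>t. deriv (\<lambda>s. u (z + of_real (t + s))) 0) 0 +
     deriv (\<lambda>t. deriv (\<lambda>s. u (z + \<i> * of_real (t + s))) 0) 0"

text \<open>Conformal factor lambda of the induced metric ds = lambda |dz|,
  lambda = (1/2)(1+|g|^2)|f|, written without denominators in B.\<close>
definition confW :: "nat \<Rightarrow> (nat \<Rightarrow> complex) \<Rightarrow> complex \<Rightarrow> real" where
  "confW n x z = ((cmod (polyA n x z))^2 + (cmod (polyB n x z))^2) / (2 * cmod (prodP n x z))"

text \<open>|A|^2 = -2K with K = -(4|g'| / (|f| (1+|g|^2)^2))^2, written with
  g' = (A'B - AB')/B^2 (so that it is defined also at the poles of g).\<close>
definition sffW :: "nat \<Rightarrow> (nat \<Rightarrow> complex) \<Rightarrow> complex \<Rightarrow> real" where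
  "sffW n x z =
     2 * (4 * cmod (deriv (polyA n x) z * polyB n x z - polyA n x z * deriv (polyB n x) z)
            * cmod (prodP n x z)
          / ((cmod (polyA n x z))^2 + (cmod (polyB n x z))^2)^2)^2"

text \<open>Jacobi equation  Delta_M u + |A|^2 u = 0, with Delta_M = lambda^(-2) (d_xx + d_yy).\<close>
definition jacobi_eq_at :: "nat \<Rightarrow> (nat \<Rightarrow> complex) \<Rightarrow> (complex \<Rightarrow> real) \<Rightarrow> complex \<Rightarrow> bool" where
  "jacobi_eq_at n x u z \<longleftrightarrow> flat_lap u z / (confW n x z)^2 + sffW n x z * u z = 0"

text \<open>Bounded Jacobi fields on the surface parametrized by Sigma = C \<union> {\<infinity>} minus
  {p_1,...,p_n}.  A field is represented by its restriction to C minus the p_i (set to 0 at the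
  p_i, so that distinct fields are distinct functions); it must be C^2 on Sigma, including
  at \<infinity> (in the chart w = 1/z), satisfy the Jacobi equation, and be bounded.\<close>
definition bounded_jacobi_fields :: "nat \<Rightarrow> (nat \<Rightarrow> complex) \<Rightarrow> (complex \<Rightarrow> real) set" where
  "bounded_jacobi_fields n x =
     {u. let S = UNIV - pt x ` {..<n} in
         (\<forall>z\<in>pt x ` {..<n}. u z = 0) \<and>
         C2_on S u \<and>
         (\<exists>c e. 0 < e \<and> C2_on (ball 0 e) (\<lambda>w. if w = 0 then c else u (1 / w))) \<and>
         (\<forall>z\<in>S. jacobi_eq_at n x u z) \<and>
         bounded (u ` S)}"

definition real_fun_dim :: "(complex \<Rightarrow> real) set \<Rightarrow> nat" where
  "real_fun_dim V = vector_space.dim (\<lambda>(r::real) f z. r * f z) V"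

definition period :: "nat \<Rightarrow> real \<Rightarrow> (nat \<Rightarrow> complex) \<Rightarrow> (nat \<Rightarrow> complex) \<Rightarrow> nat \<Rightarrow> nat \<Rightarrow> complex" where
  "period n r x0 x i k =
     contour_integral (circlepath (pt x0 i) r) (\<lambda>z. (gW n x z) ^ k * fW n x z)"

definition period_map :: "nat \<Rightarrow> real \<Rightarrow> (nat \<Rightarrow> complex) \<Rightarrow> (nat \<Rightarrow> complex) \<Rightarrow> nat \<Rightarrow> complex" where
  "period_map n r x0 x m = period n r x0 x (m div 3) (m mod 3)"

definition period_jacobian :: "nat \<Rightarrow> real \<Rightarrow> (nat \<Rightarrow> complex) \<Rightarrow> complex Matrix.mat" where
  "period_jacobian n r x0 =
     Matrix.mat (3 * (n - 1)) (3 * n)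
       (\<lambda>(m, s). deriv (\<lambda>t. period_map n r x0 (x0(s := t)) m) (x0 s))"

definition complex_rank :: "nat \<Rightarrow> complex Matrix.mat \<Rightarrow> nat" where
  "complex_rank nr M = vec_space.rank nr M"

end

theory Submission
  imports Defs "HOL-Computational_Algebra.Fundamental_Theorem_Algebra"
    "HOL-Computational_Algebra.Field_as_Ring" "HOL-Computational_Algebra.Polynomial_Factorial"
begin

text \<open>
  Let \<open>v\<close> be in the kernel of the Jacobian. The variations of \<open>g\<^sup>k \<omega>\<close> then have no residues, hence primitives
  \<open>E\<^sub>k\<close> on the punctured sphere, and the normal component \<open>w\<close> of the resulting (complexified) variation of the surface is
  a solution of the Jacobi equation. It is bounded: the flux at an end is a nonzero real vector, so \<open>g\<close> is unramified
  there, and a variation that fixes the flux fixes the limit normal. Nondegeneracy applied to \<open>Re w\<close> and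
  \<open>Im w\<close> shows that, after subtracting a complex translation from \<open>E\<close>, we have \<open>w = 0\<close>. A tangential holomorphic
  variation is a reparametrization: \<open>E\<^sub>k = h g\<^sup>k \<omega>\<close> with \<open>h\<close> a holomorphic vector field on the sphere, that is, a
  polynomial of degree at most 2. Therefore three additional linear conditions on \<open>v\<close>, namely that the variation of \<open>g\<close>
  vanishes at three points where \<open>g\<close> is unramified, force \<open>h = 0\<close> and \<open>v = 0\<close>. The Jacobian bordered by these three
  rows is an invertible square matrix, so its \<open>3n - 3\<close> rows have full rank.
\<close>

section \<open>Wirtinger calculus\<close>

text \<open>The number 3n - 3 comes from the group of Moebius changes of z: it has complex dimension
  3, and its Lie algebra is the space of quadratic fields h. With 3n parameters and 3n - 3 periods
  the kernel has dimension at least 3, so the aim is to show that it is no larger. Only n - 1 ends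
  occur in P because the residues on the sphere add up to zero.

  Two obstacles shape the calculation. First, the support function w is not holomorphic, and g may
  have poles. All formulas are therefore homogeneous in (A, B), with the denominator D = |A|^2 +
  |B|^2, which has no zero, and the non-holomorphic part of w is carried by one holomorphic function
  Q: the derivative of w by \<open>cnj z\<close> is \<open>cnj W * Q / D^2\<close>, where W = A'B -
  AB'. Second, E has double poles at the ends, so that w is not visibly bounded. Both are settled by
  one pair of identities which recover the numerators of w from Q and Q' wherever W is nonzero: if Q
  extends over an end, then w has a limit there, and if w = 0, then Q = 0 and the variation is
  tangential.\<close>

text \<open>\<open>p\<close> and \<open>q\<close> are the Wirtinger derivatives \<open>\<partial>f/\<partial>z\<close> and \<open>\<partial>f/\<partial>\<close>\<open>cnj z\<close> at \<open>z\<close>.\<close>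
definition wirt :: "(complex \<Rightarrow> complex) \<Rightarrow> complex \<Rightarrow> complex \<Rightarrow> complex \<Rightarrow> bool" where
  "wirt f p q z \<longleftrightarrow> (f has_derivative (\<lambda>h. p * h + q * cnj h)) (at z)"

lemma wirt_holomorphic:
  assumes "(f has_field_derivative f') (at z)"
  shows "wirt f f' 0 z"
  using assms unfolding wirt_def has_field_derivative_def by simp

lemma wirt_cnj:
  assumes "wirt f p q z"
  shows "wirt (\<lambda>z. cnj (f z)) (cnj q) (cnj p) z"
  using bounded_linear.has_derivative[OF bounded_linear_cnj assms[unfolded wirt_def]]
  unfolding wirt_def by (simp add: add.commute)

lemma wirt_add:
  assumes "wirt f p q z" "wirt g p' q' z"
  shows "wirt (\<lambda>z. f z + g z) (p + p') (q + q') z"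
  using has_derivative_add[OF assms[unfolded wirt_def]]
  unfolding wirt_def by (simp add: algebra_simps)

lemma wirt_diff:
  assumes "wirt f p q z" "wirt g p' q' z"
  shows "wirt (\<lambda>z. f z - g z) (p - p') (q - q') z"
  using has_derivative_diff[OF assms[unfolded wirt_def]]
  unfolding wirt_def by (simp add: algebra_simps)

lemma wirt_mult:
  assumes "wirt f p q z" "wirt g p' q' z"
  shows "wirt (\<lambda>z. f z * g z) (p * g z + f z * p') (q * g z + f z * q') z"
  using has_derivative_mult[OF assms[unfolded wirt_def]]
  unfolding wirt_def by (simp add: algebra_simps)

lemma wirt_divide:
  assumes "wirt f p q z" "wirt g p' q' z" "g z \<noteq> 0"
  shows "wirt (\<lambda>z. f z / g z) ((p * g z - f z * p') / (g z)\<^sup>2) ((q * g z - f z * q') / (g z)\<^sup>2) z"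
proof -
  have "((\<lambda>z. f z / g z) has_derivative
      (\<lambda>h. (p * h + q * cnj h) / g z - f z * (p' * h + q' * cnj h) / (g z)\<^sup>2)) (at z)"
    using assms unfolding wirt_def
    by (auto intro!: derivative_eq_intros simp: field_simps power2_eq_square)
  then show ?thesis
    unfolding wirt_def
    by (rule has_derivative_eq_rhs) (use assms(3) in \<open>auto simp: field_simps power2_eq_square\<close>)
qed

lemma wirt_unique:
  assumes "wirt f p q z" "wirt f p' q' z"
  shows "p = p'" "q = q'"
proof -
  have e: "p * h + q * cnj h = p' * h + q' * cnj h" for h
    using has_derivative_unique[OF assms[unfolded wirt_def]] by meson
  have "p + q = p' + q'" using e[of 1] by simp
  moreover have "p - q = p' - q'"
  proof -
    have "\<i> * (p - q) = \<i> * (p' - q')" using e[of \<i>] by (simp add: algebra_simps)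
    then show ?thesis by simp
  qed
  ultimately show "p = p'" "q = q'" by (auto simp: algebra_simps)
      (metis add_diff_cancel_left' add_diff_eq diff_add_cancel mult_2 mult_cancel_left zero_neq_numeral)+
qed

lemma wirt_transform:
  assumes "wirt f p q z" "open S" "z \<in> S" "\<And>w. w \<in> S \<Longrightarrow> f w = g w"
  shows "wirt g p q z"
  using assms(1) unfolding wirt_def
  by (rule has_derivative_transform_within_open[OF _ assms(2,3,4)])

text \<open>\<open>C2_on\<close> asks for continuous second derivatives. With continuity of
  \<open>p\<close> and \<open>q\<close> built in, the class is closed under conjugation, products
  and quotients, so the support function and its first derivatives need only the closure
  rules.\<close>

definition C1w :: "complex set \<Rightarrow> (complex \<Rightarrow> complex) \<Rightarrow> bool" where
  "C1w S f \<longleftrightarrow> (\<exists>p q. (\<forall>z\<in>S. wirt f (p z) (q z) z) \<and> continuous_on S p \<and> continuous_on S q)"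

lemma wirt_imp_continuous:
  assumes "\<And>z. z \<in> S \<Longrightarrow> wirt f (p z) (q z) z"
  shows "continuous_on S f"
  using assms unfolding wirt_def
  by (meson continuous_at_imp_continuous_on has_derivative_continuous)

lemma C1w_imp_continuous_on: "C1w S f \<Longrightarrow> continuous_on S f"
  unfolding C1w_def by (auto intro: wirt_imp_continuous)

lemma C1w_holomorphic:
  assumes "f holomorphic_on S" "open S"
  shows "C1w S f"
  unfolding C1w_def
proof (rule exI[of _ "deriv f"], rule exI[of _ "\<lambda>_. 0"], intro conjI ballI)
  show "wirt f (deriv f z) 0 z" if "z \<in> S" for z
    by (rule wirt_holomorphic) (use assms holomorphic_derivI that in blast)
  show "continuous_on S (deriv f)"
    using assms by (simp add: holomorphic_deriv holomorphic_on_imp_continuous_on)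
qed auto

lemma C1w_cnj:
  assumes "C1w S f" shows "C1w S (\<lambda>z. cnj (f z))"
proof -
  obtain p q where "\<forall>z\<in>S. wirt f (p z) (q z) z" "continuous_on S p" "continuous_on S q"
    using assms unfolding C1w_def by auto
  then show ?thesis unfolding C1w_def
    by (intro exI[of _ "\<lambda>z. cnj (q z)"] exI[of _ "\<lambda>z. cnj (p z)"])
       (auto intro!: wirt_cnj continuous_intros)
qed

lemma C1w_add:
  assumes "C1w S f" "C1w S g" shows "C1w S (\<lambda>z. f z + g z)"
proof -
  obtain p q p' q' where "\<forall>z\<in>S. wirt f (p z) (q z) z" "continuous_on S p" "continuous_on S q"
     "\<forall>z\<in>S. wirt g (p' z) (q' z) z" "continuous_on S p'" "continuous_on S q'"
    using assms unfolding C1w_def by metis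
  then show ?thesis unfolding C1w_def
    by (intro exI[of _ "\<lambda>z. p z + p' z"] exI[of _ "\<lambda>z. q z + q' z"])
       (auto intro!: wirt_add continuous_intros)
qed

lemma C1w_diff:
  assumes "C1w S f" "C1w S g" shows "C1w S (\<lambda>z. f z - g z)"
proof -
  obtain p q p' q' where "\<forall>z\<in>S. wirt f (p z) (q z) z" "continuous_on S p" "continuous_on S q"
     "\<forall>z\<in>S. wirt g (p' z) (q' z) z" "continuous_on S p'" "continuous_on S q'"
    using assms unfolding C1w_def by metis
  then show ?thesis unfolding C1w_def
    by (intro exI[of _ "\<lambda>z. p z - p' z"] exI[of _ "\<lambda>z. q z - q' z"])
       (auto intro!: wirt_diff continuous_intros)
qed

lemma C1w_mult:
  assumes "C1w S f" "C1w S g" shows "C1w S (\<lambda>z. f z * g z)"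
proof -
  obtain p q p' q' where *: "\<forall>z\<in>S. wirt f (p z) (q z) z" "continuous_on S p" "continuous_on S q"
     "\<forall>z\<in>S. wirt g (p' z) (q' z) z" "continuous_on S p'" "continuous_on S q'"
    using assms unfolding C1w_def by metis
  have "continuous_on S f" "continuous_on S g" using assms by (auto intro: C1w_imp_continuous_on)
  with * show ?thesis unfolding C1w_def
    by (intro exI[of _ "\<lambda>z. p z * g z + f z * p' z"] exI[of _ "\<lambda>z. q z * g z + f z * q' z"])
       (auto intro!: wirt_mult continuous_intros)
qed

lemma C1w_divide:
  assumes "C1w S f" "C1w S g" "\<And>z. z \<in> S \<Longrightarrow> g z \<noteq> 0" shows "C1w S (\<lambda>z. f z / g z)"
proof -
  obtain p q p' q' where *: "\<forall>z\<in>S. wirt f (p z) (q z) z" "continuous_on S p" "continuous_on S q"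
     "\<forall>z\<in>S. wirt g (p' z) (q' z) z" "continuous_on S p'" "continuous_on S q'"
    using assms unfolding C1w_def by metis
  have "continuous_on S f" "continuous_on S g" using assms by (auto intro: C1w_imp_continuous_on)
  with * assms(3) show ?thesis unfolding C1w_def
    by (intro exI[of _ "\<lambda>z. (p z * g z - f z * p' z) / (g z)\<^sup>2"]
              exI[of _ "\<lambda>z. (q z * g z - f z * q' z) / (g z)\<^sup>2"])
       (auto intro!: wirt_divide continuous_intros)
qed

section \<open>From Wirtinger derivatives to \<open>C2_on\<close> and
  \<open>flat_lap\<close>\<close>

definition Re_mult :: "complex \<Rightarrow> complex \<Rightarrow>\<^sub>L real" where
  "Re_mult c = Blinfun Re o\<^sub>L blinfun_mult_right c"

lemma Re_mult_apply [simp]: "blinfun_apply (Re_mult c) h = Re (c * h)"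
  unfolding Re_mult_def by (simp add: bounded_linear_Blinfun_apply bounded_linear_Re)

lemma bounded_linear_Re_mult: "bounded_linear Re_mult"
  unfolding Re_mult_def
  by (rule bounded_linear_compose[OF bounded_bilinear.bounded_linear_right[OF bounded_bilinear_blinfun_compose]
        bounded_linear_blinfun_mult_right])

text \<open>The differential of \<open>Re f\<close> is \<open>h \<mapsto> Re ((p + cnj q) h)\<close>, so second derivatives are those of
  \<open>p + cnj q\<close>.\<close>
lemma C2_on_Re:
  assumes S: "open S" and f: "\<And>z. z \<in> S \<Longrightarrow> wirt f (p z) (q z) z"
    and p: "C1w S p" and q: "C1w S q"
  shows "C2_on S (\<lambda>z. Re (f z))"
    and "z \<in> S \<Longrightarrow> wirt p p1 p2 z \<Longrightarrow> wirt q q1 q2 z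
      \<Longrightarrow> flat_lap (\<lambda>z. Re (f z)) z = 2 * Re (p2 + q1)"
proof -
  define d where "d z = p z + cnj (q z)" for z
  have "C1w S d" unfolding d_def by (intro C1w_add C1w_cnj p q)
  then obtain d1 d2 where d: "\<And>z. z \<in> S \<Longrightarrow> wirt d (d1 z) (d2 z) z"
    and c: "continuous_on S d1" "continuous_on S d2" unfolding C1w_def by auto
  have Du: "((\<lambda>z. Re (f z)) has_derivative blinfun_apply (Re_mult (d z))) (at z)" if "z \<in> S" for z
    using bounded_linear.has_derivative[OF bounded_linear_Re f[OF that, unfolded wirt_def]]
    by (rule has_derivative_eq_rhs) (auto simp: d_def fun_eq_iff algebra_simps)
  define cnjL where "cnjL = Blinfun cnj"
  have cnjL [simp]: "blinfun_apply cnjL = cnj"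
    unfolding cnjL_def by (simp add: bounded_linear_Blinfun_apply bounded_linear_cnj)
  define JL where "JL = Blinfun Re_mult"
  have JL [simp]: "blinfun_apply JL = Re_mult"
    unfolding JL_def by (simp add: bounded_linear_Blinfun_apply bounded_linear_Re_mult)
  define D2 where "D2 z = JL o\<^sub>L (blinfun_mult_right (d1 z) + (blinfun_mult_right (d2 z) o\<^sub>L cnjL))" for z
  have D2: "((\<lambda>z. Re_mult (d z)) has_derivative blinfun_apply (D2 z)) (at z)" if "z \<in> S" for z
    using bounded_linear.has_derivative[OF bounded_linear_Re_mult d[OF that, unfolded wirt_def]]
    by (rule has_derivative_eq_rhs) (auto simp: D2_def fun_eq_iff blinfun.bilinear_simps)
  have "continuous_on S D2" unfolding D2_def
    by (intro bounded_bilinear.continuous_on[OF bounded_bilinear_blinfun_compose] continuous_intros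
        bounded_linear.continuous_on[OF bounded_linear_blinfun_mult_right] c)
  with Du D2 show "C2_on S (\<lambda>z. Re (f z))"
    unfolding C2_on_def by (intro exI[of _ "\<lambda>z. Re_mult (d z)"] exI[of _ D2]) auto
  assume z: "z \<in> S" and w: "wirt p p1 p2 z" "wirt q q1 q2 z"
  have d2: "d2 z = p2 + cnj q1"
    by (rule wirt_unique(2)[OF d[OF z]], unfold d_def[abs_def]) (rule wirt_add[OF w(1) wirt_cnj[OF w(2)]])
  have D1: "((\<lambda>s. Re (f (y + c * of_real s))) has_real_derivative Re (d y * c)) (at 0)"
    if "y \<in> S" for y c
  proof -
    have "((\<lambda>s. y + c * of_real s) has_derivative (\<lambda>s. c * of_real s)) (at (0::real))"
      by (auto intro!: derivative_eq_intros)
    moreover have "((\<lambda>z. Re (f z)) has_derivative blinfun_apply (Re_mult (d y))) (at (y + c * of_real 0))"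
      using Du[OF that] by simp
    ultimately have "((\<lambda>s. Re (f (y + c * of_real s))) has_derivative
        (\<lambda>s. blinfun_apply (Re_mult (d y)) (c * of_real s))) (at (0::real))"
      by (rule has_derivative_compose)
    then show ?thesis unfolding has_field_derivative_def
      by (rule has_derivative_eq_rhs) (auto simp: fun_eq_iff algebra_simps)
  qed
  have L: "deriv (\<lambda>t. deriv (\<lambda>s. Re (f (z + c * of_real (t + s)))) 0) 0 = Re ((d1 z * c + d2 z * cnj c) * c)" for c
  proof -
    have cont: "((\<lambda>t. z + c * of_real t) \<longlongrightarrow> z + c * of_real 0) (nhds 0)"
      by (intro tendsto_intros) (auto simp: filterlim_ident)
    then have "eventually (\<lambda>t. z + c * of_real t \<in> S) (nhds (0::real))"
      using S z by (auto dest: topological_tendstoD)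
    then have "eventually (\<lambda>t. deriv (\<lambda>s. Re (f (z + c * of_real (t + s)))) 0
        = Re (d (z + c * of_real t) * c)) (nhds (0::real))"
    proof eventually_elim
      case (elim t)
      have "(\<lambda>s. Re (f (z + c * of_real (t + s)))) = (\<lambda>s. Re (f ((z + c * of_real t) + c * of_real s)))"
        by (simp add: algebra_simps)
      then show ?case using DERIV_imp_deriv[OF D1[OF elim, of c]] by simp
    qed
    then have "deriv (\<lambda>t. deriv (\<lambda>s. Re (f (z + c * of_real (t + s)))) 0) 0
        = deriv (\<lambda>t. Re (d (z + c * of_real t) * c)) 0"
      by (rule deriv_cong_ev) simp
    also have "\<dots> = Re ((d1 z * c + d2 z * cnj c) * c)"
    proof (rule DERIV_imp_deriv)
      have 1: "((\<lambda>s. z + c * of_real s) has_derivative (\<lambda>s. c * of_real s)) (at (0::real))"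
        by (auto intro!: derivative_eq_intros)
      have 2: "((\<lambda>y. Re (d y * c)) has_derivative (\<lambda>h. Re ((d1 z * h + d2 z * cnj h) * c))) (at (z + c * of_real 0))"
        using d[OF z] unfolding wirt_def by (auto intro!: derivative_eq_intros)
      show "((\<lambda>t. Re (d (z + c * of_real t) * c)) has_real_derivative Re ((d1 z * c + d2 z * cnj c) * c)) (at 0)"
        using has_derivative_compose[OF 1 2] unfolding has_field_derivative_def
        by (rule has_derivative_eq_rhs) (auto simp: fun_eq_iff algebra_simps)
    qed
    finally show ?thesis .
  qed
  \<comment> \<open>By \<open>L\<close>, the second derivative in the direction \<open>c\<close> is
    the real part of \<open>d1 * c^2 + d2 * (cmod c)^2\<close>. For \<open>c = 1\<close> and
    \<open>c = \<i>\<close> the \<open>d1\<close> terms cancel, and the mixed derivative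
    \<open>d2\<close> is counted twice.\<close>
  have "flat_lap (\<lambda>z. Re (f z)) z = Re ((d1 z * 1 + d2 z * cnj 1) * 1) + Re ((d1 z * \<i> + d2 z * cnj \<i>) * \<i>)"
    unfolding flat_lap_def using L[of 1] L[of \<i>] by simp
  also have "\<dots> = 2 * Re (d2 z)" by (simp add: algebra_simps)
  finally show "flat_lap (\<lambda>z. Re (f z)) z = 2 * Re (p2 + q1)"
    by (simp add: d2)
qed

lemma C2_on_cong:
  assumes "C2_on S u" "open S" "\<And>z. z \<in> S \<Longrightarrow> u z = v z"
  shows "C2_on S v"
proof -
  obtain Du D2u where *: "\<forall>z\<in>S. (u has_derivative blinfun_apply (Du z)) (at z) \<and>
                (Du has_derivative blinfun_apply (D2u z)) (at z)" "continuous_on S D2u"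
    using assms(1) unfolding C2_on_def by blast
  then have "\<forall>z\<in>S. (v has_derivative blinfun_apply (Du z)) (at z)"
    using assms(2,3) has_derivative_transform_within_open by blast
  with * show ?thesis unfolding C2_on_def by blast
qed

lemma flat_lap_cong:
  assumes "open S" "z \<in> S" "\<And>z. z \<in> S \<Longrightarrow> u z = v z"
  shows "flat_lap u z = flat_lap v z"
proof -
  have "deriv (\<lambda>t. deriv (\<lambda>s. u (z + c * of_real (t + s))) 0) 0
      = deriv (\<lambda>t. deriv (\<lambda>s. v (z + c * of_real (t + s))) 0) (0::real)" for c
  proof (rule deriv_cong_ev)
    have t: "((\<lambda>t. y + c * of_real t) \<longlongrightarrow> y + c * of_real 0) (nhds (0::real))" for y
      by (intro tendsto_intros) (auto simp: filterlim_ident)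
    have "eventually (\<lambda>t. z + c * of_real t \<in> S) (nhds (0::real))"
      using topological_tendstoD[OF t assms(1)] assms(2) by simp
    then show "\<forall>\<^sub>F t in nhds 0. deriv (\<lambda>s. u (z + c * of_real (t + s))) 0
        = deriv (\<lambda>s. v (z + c * of_real (t + s))) (0::real)"
    proof eventually_elim
      case (elim t)
      have "eventually (\<lambda>s. (z + c * of_real t) + c * of_real s \<in> S) (nhds (0::real))"
        using topological_tendstoD[OF t assms(1)] elim by simp
      then have "eventually (\<lambda>s. u (z + c * of_real (t + s)) = v (z + c * of_real (t + s))) (nhds (0::real))"
        by eventually_elim (auto intro!: assms(3) simp: algebra_simps)
      then show ?case by (rule deriv_cong_ev) simp
    qed
  qed simp
  from this[of 1] this[of \<i>] show ?thesis unfolding flat_lap_def by simp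
qed

section \<open>The normal component of a variation\<close>

text \<open>If \<open>E k\<close> is a primitive of the variation of \<open>g\<^sup>k \<omega>\<close>, the variation of the surface is the real part of
  \<open>X = ((E 0 - E 2) / 2, \<i> (E 0 + E 2) / 2, E 1)\<close>. With \<open>g = A / B\<close>, the bilinear product of \<open>X\<close> with the Gauss map
  \<open>(2 Re g, 2 Im g, \<bar>g\<bar>\<^sup>2 - 1) / (1 + \<bar>g\<bar>\<^sup>2)\<close> simplifies to the following expression.\<close>
definition support_fun :: "(complex \<Rightarrow> complex) \<Rightarrow> (complex \<Rightarrow> complex) \<Rightarrow> (nat \<Rightarrow> complex \<Rightarrow> complex) \<Rightarrow> complex \<Rightarrow> complex" where
  "support_fun A B E z =
     (cnj (A z) * (A z * E 1 z - B z * E 2 z) + cnj (B z) * (A z * E 0 z - B z * E 1 z))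
       / (A z * cnj (A z) + B z * cnj (B z))"

text \<open>With g = A / B the derivative of g is \<open>wronsk / B^2\<close>. If A and B have no
  common zero, the zeros of \<open>wronsk\<close> are the finite ramification points of the Gauss
  map, poles of g included.\<close>

definition wronsk :: "(complex \<Rightarrow> complex) \<Rightarrow> (complex \<Rightarrow> complex) \<Rightarrow> complex \<Rightarrow> complex" where
  "wronsk A B z = deriv A z * B z - A z * deriv B z"

text \<open>For X as above this is twice the bilinear product of X with the null vector
  \<open>((B^2 - A^2) / 2, \<i> (B^2 + A^2) / 2, A B)\<close>, which spans the complex tangent
  direction of the surface.\<close>

definition Qfun :: "(complex \<Rightarrow> complex) \<Rightarrow> (complex \<Rightarrow> complex) \<Rightarrow> (nat \<Rightarrow> complex \<Rightarrow> complex) \<Rightarrow> complex \<Rightarrow> complex" where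
  "Qfun A B E z = 2 * A z * B z * E 1 z - (B z)\<^sup>2 * E 2 z - (A z)\<^sup>2 * E 0 z"

text \<open>\<open>Qfun A B E' = 0\<close> is the linearization of the conformality relation \<open>(g \<omega>)\<^sup>2 = \<omega> (g\<^sup>2 \<omega>)\<close>.\<close>
definition null_deriv :: "complex set \<Rightarrow> (complex \<Rightarrow> complex) \<Rightarrow> (complex \<Rightarrow> complex) \<Rightarrow> (nat \<Rightarrow> complex \<Rightarrow> complex) \<Rightarrow> bool" where
  "null_deriv S A B E \<longleftrightarrow> A holomorphic_on S \<and> B holomorphic_on S \<and> (\<forall>k<3. E k holomorphic_on S) \<and>
     (\<forall>z\<in>S. Qfun A B (\<lambda>k. deriv (E k)) z = 0)"

text \<open>The terms that contain \<open>deriv (E k)\<close> add up to the null condition and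
  disappear, so the derivative is again linear in the values of E.\<close>

lemma Qfun_deriv:
  assumes "null_deriv S A B E" "open S" "z \<in> S"
  shows "(Qfun A B E has_field_derivative
     2 * (deriv A z * B z + A z * deriv B z) * E 1 z - 2 * B z * deriv B z * E 2 z - 2 * A z * deriv A z * E 0 z) (at z)"
proof -
  have d [derivative_intros]: "(A has_field_derivative deriv A z) (at z)" "(B has_field_derivative deriv B z) (at z)"
    "(E 0 has_field_derivative deriv (E 0) z) (at z)" "(E 1 has_field_derivative deriv (E 1) z) (at z)"
    "(E 2 has_field_derivative deriv (E 2) z) (at z)"
    using assms unfolding null_deriv_def by (auto intro!: holomorphic_derivI)
  have "Qfun A B (\<lambda>k. deriv (E k)) z = 0" using assms unfolding null_deriv_def by blast
  then have q: "2 * A z * B z * deriv (E 1) z = (B z)\<^sup>2 * deriv (E 2) z + (A z)\<^sup>2 * deriv (E 0) z"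
    unfolding Qfun_def by (simp add: algebra_simps)
  show ?thesis unfolding Qfun_def
    apply (rule DERIV_cong)
     apply (rule derivative_intros d)+
    using q by (simp add: algebra_simps power2_eq_square)
qed

text \<open>The right-hand sides contain the two holomorphic factors in the numerator of
  \<open>support_fun\<close>. Where \<open>wronsk\<close> is nonzero they are thus determined by Q
  and Q'. This is used for the Jacobi equation, for the limit at an end and for the case w =
  0.\<close>

lemma Qfun_identities:
  assumes "null_deriv S A B E" "open S" "z \<in> S"
  shows "deriv (Qfun A B E) z * A z - 2 * Qfun A B E z * deriv A z
           = - 2 * wronsk A B z * (A z * E 1 z - B z * E 2 z)"
    and "deriv (Qfun A B E) z * B z - 2 * Qfun A B E z * deriv B z
           = - 2 * wronsk A B z * (A z * E 0 z - B z * E 1 z)"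
  unfolding DERIV_imp_deriv[OF Qfun_deriv[OF assms]] unfolding Qfun_def wronsk_def
  by (simp_all add: algebra_simps power2_eq_square)

lemma Qfun_holomorphic:
  assumes "null_deriv S A B E" "open S"
  shows "Qfun A B E holomorphic_on S"
  using Qfun_deriv[OF assms] assms(2) holomorphic_on_open by blast

text \<open>Pure algebra behind the Jacobi equation, with every function value and derivative an
  independent variable: \<open>\<alpha>\<close>, \<open>\<beta>\<close> stand for the conjugates of
  A, B, \<open>\<alpha>'\<close>, \<open>\<beta>'\<close> for those of A', B', and \<open>q\<close>
  for the derivative of w by \<open>cnj z\<close>. The two conclusions evaluate the numerators of
  the two mixed second derivatives of w, taken in either order.\<close>

lemma support_mixed_identity:
  fixes a b a' b' \<alpha> \<beta> \<alpha>' \<beta>' G H G' H' w q Q' :: complex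
  assumes D: "D = a * \<alpha> + b * \<beta>" "D \<noteq> 0" and w: "w = (\<alpha> * G + \<beta> * H) / D"
    and \<omega>: "\<omega> = \<alpha>' * \<beta> - \<alpha> * \<beta>'" and W: "W = a' * b - a * b'" and L: "L = a' * \<alpha> + b' * \<beta>"
    and q: "q = \<omega> * (b * G - a * H) / D\<^sup>2"
    and Q': "Q' = b' * G - a' * H + b * G' - a * H'"
    and Qa: "Q' * a - 2 * (b * G - a * H) * a' = - 2 * W * G"
    and Qb: "Q' * b - 2 * (b * G - a * H) * b' = - 2 * W * H"
  shows "(\<alpha>' * G' + \<beta>' * H' - (q * L + w * (a' * \<alpha>' + b' * \<beta>'))) * D
            - (\<alpha> * G' + \<beta> * H' - w * L) * (a * \<alpha>' + b * \<beta>') = - 2 * W * \<omega> * w"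
    and "Q' * D - 2 * (b * G - a * H) * L = - 2 * W * (w * D)"
proof -
  have wD: "w * D = \<alpha> * G + \<beta> * H" using w D(2) by simp
  have qD: "q * D * D = \<omega> * (b * G - a * H)" using q D(2) by (simp add: power2_eq_square)
  have "Q' * D - 2 * (b * G - a * H) * L
      = \<alpha> * (Q' * a - 2 * (b * G - a * H) * a') + \<beta> * (Q' * b - 2 * (b * G - a * H) * b')"
    unfolding D L by (simp add: algebra_simps)
  also have "\<dots> = - 2 * W * (w * D)" unfolding Qa Qb wD by (simp add: algebra_simps)
  finally show 1: "Q' * D - 2 * (b * G - a * H) * L = - 2 * W * (w * D)" .
  \<comment> \<open>\<open>e1\<close> and \<open>e2\<close> are Lagrange identities: the differences
    of products factor through the determinants \<open>\<omega>\<close> and \<open>W\<close>. The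
    claim is then proved after multiplication by D, which turns \<open>q\<close> into the polynomial
    \<open>qD\<close>, and D is cancelled at the end.\<close>
  have e1: "(\<alpha>' * G' + \<beta>' * H') * D - (\<alpha> * G' + \<beta> * H') * (a * \<alpha>' + b * \<beta>') = \<omega> * (b * G' - a * H')"
    unfolding D \<omega> by (simp add: algebra_simps)
  have e2: "L * (a * \<alpha>' + b * \<beta>') - (a' * \<alpha>' + b' * \<beta>') * D = - W * \<omega>"
    unfolding D \<omega> L W by (simp add: algebra_simps)
  have e3: "(b' * G - a' * H) * D = (b * G - a * H) * L - W * (w * D)"
    unfolding wD unfolding D L W by (simp add: algebra_simps)
  let ?X = "(\<alpha>' * G' + \<beta>' * H' - (q * L + w * (a' * \<alpha>' + b' * \<beta>'))) * D
            - (\<alpha> * G' + \<beta> * H' - w * L) * (a * \<alpha>' + b * \<beta>')"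
  have "?X = ((\<alpha>' * G' + \<beta>' * H') * D - (\<alpha> * G' + \<beta> * H') * (a * \<alpha>' + b * \<beta>'))
      + w * (L * (a * \<alpha>' + b * \<beta>') - (a' * \<alpha>' + b' * \<beta>') * D) - q * D * L"
    by (simp add: algebra_simps)
  then have X: "?X = \<omega> * (b * G' - a * H') - w * W * \<omega> - q * D * L"
    unfolding e1 e2 by simp
  have "?X * D = \<omega> * ((b * G' - a * H') * D - W * (w * D) - (b * G - a * H) * L)"
  proof -
    have "?X * D = \<omega> * (b * G' - a * H') * D - \<omega> * W * (w * D) - (q * D * D) * L"
      unfolding X by (simp add: algebra_simps)
    then show ?thesis unfolding qD by (simp add: algebra_simps)
  qed
  also have "(b * G' - a * H') * D = Q' * D - (b' * G - a' * H) * D"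
    unfolding Q' by (simp add: algebra_simps)
  also have "\<omega> * (Q' * D - (b' * G - a' * H) * D - W * (w * D) - (b * G - a * H) * L)
      = \<omega> * (Q' * D - 2 * (b * G - a * H) * L)"
    unfolding e3 by (simp add: algebra_simps)
  also have "\<dots> = (- 2 * W * \<omega> * w) * D" unfolding 1 by (simp add: algebra_simps)
  finally show "?X = - 2 * W * \<omega> * w" using D(2) mult_right_cancel by blast
qed

text \<open>The coefficient \<open>8 |W|^2 / D^2\<close> is the squared gradient of the Gauss map in
  the flat metric, so the second conclusion is the Jacobi equation freed of the conformal factor.
  The null condition is a premise of that conclusion alone, so that the first one can be applied
  directly in the chart at infinity.\<close>

lemma support_fun_jacobi:
  assumes hol: "A holomorphic_on S" "B holomorphic_on S" and holE: "\<And>k. k < 3 \<Longrightarrow> E k holomorphic_on S"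
    and S: "open S" and D0: "\<And>z. z \<in> S \<Longrightarrow> A z \<noteq> 0 \<or> B z \<noteq> 0"
  shows "C2_on S (\<lambda>z. Re (support_fun A B E z))"
    and "null_deriv S A B E \<Longrightarrow> z \<in> S \<Longrightarrow> flat_lap (\<lambda>z. Re (support_fun A B E z)) z
       = - (8 * (cmod (wronsk A B z))\<^sup>2 / ((cmod (A z))\<^sup>2 + (cmod (B z))\<^sup>2)\<^sup>2) * Re (support_fun A B E z)"
    and "z \<in> S \<Longrightarrow> \<exists>p. wirt (support_fun A B E) p
            (cnj (wronsk A B z) * Qfun A B E z / (A z * cnj (A z) + B z * cnj (B z))\<^sup>2) z"
proof -
  define D where "D = (\<lambda>z. A z * cnj (A z) + B z * cnj (B z))"
  define G where "G = (\<lambda>z. A z * E 1 z - B z * E 2 z)"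
  define H where "H = (\<lambda>z. A z * E 0 z - B z * E 1 z)"
  define w where "w = support_fun A B E"
  define W where "W = wronsk A B"
  define Q where "Q = Qfun A B E"
  define L where "L = (\<lambda>z. deriv A z * cnj (A z) + deriv B z * cnj (B z))"
  define q where "q = (\<lambda>z. cnj (W z) * Q z / (D z * D z))"
  define p where "p = (\<lambda>z. (cnj (A z) * deriv G z + cnj (B z) * deriv H z - w z * L z) / D z)"
  have "E 0 holomorphic_on S" "E 1 holomorphic_on S" "E 2 holomorphic_on S"
    using holE by auto
  note hol = hol this
  have holGH: "G holomorphic_on S" "H holomorphic_on S"
    unfolding G_def H_def by (intro holomorphic_intros hol)+
  have holW: "W holomorphic_on S" unfolding W_def wronsk_def[abs_def]
    by (intro holomorphic_intros hol S)
  have holQ: "Q holomorphic_on S" unfolding Q_def Qfun_def[abs_def]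
    by (intro holomorphic_intros hol)
  have Dre: "D z = of_real ((cmod (A z))\<^sup>2 + (cmod (B z))\<^sup>2)" for z
    unfolding D_def by (simp only: complex_norm_square of_real_add)
  have Dn: "D z \<noteq> 0" if "z \<in> S" for z
    using D0[OF that] unfolding Dre of_real_eq_0_iff by (auto simp: add_nonneg_eq_0_iff)
  have C1: "C1w S f" if "f holomorphic_on S" for f using C1w_holomorphic[OF that S] .
  have C1s: "C1w S A" "C1w S B" "C1w S G" "C1w S H" "C1w S Q" "C1w S W"
     "C1w S (deriv A)" "C1w S (deriv B)" "C1w S (deriv G)" "C1w S (deriv H)"
    by (intro C1 hol holGH holW holQ holomorphic_deriv S)+
  have wG: "w = (\<lambda>z. (cnj (A z) * G z + cnj (B z) * H z) / D z)"
    unfolding w_def support_fun_def[abs_def] G_def H_def D_def by simp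
  have C1D: "C1w S D" unfolding D_def by (intro C1w_add C1w_mult C1w_cnj C1s)
  have C1w: "C1w S w" unfolding wG by (intro C1w_divide C1w_add C1w_mult C1w_cnj C1s C1D Dn)
  have C1q: "C1w S q" unfolding q_def
    by (intro C1w_divide C1w_mult C1w_cnj C1s C1D) (use Dn in auto)
  have C1p: "C1w S p" unfolding p_def L_def
    by (intro C1w_divide C1w_add C1w_diff C1w_mult C1w_cnj C1s C1D C1w Dn)
  note GQ = G_def H_def Q_def Qfun_def
  have QGH: "Q z = B z * G z - A z * H z" for z
    unfolding GQ by (simp add: algebra_simps power2_eq_square)
  have d: "wirt A (deriv A z) 0 z" "wirt B (deriv B z) 0 z" "wirt G (deriv G z) 0 z" "wirt H (deriv H z) 0 z"
      "wirt W (deriv W z) 0 z" "wirt Q (deriv Q z) 0 z"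
      "wirt (deriv A) (deriv (deriv A) z) 0 z" "wirt (deriv B) (deriv (deriv B) z) 0 z"
      "wirt (deriv G) (deriv (deriv G) z) 0 z" "wirt (deriv H) (deriv (deriv H) z) 0 z"
    if "z \<in> S" for z
    using that S by (auto intro!: wirt_holomorphic holomorphic_derivI[where S=S] hol holGH holW holQ holomorphic_deriv)
  have wD: "wirt D (L z) (A z * cnj (deriv A z) + B z * cnj (deriv B z)) z" if z: "z \<in> S" for z
    using wirt_add[OF wirt_mult[OF d(1)[OF z] wirt_cnj[OF d(1)[OF z]]] wirt_mult[OF d(2)[OF z] wirt_cnj[OF d(2)[OF z]]]]
    unfolding D_def L_def by simp
  have ww: "wirt w (p z) (q z) z" if z: "z \<in> S" for z
  proof -
    have "wirt w ((((cnj (A z) * deriv G z) + (cnj (B z) * deriv H z)) * D z - (cnj (A z) * G z + cnj (B z) * H z) * L z) / (D z)\<^sup>2)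
       ((((cnj (deriv A z) * G z) + (cnj (deriv B z) * H z)) * D z
          - (cnj (A z) * G z + cnj (B z) * H z) * (A z * cnj (deriv A z) + B z * cnj (deriv B z))) / (D z)\<^sup>2) z"
      using wirt_divide[OF wirt_add[OF wirt_mult[OF wirt_cnj[OF d(1)[OF z]] d(3)[OF z]]
          wirt_mult[OF wirt_cnj[OF d(2)[OF z]] d(4)[OF z]]] wD[OF z] Dn[OF z]]
      unfolding wG by simp
    moreover have "(((cnj (A z) * deriv G z) + (cnj (B z) * deriv H z)) * D z - (cnj (A z) * G z + cnj (B z) * H z) * L z) / (D z)\<^sup>2 = p z"
      unfolding p_def wG using Dn[OF z] by (simp add: field_simps power2_eq_square)
    \<comment> \<open>The terms with \<open>cnj A * cnj A'\<close> and \<open>cnj B * cnj B'\<close>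
      cancel. What remains factors into \<open>cnj W\<close> and \<open>B G - A H\<close>, which is
      Q.\<close>
    moreover have "((cnj (deriv A z) * G z) + (cnj (deriv B z) * H z)) * D z
          - (cnj (A z) * G z + cnj (B z) * H z) * (A z * cnj (deriv A z) + B z * cnj (deriv B z)) = cnj (W z) * Q z"
      unfolding QGH W_def wronsk_def D_def by (simp add: algebra_simps)
    ultimately show ?thesis unfolding q_def power2_eq_square by simp
  qed
  show "C2_on S (\<lambda>z. Re (support_fun A B E z))"
    using C2_on_Re(1)[OF S ww C1p C1q] unfolding w_def .
  show "\<exists>p. wirt (support_fun A B E) p
            (cnj (wronsk A B z) * Qfun A B E z / (A z * cnj (A z) + B z * cnj (B z))\<^sup>2) z" if "z \<in> S"
    using ww[OF that] unfolding w_def q_def W_def Q_def D_def power2_eq_square by blast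
  assume nd: "null_deriv S A B E" and z: "z \<in> S"
  define \<omega> where "\<omega> = cnj (W z)"
  have om: "\<omega> = cnj (deriv A z) * cnj (B z) - cnj (A z) * cnj (deriv B z)"
    unfolding \<omega>_def W_def wronsk_def by simp
  have Q': "deriv Q z = deriv B z * G z - deriv A z * H z + B z * deriv G z - A z * deriv H z"
  proof -
    have "Q = (\<lambda>z. B z * G z - A z * H z)" using QGH by auto
    moreover have "((\<lambda>z. B z * G z - A z * H z) has_field_derivative
        deriv B z * G z - deriv A z * H z + B z * deriv G z - A z * deriv H z) (at z)"
      using holomorphic_derivI[OF hol(1) S z] holomorphic_derivI[OF hol(2) S z]
        holomorphic_derivI[OF holGH(1) S z] holomorphic_derivI[OF holGH(2) S z]
      by (auto intro!: derivative_eq_intros simp: algebra_simps)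
    ultimately show ?thesis using DERIV_imp_deriv by simp
  qed
  have q': "q z = \<omega> * (B z * G z - A z * H z) / (D z)\<^sup>2" unfolding q_def \<omega>_def QGH power2_eq_square by simp
  have w': "w z = (cnj (A z) * G z + cnj (B z) * H z) / D z" unfolding wG by simp
  have Qa: "deriv Q z * A z - 2 * (B z * G z - A z * H z) * deriv A z = - 2 * W z * G z"
    and Qb: "deriv Q z * B z - 2 * (B z * G z - A z * H z) * deriv B z = - 2 * W z * H z"
    using Qfun_identities[OF nd S z] unfolding Q_def[symmetric] W_def[symmetric] QGH[of z]
    by (auto simp: G_def H_def)
  note mixed = support_mixed_identity[OF D_def[THEN fun_cong] Dn[OF z] w' om W_def[THEN fun_cong, unfolded wronsk_def] L_def[THEN fun_cong] q' Q'
      Qa Qb]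
  have wL: "wirt L (deriv (deriv A) z * cnj (A z) + deriv (deriv B) z * cnj (B z))
       (deriv A z * cnj (deriv A z) + deriv B z * cnj (deriv B z)) z"
    using wirt_add[OF wirt_mult[OF d(7)[OF z] wirt_cnj[OF d(1)[OF z]]] wirt_mult[OF d(8)[OF z] wirt_cnj[OF d(2)[OF z]]]]
    unfolding L_def by simp
  obtain p1 where "wirt p p1 (((cnj (deriv A z) * deriv G z + cnj (deriv B z) * deriv H z
       - (q z * L z + w z * (deriv A z * cnj (deriv A z) + deriv B z * cnj (deriv B z)))) * D z
       - (cnj (A z) * deriv G z + cnj (B z) * deriv H z - w z * L z) * (A z * cnj (deriv A z) + B z * cnj (deriv B z))) / (D z)\<^sup>2) z"
    using wirt_divide[OF wirt_diff[OF wirt_add[OF wirt_mult[OF wirt_cnj[OF d(1)[OF z]] d(9)[OF z]]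
          wirt_mult[OF wirt_cnj[OF d(2)[OF z]] d(10)[OF z]]] wirt_mult[OF ww[OF z] wL]] wD[OF z] Dn[OF z]]
    unfolding p_def by auto
  then have wp: "wirt p p1 (- 2 * W z * \<omega> * w z / (D z)\<^sup>2) z" unfolding mixed(1) .
  obtain q2 where "wirt q (((cnj (W z) * deriv Q z) * (D z * D z) - cnj (W z) * Q z * (L z * D z + D z * L z)) / (D z * D z)\<^sup>2) q2 z"
    using wirt_divide[OF wirt_mult[OF wirt_cnj[OF d(5)[OF z]] d(6)[OF z]] wirt_mult[OF wD[OF z] wD[OF z]]] Dn[OF z]
    unfolding q_def by auto
  moreover have "((cnj (W z) * deriv Q z) * (D z * D z) - cnj (W z) * Q z * (L z * D z + D z * L z)) / (D z * D z)\<^sup>2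
     = - 2 * W z * \<omega> * w z / (D z)\<^sup>2"
  proof -
    have "(cnj (W z) * deriv Q z) * (D z * D z) - cnj (W z) * Q z * (L z * D z + D z * L z)
      = \<omega> * D z * (deriv Q z * D z - 2 * (B z * G z - A z * H z) * L z)"
      unfolding QGH \<omega>_def by (simp add: algebra_simps)
    also have "\<dots> = (- 2 * W z * \<omega> * w z) * (D z)\<^sup>2"
      unfolding mixed(2) by (simp add: power2_eq_square algebra_simps)
    finally show ?thesis using Dn[OF z] by (simp add: power2_eq_square)
  qed
  ultimately have wq: "wirt q (- 2 * W z * \<omega> * w z / (D z)\<^sup>2) q2 z" by simp
  have e: "- 2 * W z * \<omega> * w z / (D z)\<^sup>2 = of_real (- 2 * (cmod (W z))\<^sup>2 / ((cmod (A z))\<^sup>2 + (cmod (B z))\<^sup>2)\<^sup>2) * w z"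
  proof -
    have "W z * \<omega> = of_real ((cmod (W z))\<^sup>2)" unfolding \<omega>_def by (simp only: complex_norm_square)
    then have "- 2 * W z * \<omega> * w z / (D z)\<^sup>2 = - 2 * of_real ((cmod (W z))\<^sup>2) * w z / (D z)\<^sup>2"
      by (metis (no_types, lifting) mult.assoc)
    then show ?thesis unfolding Dre by simp
  qed
  \<comment> \<open>\<open>C2_on_Re\<close> takes the two mixed derivatives separately. They were
    computed independently as \<open>wp\<close> and \<open>wq\<close> and agree.\<close>
  have "flat_lap (\<lambda>z. Re (w z)) z = 2 * Re (- 2 * W z * \<omega> * w z / (D z)\<^sup>2 + - 2 * W z * \<omega> * w z / (D z)\<^sup>2)"
    by (rule C2_on_Re(2)[OF S ww C1p C1q z wp wq])
  also have "\<dots> = 4 * Re (- 2 * W z * \<omega> * w z / (D z)\<^sup>2)"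
  proof -
    have "2 * Re (X + X) = 4 * Re X" for X by simp
    then show ?thesis .
  qed
  also have "\<dots> = 4 * ((- 2 * (cmod (W z))\<^sup>2 / ((cmod (A z))\<^sup>2 + (cmod (B z))\<^sup>2)\<^sup>2) * Re (w z))"
    unfolding e by (simp only: Re_complex_of_real times_complex.sel Im_complex_of_real) simp
  finally show "flat_lap (\<lambda>z. Re (support_fun A B E z)) z
       = - (8 * (cmod (wronsk A B z))\<^sup>2 / ((cmod (A z))\<^sup>2 + (cmod (B z))\<^sup>2)\<^sup>2) * Re (support_fun A B E z)"
    unfolding w_def W_def by simp
qed

text \<open>Write \<open>\<tau> = (z - p)\<^sup>2 Q\<close>. The null condition reads \<open>(z - p) T = 2 \<tau>\<close>, where \<open>T p = \<tau>' p\<close> because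
  \<open>\<epsilon> k p\<close> is proportional to \<open>(B\<^sup>2, A B, A\<^sup>2)\<close>. Letting \<open>z \<rightarrow> p\<close> gives \<open>T p = 2 \<tau>' p\<close>, so \<open>\<tau>' p = 0\<close> and \<open>Q\<close>
  has a removable singularity.\<close>
lemma support_fun_converges_at_end:
  assumes e: "0 < e" and hol: "A holomorphic_on ball p e" "B holomorphic_on ball p e"
    and hol\<epsilon>: "\<And>k. k < 3 \<Longrightarrow> \<epsilon> k holomorphic_on ball p e"
    and nd: "null_deriv (ball p e - {p}) A B E"
    and E: "\<And>k z. k < 3 \<Longrightarrow> z \<in> ball p e - {p} \<Longrightarrow> E k z = \<epsilon> k z / (z - p)\<^sup>2"
    and \<epsilon>: "\<epsilon> 0 p = c * (B p)\<^sup>2" "\<epsilon> 1 p = c * (A p * B p)" "\<epsilon> 2 p = c * (A p)\<^sup>2"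
    and W: "wronsk A B p \<noteq> 0" and AB: "A p \<noteq> 0 \<or> B p \<noteq> 0"
  shows "\<exists>l. (support_fun A B E \<longlongrightarrow> l) (at p)"
proof -
  let ?S = "ball p e - {p}"
  have S: "open ?S" by auto
  have pe: "p \<in> ball p e" using e by simp
  define T where "T = Qfun A B (\<lambda>k. deriv (\<epsilon> k))"
  define \<tau> where "\<tau> = Qfun A B \<epsilon>"
  define Q where "Q = Qfun A B E"
  have ev: "eventually (\<lambda>z. z \<in> ?S) (at p)"
    using eventually_at_in_open[of "ball p e" p] e by auto
  have h\<epsilon>: "\<epsilon> 0 holomorphic_on ball p e" "\<epsilon> 1 holomorphic_on ball p e" "\<epsilon> 2 holomorphic_on ball p e"
    using hol\<epsilon> by auto
  have holT: "T holomorphic_on ball p e"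
    unfolding T_def Qfun_def[abs_def] by (intro holomorphic_intros hol h\<epsilon>) auto
  have dE: "deriv (E k) z = deriv (\<epsilon> k) z / (z - p)\<^sup>2 - 2 * \<epsilon> k z / (z - p)^3"
    if k: "k < 3" and z: "z \<in> ?S" for k z
  proof (rule DERIV_imp_deriv)
    have "z \<noteq> p" using z by auto
    have "(\<epsilon> k has_field_derivative deriv (\<epsilon> k) z) (at z)"
      using z by (intro holomorphic_derivI[OF hol\<epsilon>[OF k]]) auto
    then have D: "((\<lambda>z. \<epsilon> k z / (z - p)\<^sup>2) has_field_derivative
          (deriv (\<epsilon> k) z * (z - p)\<^sup>2 - \<epsilon> k z * (2 * (z - p))) / ((z - p)\<^sup>2 * (z - p)\<^sup>2)) (at z)"
      using \<open>z \<noteq> p\<close> by (auto intro!: derivative_eq_intros)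
    have alg: "(a * \<zeta>\<^sup>2 - b * (2 * \<zeta>)) / (\<zeta>\<^sup>2 * \<zeta>\<^sup>2) = a / \<zeta>\<^sup>2 - 2 * b / \<zeta>^3" if "\<zeta> \<noteq> 0" for a b \<zeta> :: complex
      using that by (simp add: field_simps power2_eq_square power3_eq_cube)
    have "((\<lambda>z. \<epsilon> k z / (z - p)\<^sup>2) has_field_derivative
          deriv (\<epsilon> k) z / (z - p)\<^sup>2 - 2 * \<epsilon> k z / (z - p)^3) (at z)"
      by (rule DERIV_cong[OF D alg]) (use \<open>z \<noteq> p\<close> in simp)
    then show "(E k has_field_derivative
          deriv (\<epsilon> k) z / (z - p)\<^sup>2 - 2 * \<epsilon> k z / (z - p)^3) (at z)"
      by (rule has_field_derivative_transform_within_open[OF _ S z]) (use E[OF k] in auto)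
  qed
  \<comment> \<open>The null condition for \<open>deriv (E k) = deriv (\<epsilon> k) / (z - p)^2 - 2
    * \<epsilon> k / (z - p)^3\<close>, cleared of its poles.\<close>
  have rel: "(z - p) * T z = 2 * \<tau> z" if z: "z \<in> ?S" for z
  proof -
    have "z \<noteq> p" using z by auto
    have "Qfun A B (\<lambda>k. deriv (E k)) z = 0" using nd z unfolding null_deriv_def by blast
    moreover have "Qfun A B (\<lambda>k. deriv (E k)) z * (z - p)^3 = (z - p) * T z - 2 * \<tau> z"
    proof -
      obtain \<zeta> where \<zeta>: "z - p = \<zeta>" by blast
      then have "\<zeta> \<noteq> 0" using \<open>z \<noteq> p\<close> by auto
      then show ?thesis unfolding Qfun_def T_def \<tau>_def
        by (simp add: dE[OF _ z] \<zeta> field_simps power2_eq_square power3_eq_cube)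
    qed
    ultimately show ?thesis by simp
  qed
  have \<tau>p: "\<tau> p = 0" unfolding \<tau>_def Qfun_def \<epsilon> by (simp add: algebra_simps power2_eq_square)
  have "(\<tau> has_field_derivative T p) (at p)"
  proof -
    have d [derivative_intros]: "(A has_field_derivative deriv A p) (at p)" "(B has_field_derivative deriv B p) (at p)"
      "(\<epsilon> 0 has_field_derivative deriv (\<epsilon> 0) p) (at p)" "(\<epsilon> 1 has_field_derivative deriv (\<epsilon> 1) p) (at p)"
      "(\<epsilon> 2 has_field_derivative deriv (\<epsilon> 2) p) (at p)"
      using pe by (auto intro!: holomorphic_derivI[where S="ball p e"] hol h\<epsilon>[simplified])
    show ?thesis unfolding \<tau>_def Qfun_def[abs_def]
      apply (rule DERIV_cong)
       apply (rule derivative_intros d)+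
      unfolding T_def Qfun_def \<epsilon> by (simp add: algebra_simps power2_eq_square)
  qed
  then have lim: "((\<lambda>z. \<tau> z / (z - p)) \<longlongrightarrow> T p) (at p)"
    using \<tau>p by (simp add: has_field_derivative_iff)
  have "((\<lambda>z. 2 * (\<tau> z / (z - p))) \<longlongrightarrow> 2 * T p) (at p)" by (intro tendsto_intros lim)
  moreover have "eventually (\<lambda>z. 2 * (\<tau> z / (z - p)) = T z) (at p)"
    using ev by eventually_elim (use rel in \<open>auto simp: field_simps\<close>)
  ultimately have "(T \<longlongrightarrow> 2 * T p) (at p)" by (rule Lim_transform_eventually)
  moreover have "(T \<longlongrightarrow> T p) (at p)"
    using holT e by (metis pe centre_in_ball continuous_on_eq_continuous_at holomorphic_on_imp_continuous_on
        isContD open_ball)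
  ultimately have "2 * T p = T p" using tendsto_unique trivial_limit_at by blast
  then have Tp: "T p = 0" by simp
  have "((\<lambda>z. (z - p) * Q z) \<longlongrightarrow> 0) (at p)"
  proof (rule Lim_transform_eventually[OF lim[unfolded Tp]])
    show "\<forall>\<^sub>F z in at p. \<tau> z / (z - p) = (z - p) * Q z" using ev
    proof eventually_elim
      case (elim z)
      obtain \<zeta> where \<zeta>: "z - p = \<zeta>" by blast
      then have "\<zeta> \<noteq> 0" using elim by auto
      then show ?case unfolding \<tau>_def Q_def Qfun_def
        by (simp add: E[OF _ elim] \<zeta> field_simps power2_eq_square)
    qed
  qed
  then obtain g where g: "g holomorphic_on ball p e" "\<And>z. z \<in> ?S \<Longrightarrow> g z = Q z"
    using holomorphic_on_extend_lim[of Q "ball p e" p] Qfun_holomorphic[OF nd S] e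
    unfolding Q_def by auto
  have dg: "deriv g z = deriv Q z" if "z \<in> ?S" for z
  proof (rule deriv_cong_ev)
    show "\<forall>\<^sub>F z in nhds z. g z = Q z"
      using eventually_nhds_in_open[OF S that] by eventually_elim (rule g(2))
  qed simp
  \<comment> \<open>\<open>Qfun_identities\<close> solved for the two factors, with the extension
    \<open>g\<close> in place of Q. Since \<open>wronsk A B p\<close> is nonzero, these formulas are
    continuous at \<open>p\<close>, although E itself has a pole there.\<close>
  define G where "G z = - (deriv g z * A z - 2 * g z * deriv A z) / (2 * wronsk A B z)" for z
  define H where "H z = - (deriv g z * B z - 2 * g z * deriv B z) / (2 * wronsk A B z)" for z
  define w where "w z = (cnj (A z) * G z + cnj (B z) * H z) / (A z * cnj (A z) + B z * cnj (B z))" for z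
  have cont: "isCont f p" if "f holomorphic_on ball p e" for f
    using that e by (metis pe continuous_on_eq_continuous_at holomorphic_on_imp_continuous_on open_ball)
  have "isCont A p" "isCont B p" "isCont g p" "isCont (deriv A) p" "isCont (deriv B) p" "isCont (deriv g) p"
    by (auto intro!: cont hol g holomorphic_deriv)
  note cs = this
  have cW: "isCont (wronsk A B) p" unfolding wronsk_def[abs_def] by (intro continuous_intros cs)
  have D: "A p * cnj (A p) + B p * cnj (B p) \<noteq> 0"
  proof -
    have "A p * cnj (A p) + B p * cnj (B p) = of_real ((cmod (A p))\<^sup>2 + (cmod (B p))\<^sup>2)"
      by (simp only: complex_norm_square of_real_add)
    then show ?thesis using AB by (simp only: of_real_eq_0_iff) (auto simp: add_nonneg_eq_0_iff)
  qed
  have "isCont w p" unfolding w_def[abs_def] G_def[abs_def] H_def[abs_def]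
    by (intro continuous_intros cs cW isCont_cnj) (use W D in auto)
  then have "(w \<longlongrightarrow> w p) (at p)" by (simp add: isContD)
  moreover have "eventually (\<lambda>z. wronsk A B z \<noteq> 0) (at p)"
    using cW W by (simp add: isCont_def tendsto_imp_eventually_ne)
  then have "eventually (\<lambda>z. w z = support_fun A B E z) (at p)" using ev
  proof eventually_elim
    case (elim z)
    have "G z = A z * E 1 z - B z * E 2 z" "H z = A z * E 0 z - B z * E 1 z"
      using Qfun_identities[OF nd S elim(2)] elim(1) unfolding G_def H_def dg[OF elim(2)] g(2)[OF elim(2)] Q_def
      by auto
    then show ?case unfolding w_def support_fun_def by simp
  qed
  ultimately show ?thesis using Lim_transform_eventually by blast
qed

section \<open>Bounded Jacobi fields\<close>

definition ends :: "nat \<Rightarrow> (nat \<Rightarrow> complex) \<Rightarrow> complex set" where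
  "ends n x = pt x ` {..<n}"

lemma finite_ends [simp]: "finite (ends n x)" unfolding ends_def by simp

lemma open_compl_ends [simp]: "open (- ends n x)"
  by (simp add: finite_imp_closed open_Compl)

lemma polyA_holomorphic [holomorphic_intros]: "polyA n x holomorphic_on S"
  unfolding polyA_def[abs_def] by (intro holomorphic_intros)

lemma polyB_holomorphic [holomorphic_intros]: "polyB n x holomorphic_on S"
  unfolding polyB_def[abs_def] by (intro holomorphic_intros)

lemma prodP_nonzero_iff: "prodP n x z \<noteq> 0 \<longleftrightarrow> z \<notin> ends n x"
  unfolding prodP_def ends_def by auto

text \<open>The leading coefficient is tangent to the surface: it comes from moving the end.\<close>
definition regular_at :: "nat \<Rightarrow> (nat \<Rightarrow> complex) \<Rightarrow> (nat \<Rightarrow> complex \<Rightarrow> complex) \<Rightarrow> complex \<Rightarrow> bool" where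
  "regular_at n x E p \<longleftrightarrow> (\<exists>e>0. \<exists>\<epsilon> c. (\<forall>k<3. \<epsilon> k holomorphic_on ball p e \<and>
        (\<forall>z\<in>ball p e - {p}. E k z = \<epsilon> k z / (z - p)\<^sup>2)) \<and>
      \<epsilon> 0 p = c * (polyB n x p)\<^sup>2 \<and> \<epsilon> 1 p = c * (polyA n x p * polyB n x p) \<and> \<epsilon> 2 p = c * (polyA n x p)\<^sup>2)"

definition regular_at_infinity :: "(nat \<Rightarrow> complex \<Rightarrow> complex) \<Rightarrow> bool" where
  "regular_at_infinity E \<longleftrightarrow> (\<exists>e>0. \<exists>\<epsilon>. \<forall>k<3. \<epsilon> k holomorphic_on ball 0 e \<and>
     (\<forall>w\<in>ball 0 e - {0}. E k (1 / w) = \<epsilon> k w))"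

section \<open>The support function near infinity and the boundedness of the Jacobi field\<close>

lemma sum_reverse_poly:
  fixes a :: "nat \<Rightarrow> complex"
  assumes "w \<noteq> 0"
  shows "(\<Sum>i<n. a i * (1 / w) ^ (n - 1 - i)) = (\<Sum>i<n. a i * w ^ i) / w ^ (n - 1)"
  unfolding sum_divide_distrib
proof (rule sum.cong)
  fix i assume "i \<in> {..<n}"
  then have "n - 1 = (n - 1 - i) + i" by auto
  then have "w ^ (n - 1) = w ^ (n - 1 - i) * w ^ i" by (metis power_add)
  then show "a i * (1 / w) ^ (n - 1 - i) = a i * w ^ i / w ^ (n - 1)"
    using assms by (simp add: field_simps power_divide)
qed simp

text \<open>Numerator and denominator both scale by \<open>c * cnj c\<close>: the normal depends
  only on the ratio A / B.\<close>

lemma support_fun_rescale: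
  assumes "c \<noteq> 0" "A z = c * A' w" "B z = c * B' w" "\<And>k. k < 3 \<Longrightarrow> E k z = E' k w"
  shows "support_fun A B E z = support_fun A' B' E' w"
proof -
  have E: "E 0 z = E' 0 w" "E 1 z = E' 1 w" "E 2 z = E' 2 w" using assms(4) by auto
  have "support_fun A B E z = ((c * cnj c) * (cnj (A' w) * (A' w * E' 1 w - B' w * E' 2 w) + cnj (B' w) * (A' w * E' 0 w - B' w * E' 1 w)))
       / ((c * cnj c) * (A' w * cnj (A' w) + B' w * cnj (B' w)))"
    unfolding support_fun_def assms(2,3) E by (simp add: algebra_simps)
  also have "\<dots> = support_fun A' B' E' w"
    unfolding support_fun_def using assms(1) by (intro nonzero_mult_divide_mult_cancel_left) auto
  finally show ?thesis .
qed

text \<open>Multiplication of A (1/w) and B (1/w) by \<open>w ^ (n - 1)\<close> gives the reversed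
  polynomials A', B'. Their values at 0 are the leading coefficients, so by \<open>lead\<close> they
  have no common zero near 0, and the smoothness statement for a finite point applies to
  them.\<close>

lemma support_fun_C2_at_infinity:
  assumes n: "2 \<le> n" and lead: "coef_a x 0 \<noteq> 0 \<or> coef_b x 0 \<noteq> 0"
    and E: "regular_at_infinity E"
  shows "\<exists>c e. 0 < e \<and> C2_on (ball 0 e) (\<lambda>w. if w = 0 then c else Re (support_fun (polyA n x) (polyB n x) E (1 / w)))"
proof -
  obtain e1 \<epsilon> where e1: "e1 > 0" and hol: "\<And>k. k < 3 \<Longrightarrow> \<epsilon> k holomorphic_on ball 0 e1"
    and Ee: "\<And>k w. k < 3 \<Longrightarrow> w \<in> ball 0 e1 - {0} \<Longrightarrow> E k (1 / w) = \<epsilon> k w"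
    using E unfolding regular_at_infinity_def by metis
  define A' where "A' w = (\<Sum>i<n. coef_a x i * w ^ i)" for w
  define B' where "B' w = (\<Sum>i<n. coef_b x i * w ^ i)" for w
  have holAB: "A' holomorphic_on T" "B' holomorphic_on T" for T
    unfolding A'_def[abs_def] B'_def[abs_def] by (intro holomorphic_intros)+
  have A0: "A' 0 = coef_a x 0"
  proof -
    have "A' 0 = (\<Sum>i<n. if i = 0 then coef_a x 0 else 0)" unfolding A'_def by (intro sum.cong) auto
    then show ?thesis using n by simp
  qed
  have B0: "B' 0 = coef_b x 0"
  proof -
    have "B' 0 = (\<Sum>i<n. if i = 0 then coef_b x 0 else 0)" unfolding B'_def by (intro sum.cong) auto
    then show ?thesis using n by simp
  qed
  define V where "V = ({w. A' w \<noteq> 0} \<union> {w. B' w \<noteq> 0})"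
  have "continuous_on UNIV A'" "continuous_on UNIV B'"
    using holAB holomorphic_on_imp_continuous_on by blast+
  then have "open V" unfolding V_def
    by (intro open_Un open_Collect_neq continuous_on_const)
  moreover have "0 \<in> V" unfolding V_def using lead A0 B0 by auto
  ultimately obtain e2 where e2: "e2 > 0" "ball 0 e2 \<subseteq> V" by (meson openE)
  define e where "e = min e1 e2"
  have e: "e > 0" "ball 0 e \<subseteq> ball 0 e1" "ball 0 e \<subseteq> V" using e1 e2 unfolding e_def by auto
  have "C2_on (ball 0 e) (\<lambda>w. Re (support_fun A' B' \<epsilon> w))"
    by (rule support_fun_jacobi(1)) (use e hol holAB in \<open>auto simp: V_def intro: holomorphic_on_subset\<close>)
  then have "C2_on (ball 0 e) (\<lambda>w. if w = 0 then Re (support_fun A' B' \<epsilon> 0) else Re (support_fun (polyA n x) (polyB n x) E (1 / w)))"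
  proof (rule C2_on_cong)
    fix w :: complex assume w: "w \<in> ball 0 e"
    show "Re (support_fun A' B' \<epsilon> w) = (if w = 0 then Re (support_fun A' B' \<epsilon> 0) else Re (support_fun (polyA n x) (polyB n x) E (1 / w)))"
    proof (cases "w = 0")
      case False
      have "support_fun (polyA n x) (polyB n x) E (1 / w) = support_fun A' B' \<epsilon> w"
        by (rule support_fun_rescale[of "1 / w ^ (n - 1)"])
          (use False w e in \<open>auto simp: polyA_def polyB_def A'_def B'_def sum_reverse_poly[OF False, of _ n, simplified]
             intro!: Ee\<close>)
      then show ?thesis using False by simp
    qed auto
  qed auto
  then show ?thesis using e(1) by blast
qed

lemma C2_on_imp_isCont:
  assumes "C2_on S u" "z \<in> S" shows "isCont u z"
  using assms unfolding C2_on_def by (meson has_derivative_continuous)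

lemma C2_on_subset:
  assumes "C2_on S u" "T \<subseteq> S" shows "C2_on T u"
proof -
  obtain Du D2u where "\<forall>z\<in>S. (u has_derivative blinfun_apply (Du z)) (at z) \<and>
                (Du has_derivative blinfun_apply (D2u z)) (at z)" "continuous_on S D2u"
    using assms(1) unfolding C2_on_def by blast
  then have "\<forall>z\<in>T. (u has_derivative blinfun_apply (Du z)) (at z) \<and>
                (Du has_derivative blinfun_apply (D2u z)) (at z)" "continuous_on T D2u"
    using assms(2) continuous_on_subset by auto
  then show ?thesis unfolding C2_on_def by blast
qed

text \<open>Compactness of the sphere: u is bounded near each point of P by its limit and near
  infinity by continuity in 1/z, and what is left is the compact set K.\<close>

lemma bounded_from_ends:
  fixes u :: "complex \<Rightarrow> real"
  assumes P: "finite P" and cont: "continuous_on (- P) u"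
    and ends: "\<And>p. p \<in> P \<Longrightarrow> \<exists>l. (u \<longlongrightarrow> l) (at p)"
    and inf: "isCont (\<lambda>w. if w = 0 then c else u (1 / w)) 0"
  shows "bounded (u ` (- P))"
proof -
  have "\<exists>d>0. bounded (u ` (ball p d - {p}))" if p: "p \<in> P" for p
  proof -
    obtain l where "(u \<longlongrightarrow> l) (at p)" using ends[OF p] by blast
    then have "eventually (\<lambda>z. dist (u z) l < 1) (at p)" by (simp add: tendstoD)
    then obtain d where d: "d > 0" "\<And>z. z \<noteq> p \<Longrightarrow> dist z p < d \<Longrightarrow> dist (u z) l < 1"
      unfolding eventually_at by auto
    have "u z \<in> ball l 1" if "z \<in> ball p d - {p}" for z
      using d(2)[of z] that by (simp add: dist_commute)
    then have "u ` (ball p d - {p}) \<subseteq> ball l 1" by blast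
    then show ?thesis using d(1) bounded_subset bounded_ball by blast
  qed
  then obtain d where d: "\<And>p. p \<in> P \<Longrightarrow> d p > 0" "\<And>p. p \<in> P \<Longrightarrow> bounded (u ` (ball p (d p) - {p}))"
    by metis
  have "eventually (\<lambda>w. dist (if w = 0 then c else u (1 / w)) c < 1) (at 0)"
    using inf unfolding isCont_def by (intro tendstoD) auto
  then obtain s where s: "s > 0" "\<And>w. w \<noteq> 0 \<Longrightarrow> dist w 0 < s \<Longrightarrow> dist (if w = 0 then c else u (1 / w)) c < 1"
    unfolding eventually_at by auto
  define R where "R = 1 / s"
  have big: "u z \<in> ball c 1" if "R < cmod z" for z
  proof -
    have z: "1 < cmod z * s" using that s(1) unfolding R_def by (simp add: divide_less_eq)
    then have "z \<noteq> 0" by auto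
    then have "dist (1 / z) 0 < s" using z by (simp add: norm_divide divide_less_eq mult.commute)
    then have "dist (if 1 / z = 0 then c else u (1 / (1 / z))) c < 1"
      using s(2)[of "1 / z"] \<open>z \<noteq> 0\<close> by simp
    then show ?thesis using \<open>z \<noteq> 0\<close> by (simp add: dist_commute)
  qed
  define K where "K = cball 0 R - (\<Union>p\<in>P. ball p (d p))"
  have "compact K" unfolding K_def by (intro compact_diff open_UN ballI open_ball compact_cball)
  moreover have "K \<subseteq> - P" unfolding K_def using d(1) by force
  ultimately have "bounded (u ` K)"
    using cont by (meson compact_continuous_image compact_imp_bounded continuous_on_subset)
  moreover have "bounded (\<Union>p\<in>P. u ` (ball p (d p) - {p}))" using P d(2) by (simp add: bounded_UN)
  moreover have "u ` (- P) \<subseteq> u ` K \<union> (\<Union>p\<in>P. u ` (ball p (d p) - {p})) \<union> ball c 1"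
  proof
    fix y assume "y \<in> u ` (- P)"
    then obtain z where z: "z \<notin> P" "y = u z" by auto
    show "y \<in> u ` K \<union> (\<Union>p\<in>P. u ` (ball p (d p) - {p})) \<union> ball c 1"
    proof (cases "R < cmod z")
      case True then show ?thesis using big z by auto
    next
      case False
      show ?thesis
      proof (cases "\<exists>p\<in>P. z \<in> ball p (d p)")
        case True then show ?thesis using z by blast
      next
        case F: False
        then have "z \<in> K" using False unfolding K_def by simp
        then show ?thesis using z by blast
      qed
    qed
  qed
  ultimately show ?thesis by (meson bounded_Un bounded_ball bounded_subset)
qed

lemma nnoid_dataD:
  assumes "nnoid_data n x"
  shows "2 \<le> n" "inj_on (pt x) {..<n}" "polyA n x z \<noteq> 0 \<or> polyB n x z \<noteq> 0"
    "coef_a x 0 \<noteq> 0 \<or> coef_b x 0 \<noteq> 0"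
    "\<And>p. p \<in> ends n x \<Longrightarrow> polyA n x p \<noteq> 0 \<and> polyB n x p \<noteq> 0"
  using assms unfolding nnoid_data_def ends_def by auto

text \<open>The value 0 at the ends is the normalization required in
  \<open>bounded_jacobi_fields\<close>.\<close>

definition jacobi_of :: "nat \<Rightarrow> (nat \<Rightarrow> complex) \<Rightarrow> (nat \<Rightarrow> complex \<Rightarrow> complex) \<Rightarrow> complex \<Rightarrow> real" where
  "jacobi_of n x E z = (if z \<in> ends n x then 0 else Re (support_fun (polyA n x) (polyB n x) E z))"

definition admissible :: "nat \<Rightarrow> (nat \<Rightarrow> complex) \<Rightarrow> (nat \<Rightarrow> complex \<Rightarrow> complex) \<Rightarrow> bool" where
  "admissible n x E \<longleftrightarrow> null_deriv (- ends n x) (polyA n x) (polyB n x) E \<and>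
     (\<forall>p\<in>ends n x. regular_at n x E p) \<and> regular_at_infinity E"

lemma jacobi_of_mem:
  assumes nn: "nnoid_data n x" and E: "admissible n x E"
    and W: "\<And>p. p \<in> ends n x \<Longrightarrow> wronsk (polyA n x) (polyB n x) p \<noteq> 0"
  shows "jacobi_of n x E \<in> bounded_jacobi_fields n x"
proof -
  let ?S = "- ends n x" and ?A = "polyA n x" and ?B = "polyB n x"
  let ?v = "\<lambda>z. Re (support_fun ?A ?B E z)" and ?u = "jacobi_of n x E"
  have nd: "null_deriv ?S ?A ?B E" using E unfolding admissible_def by blast
  have holE: "E k holomorphic_on ?S" if "k < 3" for k using nd that unfolding null_deriv_def by blast
  have D0: "?A z \<noteq> 0 \<or> ?B z \<noteq> 0" for z by (rule nnoid_dataD(3)[OF nn])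
  note J = support_fun_jacobi[where S="?S" and A="?A" and B="?B" and E=E, OF polyA_holomorphic polyB_holomorphic holE open_compl_ends D0]
  have uv: "?u z = ?v z" if "z \<in> ?S" for z using that unfolding jacobi_of_def by simp
  have C2v: "C2_on ?S ?v" by (rule J(1)) auto
  have C2: "C2_on ?S ?u" by (rule C2_on_cong[OF C2v]) (use uv in auto)
  obtain c e where ce: "0 < e" "C2_on (ball 0 e) (\<lambda>w. if w = 0 then c else ?v (1 / w))"
    using support_fun_C2_at_infinity[OF nnoid_dataD(1,4)[OF nn]] E unfolding admissible_def by blast
  obtain R where R: "R > 0" "\<And>p. p \<in> ends n x \<Longrightarrow> cmod p < R"
    using finite_imp_bounded[OF finite_ends[of n x]] unfolding bounded_pos_less by auto
  \<comment> \<open>The bound \<open>1 / R\<close> keeps \<open>1 / w\<close> away from the ends,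
    where \<open>jacobi_of\<close> has its artificial value 0.\<close>
  define e' where "e' = min e (1 / R)"
  have e': "0 < e'" "e' \<le> e" "e' \<le> 1 / R" unfolding e'_def using ce R by auto
  have C2i: "C2_on (ball 0 e') (\<lambda>w. if w = 0 then c else ?u (1 / w))"
  proof (rule C2_on_cong)
    show "C2_on (ball 0 e') (\<lambda>w. if w = 0 then c else ?v (1 / w))"
      by (rule C2_on_subset[OF ce(2)]) (use e'(2) in auto)
    fix w :: complex assume w: "w \<in> ball 0 e'"
    have "1 / w \<notin> ends n x" if "w \<noteq> 0"
    proof
      assume "1 / w \<in> ends n x"
      then have "1 / cmod w < R" using R(2) by (metis norm_divide norm_one)
      moreover have "cmod w < 1 / R" using w e' by simp
      ultimately show False using that R(1) by (simp add: field_simps)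
    qed
    then show "(if w = 0 then c else ?v (1 / w)) = (if w = 0 then c else ?u (1 / w))"
      using uv by simp
  qed auto
  have jac: "jacobi_eq_at n x ?u z" if z: "z \<in> ?S" for z
  proof -
    define D where "D = (cmod (?A z))\<^sup>2 + (cmod (?B z))\<^sup>2"
    define m where "m = cmod (wronsk ?A ?B z)"
    define k where "k = cmod (prodP n x z)"
    have "D \<noteq> 0" unfolding D_def using nnoid_dataD(3)[OF nn, of z] by (auto simp: add_nonneg_eq_0_iff)
    moreover have "k \<noteq> 0" unfolding k_def using z prodP_nonzero_iff by auto
    \<comment> \<open>Division by \<open>(confW)^2 = (D / (2 k))^2\<close> turns this into
      \<open>- 32 m^2 k^2 / D^4\<close> times u, and \<open>sffW\<close> is
      \<open>32 m^2 k^2 / D^4\<close>.\<close>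
    moreover have "flat_lap ?u z = - (8 * m\<^sup>2 / D\<^sup>2) * ?u z"
      using J(2)[OF _ nd z] flat_lap_cong[OF open_compl_ends z uv] uv[OF z] unfolding m_def D_def by simp
    ultimately show ?thesis unfolding jacobi_eq_at_def confW_def sffW_def D_def[symmetric]
        wronsk_def[symmetric] m_def[symmetric] k_def[symmetric]
      by (simp add: field_simps power2_eq_square)
  qed
  have lim: "\<exists>l. (?u \<longlongrightarrow> l) (at p)" if p: "p \<in> ends n x" for p
  proof -
    obtain e1 \<epsilon> c1 where e1: "e1 > 0" and
      \<epsilon>: "\<And>k. k < 3 \<Longrightarrow> \<epsilon> k holomorphic_on ball p e1"
         "\<And>k z. k < 3 \<Longrightarrow> z \<in> ball p e1 - {p} \<Longrightarrow> E k z = \<epsilon> k z / (z - p)\<^sup>2"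
         "\<epsilon> 0 p = c1 * (?B p)\<^sup>2" "\<epsilon> 1 p = c1 * (?A p * ?B p)" "\<epsilon> 2 p = c1 * (?A p)\<^sup>2"
      using E p unfolding admissible_def regular_at_def by metis
    have "open (- (ends n x - {p}))" by (intro open_Compl finite_imp_closed finite_Diff finite_ends)
    moreover have "p \<in> - (ends n x - {p})" by simp
    ultimately obtain e2 where e2: "e2 > 0" "ball p e2 \<subseteq> - (ends n x - {p})" by (meson openE)
    define e where "e = min e1 e2"
    have e: "0 < e" "ball p e \<subseteq> ball p e1" "ball p e - {p} \<subseteq> ?S"
      using e1 e2 unfolding e_def by auto
    have "\<exists>l. (support_fun ?A ?B E \<longlongrightarrow> l) (at p)"
    proof (rule support_fun_converges_at_end[OF e(1)])
      show "null_deriv (ball p e - {p}) ?A ?B E"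
        using nd e(3) unfolding null_deriv_def by (meson holomorphic_on_subset subsetD)
      show "\<epsilon> k holomorphic_on ball p e" if "k < 3" for k
        using \<epsilon>(1)[OF that] e(2) holomorphic_on_subset by blast
      show "E k z = \<epsilon> k z / (z - p)\<^sup>2" if "k < 3" "z \<in> ball p e - {p}" for k z
        using \<epsilon>(2) that e(2) by blast
    qed (use \<epsilon>(3-5) W[OF p] nnoid_dataD(3)[OF nn] in \<open>auto intro: holomorphic_intros\<close>)
    then obtain l where "(support_fun ?A ?B E \<longlongrightarrow> l) (at p)" by blast
    then have "(?v \<longlongrightarrow> Re l) (at p)" by (rule tendsto_Re)
    moreover have "eventually (\<lambda>z. ?v z = ?u z) (at p)"
      using eventually_at_in_open[of "ball p e" p] e by (auto elim!: eventually_mono simp: uv subset_iff)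
    ultimately show ?thesis using Lim_transform_eventually by blast
  qed
  have bdd: "bounded (?u ` ?S)"
  proof (rule bounded_from_ends[OF finite_ends _ lim])
    show "continuous_on ?S ?u" using C2_on_imp_isCont[OF C2] by (simp add: continuous_at_imp_continuous_on)
    show "isCont (\<lambda>w. if w = 0 then c else ?u (1 / w)) 0"
      by (rule C2_on_imp_isCont[OF C2i]) (use e' in auto)
  qed
  have "?u z = 0" if "z \<in> pt x ` {..<n}" for z using that unfolding jacobi_of_def ends_def by simp
  then show ?thesis unfolding bounded_jacobi_fields_def Let_def
    using C2 C2i e'(1) jac bdd unfolding ends_def[symmetric] Compl_eq_Diff_UNIV by blast
qed

text \<open>If w = 0, its derivative by \<open>cnj z\<close> vanishes too, hence Q = 0 wherever
  \<open>wronsk\<close> is nonzero. This holds on a neighbourhood of \<open>z\<close>, so Q' = 0 at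
  \<open>z\<close>, and \<open>Qfun_identities\<close> gives both relations. They say that (E 0, E
  1, E 2) is proportional to (B^2, AB, A^2), that is, X is tangential.\<close>

lemma support_fun_vanish:
  assumes nd: "null_deriv S A B E" and S: "open S"
    and D0: "\<And>z. z \<in> S \<Longrightarrow> A z \<noteq> 0 \<or> B z \<noteq> 0"
    and 0: "\<And>z. z \<in> S \<Longrightarrow> support_fun A B E z = 0"
    and z: "z \<in> S" "wronsk A B z \<noteq> 0"
  shows "A z * E 1 z = B z * E 2 z" "A z * E 0 z = B z * E 1 z"
proof -
  have hol: "A holomorphic_on S" "B holomorphic_on S" "\<And>k. k < 3 \<Longrightarrow> E k holomorphic_on S"
    using nd unfolding null_deriv_def by auto
  have W: "wronsk A B holomorphic_on S" unfolding wronsk_def[abs_def] by (intro holomorphic_intros hol S)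
  define U where "U = S \<inter> wronsk A B -` (- {0})"
  have U: "open U" unfolding U_def
    by (intro continuous_open_preimage holomorphic_on_imp_continuous_on W S) auto
  have zU: "z \<in> U" unfolding U_def using z by simp
  have Q0: "Qfun A B E y = 0" if y: "y \<in> U" for y
  proof -
    have yS: "y \<in> S" and Wy: "wronsk A B y \<noteq> 0" using y unfolding U_def by auto
    obtain p where p: "wirt (support_fun A B E) p
            (cnj (wronsk A B y) * Qfun A B E y / (A y * cnj (A y) + B y * cnj (B y))\<^sup>2) y"
      using support_fun_jacobi(3)[where E=E, OF hol S D0] yS by blast
    have "wirt (\<lambda>_. 0) 0 0 y" by (rule wirt_holomorphic) simp
    then have "wirt (support_fun A B E) 0 0 y"
      by (rule wirt_transform[OF _ S yS]) (simp add: 0)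
    then have "cnj (wronsk A B y) * Qfun A B E y / (A y * cnj (A y) + B y * cnj (B y))\<^sup>2 = 0"
      using wirt_unique(2)[OF p] by blast
    moreover have "A y * cnj (A y) + B y * cnj (B y) \<noteq> 0"
    proof -
      have "A y * cnj (A y) + B y * cnj (B y) = of_real ((cmod (A y))\<^sup>2 + (cmod (B y))\<^sup>2)"
        by (simp only: complex_norm_square of_real_add)
      then show ?thesis using D0[OF yS] by (simp only: of_real_eq_0_iff) (auto simp: add_nonneg_eq_0_iff)
    qed
    ultimately show ?thesis using Wy by simp
  qed
  have "deriv (Qfun A B E) z = deriv (\<lambda>_. 0) z"
  proof (rule deriv_cong_ev)
    show "\<forall>\<^sub>F y in nhds z. Qfun A B E y = 0"
      using eventually_nhds_in_open[OF U zU] by eventually_elim (rule Q0)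
  qed simp
  then have "deriv (Qfun A B E) z = 0" by simp
  then show "A z * E 1 z = B z * E 2 z" "A z * E 0 z = B z * E 1 z"
    using Qfun_identities[OF nd S z(1)] Q0[OF zU] z(2) by simp_all
qed

section \<open>Linearity, and translations as bounded Jacobi fields\<close>

lemma support_fun_linear:
  "support_fun A B (\<lambda>k z. a * E k z + b * E' k z) z = a * support_fun A B E z + b * support_fun A B E' z"
  unfolding support_fun_def by (simp add: algebra_simps add_divide_distrib diff_divide_distrib)

lemma admissible_const: "admissible n x (\<lambda>k z. c k)"
  unfolding admissible_def
proof (intro conjI ballI)
  show "null_deriv (- ends n x) (polyA n x) (polyB n x) (\<lambda>k z. c k)"
    unfolding null_deriv_def Qfun_def by (auto intro: holomorphic_intros)
  show "regular_at_infinity (\<lambda>k z. c k)"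
    unfolding regular_at_infinity_def by (rule exI[of _ 1]) (auto intro!: exI[of _ "\<lambda>k z. c k"])
  show "regular_at n x (\<lambda>k z. c k) p" for p
    unfolding regular_at_def
    by (rule exI[of _ 1], rule conjI, simp, rule exI[of _ "\<lambda>k z. c k * (z - p)\<^sup>2"], rule exI[of _ 0])
       (auto intro!: holomorphic_intros)
qed

lemma null_deriv_linear:
  assumes "null_deriv S A B E" "null_deriv S A B E'" "open S"
  shows "null_deriv S A B (\<lambda>k z. a * E k z + b * E' k z)"
  unfolding null_deriv_def
proof (intro conjI allI impI ballI)
  show "(\<lambda>z. a * E k z + b * E' k z) holomorphic_on S" if "k < 3" for k
    using assms that unfolding null_deriv_def by (auto intro!: holomorphic_intros)
  fix z assume z: "z \<in> S"
  have "deriv (\<lambda>z. a * E k z + b * E' k z) z = a * deriv (E k) z + b * deriv (E' k) z" if "k < 3" for k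
  proof (rule DERIV_imp_deriv)
    have "(E k has_field_derivative deriv (E k) z) (at z)" "(E' k has_field_derivative deriv (E' k) z) (at z)"
      using assms that z unfolding null_deriv_def by (auto intro!: holomorphic_derivI)
    then show "((\<lambda>z. a * E k z + b * E' k z) has_field_derivative a * deriv (E k) z + b * deriv (E' k) z) (at z)"
      by (auto intro!: derivative_eq_intros)
  qed
  then have "Qfun A B (\<lambda>k. deriv (\<lambda>z. a * E k z + b * E' k z)) z
     = a * Qfun A B (\<lambda>k. deriv (E k)) z + b * Qfun A B (\<lambda>k. deriv (E' k)) z"
    unfolding Qfun_def by (simp add: algebra_simps)
  then show "Qfun A B (\<lambda>k. deriv (\<lambda>z. a * E k z + b * E' k z)) z = 0"
    using assms z unfolding null_deriv_def by simp
qed (use assms in \<open>auto simp: null_deriv_def\<close>)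

lemma admissible_scale:
  assumes "admissible n x E"
  shows "admissible n x (\<lambda>k z. a * E k z)"
  unfolding admissible_def
proof (intro conjI ballI)
  show "null_deriv (- ends n x) (polyA n x) (polyB n x) (\<lambda>k z. a * E k z)"
    using null_deriv_linear[of "- ends n x" "polyA n x" "polyB n x" E E a 0] assms
    unfolding admissible_def by simp
  obtain e \<epsilon> where e: "e>0" "\<And>k. k<3 \<Longrightarrow> \<epsilon> k holomorphic_on ball 0 e"
     "\<And>k w. k < 3 \<Longrightarrow> w\<in>ball 0 e - {0} \<Longrightarrow> E k (1 / w) = \<epsilon> k w"
    using assms unfolding admissible_def regular_at_infinity_def by metis
  show "regular_at_infinity (\<lambda>k z. a * E k z)" unfolding regular_at_infinity_def
    by (rule exI[of _ e], rule conjI[OF e(1)], rule exI[of _ "\<lambda>k z. a * \<epsilon> k z"])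
       (use e in \<open>auto intro!: holomorphic_intros\<close>)
  fix p assume p: "p \<in> ends n x"
  then obtain e \<epsilon> c where e: "e>0" "\<And>k. k<3 \<Longrightarrow> \<epsilon> k holomorphic_on ball p e"
     "\<And>k z. k < 3 \<Longrightarrow> z\<in>ball p e - {p} \<Longrightarrow> E k z = \<epsilon> k z / (z - p)\<^sup>2"
     "\<epsilon> 0 p = c * (polyB n x p)\<^sup>2" "\<epsilon> 1 p = c * (polyA n x p * polyB n x p)" "\<epsilon> 2 p = c * (polyA n x p)\<^sup>2"
    using assms unfolding admissible_def regular_at_def by metis
  show "regular_at n x (\<lambda>k z. a * E k z) p" unfolding regular_at_def
    by (rule exI[of _ e], rule conjI[OF e(1)], rule exI[of _ "\<lambda>k z. a * \<epsilon> k z"], rule exI[of _ "a * c"])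
       (use e in \<open>auto intro!: holomorphic_intros\<close>)
qed

text \<open>Constant \<open>E\<close> is a translation; \<open>transl a b c\<close> is the one along the real vector \<open>(a, b, c)\<close>.\<close>
definition transl :: "real \<Rightarrow> real \<Rightarrow> real \<Rightarrow> nat \<Rightarrow> complex \<Rightarrow> complex" where
  "transl a b c k z = (if k = 0 then a - \<i> * b else if k = 1 then c else - a - \<i> * b)"

lemma transl_linear:
  "transl a b c = (\<lambda>k z. of_real a * transl 1 0 0 k z + (of_real b * transl 0 1 0 k z + of_real c * transl 0 0 1 k z))"
  unfolding transl_def by (intro ext) (simp add: algebra_simps)

lemma support_transl_linear:
  "support_fun A B (transl a b c) z = of_real a * support_fun A B (transl 1 0 0) z
     + of_real b * support_fun A B (transl 0 1 0) z + of_real c * support_fun A B (transl 0 0 1) z"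
proof -
  have "support_fun A B (transl a b c) z = support_fun A B (\<lambda>k z. of_real a * transl 1 0 0 k z + 1 *
      (of_real b * transl 0 1 0 k z + of_real c * transl 0 0 1 k z)) z"
    by (subst transl_linear) simp
  also have "\<dots> = of_real a * support_fun A B (transl 1 0 0) z + 1 *
      (of_real b * support_fun A B (transl 0 1 0) z + of_real c * support_fun A B (transl 0 0 1) z)"
    by (simp only: support_fun_linear)
  finally show ?thesis by simp
qed

text \<open>A real vector is paired with the real Gauss map. Hence the passage to the real part in
  \<open>jacobi_of\<close> loses nothing for a real translation.\<close>

lemma support_transl_real: "support_fun A B (transl a b c) z = of_real (Re (support_fun A B (transl a b c) z))"
proof -
  have "cnj (support_fun A B (transl a b c) z) = support_fun A B (transl a b c) z"
    unfolding support_fun_def transl_def by (simp add: algebra_simps)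
  then show ?thesis by (metis Reals_cnj_iff of_real_Re)
qed

lemma jacobi_transl_linear:
  "jacobi_of n x (transl a b c) z = a * jacobi_of n x (transl 1 0 0) z
     + b * jacobi_of n x (transl 0 1 0) z + c * jacobi_of n x (transl 0 0 1) z"
  unfolding jacobi_of_def support_transl_linear[of _ _ a b c] by simp

text \<open>With constant c the proportionality relations can be differentiated, so (A, B) and (A',
  B') solve the same linear equations. Their determinant is \<open>wronsk\<close>, which is nonzero
  at \<open>z\<close>, and so c = 0.\<close>

lemma const_support_vanish:
  assumes nn: "nnoid_data n x" and z: "z \<notin> ends n x" "wronsk (polyA n x) (polyB n x) z \<noteq> 0"
    and 0: "\<And>z. z \<notin> ends n x \<Longrightarrow> support_fun (polyA n x) (polyB n x) (\<lambda>k z. c k) z = 0"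
  shows "c 0 = 0" "c 1 = 0" "c 2 = 0"
proof -
  let ?A = "polyA n x" and ?B = "polyB n x"
  define U where "U = (- ends n x) \<inter> wronsk ?A ?B -` (- {0})"
  have W: "wronsk ?A ?B holomorphic_on - ends n x"
    unfolding wronsk_def[abs_def] by (intro holomorphic_intros open_compl_ends)
  have U: "open U" unfolding U_def
    by (intro continuous_open_preimage holomorphic_on_imp_continuous_on W open_compl_ends) auto
  have zU: "z \<in> U" unfolding U_def using z by simp
  have nd: "null_deriv (- ends n x) ?A ?B (\<lambda>k z. c k)"
    using admissible_const unfolding admissible_def by blast
  have eq: "?A y * c 1 = ?B y * c 2" "?A y * c 0 = ?B y * c 1" if "y \<in> U" for y
    using support_fun_vanish[OF nd open_compl_ends nnoid_dataD(3)[OF nn] 0, of y] that unfolding U_def by auto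
  have dA: "(?A has_field_derivative deriv ?A z) (at z)" "(?B has_field_derivative deriv ?B z) (at z)"
    by (rule holomorphic_derivI[where S=UNIV]; auto intro: holomorphic_intros)+
  have deq: "deriv ?A z * a = deriv ?B z * b" if "\<And>y. y \<in> U \<Longrightarrow> ?A y * a = ?B y * b" for a b
  proof -
    have "deriv (\<lambda>y. ?A y * a) z = deriv (\<lambda>y. ?B y * b) z"
    proof (rule deriv_cong_ev)
      show "\<forall>\<^sub>F y in nhds z. ?A y * a = ?B y * b"
        using eventually_nhds_in_open[OF U zU] by eventually_elim (rule that)
    qed simp
    moreover have "deriv (\<lambda>y. ?A y * a) z = deriv ?A z * a" "deriv (\<lambda>y. ?B y * b) z = deriv ?B z * b"
      by (rule DERIV_imp_deriv; rule DERIV_cmult_right; rule dA)+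
    ultimately show ?thesis by simp
  qed
  have d1: "deriv ?A z * c 1 = deriv ?B z * c 2" by (rule deq[OF eq(1)])
  have d2: "deriv ?A z * c 0 = deriv ?B z * c 1" by (rule deq[OF eq(2)])
  have "c 1 * wronsk ?A ?B z = (deriv ?A z * c 1) * ?B z - (?A z * c 1) * deriv ?B z"
    unfolding wronsk_def by (simp add: algebra_simps)
  then have "c 1 * wronsk ?A ?B z = 0" unfolding d1 eq(1)[OF zU] by simp
  then show c1: "c 1 = 0" using z(2) by simp
  have "c 2 * wronsk ?A ?B z = deriv ?A z * (?B z * c 2) - ?A z * (deriv ?B z * c 2)"
    unfolding wronsk_def by (simp add: algebra_simps)
  then show "c 2 = 0" unfolding d1[symmetric] eq(1)[OF zU, symmetric] c1 using z(2) by simp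
  have "c 0 * wronsk ?A ?B z = (deriv ?A z * c 0) * ?B z - (?A z * c 0) * deriv ?B z"
    unfolding wronsk_def by (simp add: algebra_simps)
  then show "c 0 = 0" unfolding d2 eq(2)[OF zU] c1 using z(2) by simp
qed

text \<open>The scalar multiplication is the one in \<open>real_fun_dim\<close>, so that
  \<open>rfun.dim\<close> is the dimension assumed in the theorem.\<close>

interpretation rfun: vector_space "\<lambda>(r::real) f (z::complex). r * f z"
  by unfold_locales (auto simp: fun_eq_iff algebra_simps)

lemma jacobi_transl_eq_0:
  assumes nn: "nnoid_data n x" and z: "z \<notin> ends n x" "wronsk (polyA n x) (polyB n x) z \<noteq> 0"
    and 0: "jacobi_of n x (transl a b c) = (\<lambda>_. 0)"
  shows "a = 0" "b = 0" "c = 0"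
proof -
  have "support_fun (polyA n x) (polyB n x) (\<lambda>k z. transl a b c k 0) y = 0" if "y \<notin> ends n x" for y
  proof -
    have "(\<lambda>k z. transl a b c k 0) = transl a b c" unfolding transl_def by (intro ext) simp
    moreover have "jacobi_of n x (transl a b c) y = 0" using 0 by simp
    ultimately show ?thesis using that support_transl_real[of "polyA n x" "polyB n x" a b c y]
      unfolding jacobi_of_def by simp
  qed
  from const_support_vanish[OF nn z this]
  have "complex_of_real a - \<i> * b = 0" "complex_of_real c = 0"
    unfolding transl_def by simp_all
  then show "a = 0" "b = 0" "c = 0" by (auto simp: complex_eq_iff)
qed

text \<open>The three coordinate translations give independent bounded Jacobi fields. A field
  outside their span would be a fourth independent element in the span of a basis with three
  elements.\<close>

lemma bounded_jacobi_span:
  assumes nn: "nnoid_data n x" and z: "z \<notin> ends n x" "wronsk (polyA n x) (polyB n x) z \<noteq> 0"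
    and W: "\<And>p. p \<in> ends n x \<Longrightarrow> wronsk (polyA n x) (polyB n x) p \<noteq> 0"
    and dim: "real_fun_dim (bounded_jacobi_fields n x) = 3"
    and u: "u \<in> bounded_jacobi_fields n x"
  shows "\<exists>a b c. u = jacobi_of n x (transl a b c)"
proof -
  let ?V = "bounded_jacobi_fields n x" and ?t = "\<lambda>a b c. jacobi_of n x (transl a b c)"
  let ?t1 = "?t 1 0 0" and ?t2 = "?t 0 1 0" and ?t3 = "?t 0 0 1"
  have adm: "admissible n x (transl a b c)" for a b c
  proof -
    have "(\<lambda>k z. transl a b c k 0) = transl a b c" unfolding transl_def by (intro ext) simp
    then show ?thesis using admissible_const[of n x "\<lambda>k. transl a b c k 0"] by simp
  qed
  have tV: "?t a b c \<in> ?V" for a b c by (rule jacobi_of_mem[OF nn adm W])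
  have lin: "?t a b c = (\<lambda>z. a * ?t1 z + b * ?t2 z + c * ?t3 z)" for a b c
    by (intro ext) (rule jacobi_transl_linear)
  note zero = jacobi_transl_eq_0[OF nn z]
  have i3: "\<not> rfun.dependent {?t3}"
    using zero(3)[of 0 0 1] by (auto simp: rfun.dependent_single zero_fun_def)
  have n2: "?t2 \<notin> rfun.span {?t3}"
  proof
    assume "?t2 \<in> rfun.span {?t3}"
    then obtain k where "?t2 - (\<lambda>z. k * ?t3 z) = 0" by (auto simp: rfun.span_breakdown_eq)
    then have "?t 0 1 (-k) = (\<lambda>_. 0)" unfolding lin[of 0 1 "-k"] by (auto simp: fun_eq_iff)
    then show False using zero(2)[of 0 1 "-k"] by simp
  qed
  have n1: "?t1 \<notin> rfun.span {?t2, ?t3}"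
  proof
    assume "?t1 \<in> rfun.span {?t2, ?t3}"
    then obtain j k where "?t1 - (\<lambda>z. j * ?t2 z) - (\<lambda>z. k * ?t3 z) = 0" by (auto simp: rfun.span_breakdown_eq)
    then have "?t 1 (-j) (-k) = (\<lambda>_. 0)" unfolding lin[of 1 "-j" "-k"] by (auto simp: fun_eq_iff)
    then show False using zero(1)[of 1 "-j" "-k"] by simp
  qed
  have d: "?t2 \<noteq> ?t3" "?t1 \<noteq> ?t2" "?t1 \<noteq> ?t3"
    using n1 n2 by (metis insertCI rfun.span_base)+
  have ind: "\<not> rfun.dependent {?t1, ?t2, ?t3}"
    using i3 n1 n2 d by (simp add: rfun.independent_insert)
  obtain Ba where Ba: "Ba \<subseteq> ?V" "\<not> rfun.dependent Ba" "?V \<subseteq> rfun.span Ba" "card Ba = rfun.dim ?V"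
    using rfun.basis_exists by blast
  have cB: "card Ba = 3" using Ba(4) dim unfolding real_fun_dim_def by simp
  \<comment> \<open>\<open>card\<close> is 0 on infinite sets, so the value 3 also excludes an
    infinite basis.\<close>
  then have fB: "finite Ba" using card.infinite by fastforce
  have "u \<in> rfun.span {?t1, ?t2, ?t3}"
  proof (rule ccontr)
    assume c: "u \<notin> rfun.span {?t1, ?t2, ?t3}"
    then have "\<not> rfun.dependent (insert u {?t1, ?t2, ?t3})" using ind by (simp add: rfun.independent_insertI)
    moreover have "insert u {?t1, ?t2, ?t3} \<subseteq> rfun.span Ba" using tV u Ba(3) by blast
    ultimately have "card (insert u {?t1, ?t2, ?t3}) \<le> 3"
      using rfun.independent_span_bound[OF fB] cB by metis
    moreover have "u \<notin> {?t1, ?t2, ?t3}" 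
      using c rfun.span_base[of u "{?t1, ?t2, ?t3}"] by argo
    ultimately show False using d by simp
  qed
  then obtain i j k where "u - (\<lambda>z. i * ?t1 z) - (\<lambda>z. j * ?t2 z) - (\<lambda>z. k * ?t3 z) = 0"
    by (auto simp: rfun.span_breakdown_eq)
  then have "u = ?t i j k" unfolding lin[of i j k] by (auto simp: fun_eq_iff algebra_simps)
  then show ?thesis by blast
qed

text \<open>Im w is the real part of the support function of - \<i> E, which is again admissible
  because the conditions are complex linear. The translations found for Re w and Im w combine to one
  complex vector c.\<close>

lemma support_fun_translation:
  assumes nn: "nnoid_data n x" and z: "z \<notin> ends n x" "wronsk (polyA n x) (polyB n x) z \<noteq> 0"
    and W: "\<And>p. p \<in> ends n x \<Longrightarrow> wronsk (polyA n x) (polyB n x) p \<noteq> 0"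
    and dim: "real_fun_dim (bounded_jacobi_fields n x) = 3"
    and E: "admissible n x E"
  shows "\<exists>c. \<forall>y. y \<notin> ends n x \<longrightarrow> support_fun (polyA n x) (polyB n x) (\<lambda>k z. E k z - c k) y = 0"
proof -
  let ?s = "support_fun (polyA n x) (polyB n x)"
  obtain a b c where 1: "jacobi_of n x E = jacobi_of n x (transl a b c)"
    using bounded_jacobi_span[OF nn z W dim jacobi_of_mem[OF nn E W]] by blast
  obtain a' b' c' where 2: "jacobi_of n x (\<lambda>k z. - \<i> * E k z) = jacobi_of n x (transl a' b' c')"
    using bounded_jacobi_span[OF nn z W dim jacobi_of_mem[OF nn admissible_scale[OF E] W]] by blast
  define C where "C k = transl a b c k 0 + \<i> * transl a' b' c' k 0" for k
  show ?thesis
  proof (intro exI[of _ C] allI impI)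
    fix y assume y: "y \<notin> ends n x"
    have "Re (?s E y) = Re (?s (transl a b c) y)" using fun_cong[OF 1, of y] y unfolding jacobi_of_def by simp
    moreover have "?s (\<lambda>k z. - \<i> * E k z) y = - \<i> * ?s E y"
      using support_fun_linear[of _ _ "- \<i>" E 0 E y] by simp
    then have "Im (?s E y) = Re (?s (transl a' b' c') y)"
      using fun_cong[OF 2, of y] y unfolding jacobi_of_def by simp
    ultimately have e: "?s E y = ?s (transl a b c) y + \<i> * ?s (transl a' b' c') y"
      using support_transl_real[of _ _ a b c y] support_transl_real[of _ _ a' b' c' y]
      by (metis complex_eq)
    have "(\<lambda>k z. E k z - C k) = (\<lambda>k z. 1 * E k z + (- 1) * (1 * transl a b c k z + \<i> * transl a' b' c' k z))"
      unfolding C_def transl_def by (intro ext) simp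
    then have "?s (\<lambda>k z. E k z - C k) y = 1 * ?s E y + (- 1) * (1 * ?s (transl a b c) y + \<i> * ?s (transl a' b' c') y)"
      by (simp only: support_fun_linear)
    then show "?s (\<lambda>k z. E k z - C k) y = 0" using e by simp
  qed
qed

section \<open>Periods and their derivatives\<close>

text \<open>\<open>A^k * B^(2 - k)\<close>, the numerator of \<open>g^k \<omega>\<close> once the
  powers of B are cancelled; it is polynomial also at the poles of g.\<close>

definition numW :: "nat \<Rightarrow> (nat \<Rightarrow> complex) \<Rightarrow> nat \<Rightarrow> complex \<Rightarrow> complex" where
  "numW n x k z = (if k = 0 then (polyB n x z)\<^sup>2 else if k = 1 then polyA n x z * polyB n x z else (polyA n x z)\<^sup>2)"

definition prodHat :: "nat \<Rightarrow> (nat \<Rightarrow> complex) \<Rightarrow> nat \<Rightarrow> complex \<Rightarrow> complex" where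
  "prodHat n x i z = (\<Prod>j\<in>{..<n} - {i}. (z - pt x j)\<^sup>2)"

lemma prodP_split: "i < n \<Longrightarrow> prodP n x z = (z - pt x i)\<^sup>2 * prodHat n x i z"
  unfolding prodP_def prodHat_def by (subst prod.remove[of _ i]) auto

lemma numW_holomorphic [holomorphic_intros]: "numW n x k holomorphic_on S"
proof -
  have "numW n x k = (if k = 0 then (\<lambda>z. (polyB n x z)\<^sup>2) else if k = 1 then (\<lambda>z. polyA n x z * polyB n x z)
     else (\<lambda>z. (polyA n x z)\<^sup>2))" unfolding numW_def[abs_def] by auto
  then show ?thesis by (auto intro!: holomorphic_intros)
qed

lemma prodHat_holomorphic [holomorphic_intros]: "prodHat n x i holomorphic_on S"
  unfolding prodHat_def[abs_def] by (intro holomorphic_intros)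

lemma prodP_holomorphic [holomorphic_intros]: "prodP n x holomorphic_on S"
  unfolding prodP_def[abs_def] by (intro holomorphic_intros)

text \<open>The premise on B matters: division by zero makes \<open>gW\<close> equal to 0 at a zero
  of B, so for k = 2 the left side would be 0 there, while the right side has the numerator
  \<open>A^2\<close>.\<close>

lemma Weierstrass_integrand:
  assumes "k < 3" "polyB n x z \<noteq> 0"
  shows "gW n x z ^ k * fW n x z = numW n x k z / prodP n x z"
proof -
  consider "k = 0" | "k = 1" | "k = 2" using assms(1) by linarith
  then show ?thesis by cases (use assms(2) in \<open>auto simp: gW_def fW_def numW_def power2_eq_square\<close>)
qed

lemma prodHat_nonzero:
  assumes "small_radius n x r" "i < n" "cmod (z - pt x i) \<le> r"
  shows "prodHat n x i z \<noteq> 0"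
proof -
  have "z \<noteq> pt x j" if "j < n" "j \<noteq> i" for j
    using assms that unfolding small_radius_def by (metis linorder_not_less norm_minus_commute)
  then show ?thesis unfolding prodHat_def by auto
qed

text \<open>The disc contains no end but p_i, a double pole; this is Cauchy's formula for a first
  derivative.\<close>

lemma integral_phi:
  assumes r: "small_radius n x r" and i: "i < n"
  shows "((\<lambda>z. numW n x k z / prodP n x z) has_contour_integral
     2 * pi * \<i> * deriv (\<lambda>z. numW n x k z / prodHat n x i z) (pt x i)) (circlepath (pt x i) r)"
proof -
  let ?f = "\<lambda>z. numW n x k z / prodHat n x i z" and ?p = "pt x i"
  have h: "?f holomorphic_on cball ?p r"
    by (intro holomorphic_intros) (use prodHat_nonzero[OF r i] in \<open>auto simp: dist_norm norm_minus_commute\<close>)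
  have "r > 0" using r unfolding small_radius_def by simp
  have "((\<lambda>u. ?f u / (u - ?p) ^ Suc 1) has_contour_integral 2 * pi * \<i> / fact 1 * (deriv ^^ 1) ?f ?p) (circlepath ?p r)"
    by (rule Cauchy_has_contour_integral_higher_derivative_circlepath)
       (use h \<open>r > 0\<close> in \<open>auto intro: holomorphic_on_imp_continuous_on holomorphic_on_subset\<close>)
  then show ?thesis
    by (auto simp: prodP_split[OF i] power2_eq_square mult.commute)
qed

lemma exists_less_all:
  fixes S :: "real set"
  assumes "finite S" "\<And>s. s \<in> S \<Longrightarrow> 0 < s"
  shows "\<exists>r>0. \<forall>s\<in>S. r < s"
proof -
  define m where "m = Min (insert 1 S)"
  have "0 < m" unfolding m_def using assms by (subst Min_gr_iff) auto
  moreover have "m / 2 < s" if "s \<in> S" for s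
    using Min_le[of "insert 1 S" s] assms(1) that \<open>0 < m\<close> unfolding m_def[symmetric] by auto
  ultimately show ?thesis by (intro exI[of _ "m / 2"]) auto
qed

lemma exists_small_radius:
  assumes "inj_on (pt x) {..<n}" "0 < d"
  shows "\<exists>r<d. small_radius n x r"
proof -
  let ?S = "insert d ((\<lambda>(i, j). cmod (pt x i - pt x j)) ` {(i, j). i < n \<and> j < n \<and> i \<noteq> j})"
  have "{(i, j). i < n \<and> j < n \<and> i \<noteq> j} \<subseteq> {..<n} \<times> {..<n}" by auto
  then have "finite {(i, j). i < n \<and> j < n \<and> i \<noteq> j}" by (meson finite_SigmaI finite_lessThan finite_subset)
  moreover have "0 < s" if "s \<in> ?S" for s
    using that assms by (auto dest: inj_onD)
  ultimately obtain r where "r > 0" "\<forall>s\<in>?S. r < s" using exists_less_all[of ?S] by blast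
  then show ?thesis unfolding small_radius_def by (intro exI[of _ r]) auto
qed

text \<open>The residues \<open>\<rho>\<^sub>k\<close> of \<open>g\<^sup>k \<omega>\<close> satisfy \<open>\<rho>\<^sub>1\<^sup>2 - \<rho>\<^sub>0 \<rho>\<^sub>2 = (W / prodHat)\<^sup>2\<close>. If \<open>W\<close> vanished at an
  end, reality of the flux would force \<open>\<rho>\<^sub>1\<^sup>2 = - \<bar>\<rho>\<^sub>0\<bar>\<^sup>2\<close> with \<open>\<rho>\<^sub>1\<close> real, hence zero flux.\<close>
lemma wronsk_nonzero_at_end:
  assumes nn: "nnoid_data n x" and p: "p \<in> ends n x"
  shows "wronsk (polyA n x) (polyB n x) p \<noteq> 0"
proof
  assume W0: "wronsk (polyA n x) (polyB n x) p = 0"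
  obtain i where i: "i < n" "p = pt x i" using p unfolding ends_def by auto
  let ?A = "polyA n x" and ?B = "polyB n x"
  have "?B p \<noteq> 0" using nnoid_dataD(5)[OF nn p] by blast
  moreover have "isCont ?B p"
    by (metis polyB_holomorphic UNIV_I continuous_on_eq_continuous_at holomorphic_on_imp_continuous_on open_UNIV)
  ultimately have "eventually (\<lambda>z. ?B z \<noteq> 0) (at p)" by (simp add: isCont_def tendsto_imp_eventually_ne)
  then obtain d where d: "d > 0" "\<And>z. z \<noteq> p \<Longrightarrow> dist z p < d \<Longrightarrow> ?B z \<noteq> 0"
    unfolding eventually_at by auto
  \<comment> \<open>The period conditions in \<open>nnoid_data\<close> hold for every small radius,
    so the circle can be taken so small that it meets no zero of B.\<close>
  obtain r where r: "r < d" "small_radius n x r"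
    using exists_small_radius[OF nnoid_dataD(2)[OF nn] d(1)] by blast
  have r0: "r > 0" using r(2) unfolding small_radius_def by simp
  have Bn: "?B z \<noteq> 0" if "z \<in> path_image (circlepath p r)" for z
    using that d(2)[of z] r(1) r0 by (auto simp: dist_norm norm_minus_commute)
  let ?s = "prodHat n x i"
  define \<rho> where "\<rho> k = deriv (\<lambda>z. numW n x k z / ?s z) p" for k
  define R where "R k = 2 * pi * \<i> * \<rho> k" for k
  let ?\<phi> = "\<lambda>k z. numW n x k z / prodP n x z"
  have I: "(?\<phi> k has_contour_integral R k) (circlepath p r)" for k
    using integral_phi[OF r(2) i(1)] unfolding R_def \<rho>_def i(2) .
  have gf: "fW n x z = ?\<phi> 0 z" "gW n x z * fW n x z = ?\<phi> 1 z" "(gW n x z)\<^sup>2 * fW n x z = ?\<phi> 2 z"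
    if "z \<in> path_image (circlepath p r)" for z
    using Weierstrass_integrand[of 0 n x z] Weierstrass_integrand[of 1 n x z] Weierstrass_integrand[of 2 n x z] Bn[OF that]
    by simp_all
  have c0: "contour_integral (circlepath p r) (PhiW n x 0) = 1/2 * (R 0 - R 2)"
  proof (rule contour_integral_unique, rule has_contour_integral_eq)
    show "((\<lambda>z. 1/2 * (?\<phi> 0 z - ?\<phi> 2 z)) has_contour_integral 1/2 * (R 0 - R 2)) (circlepath p r)"
      by (intro has_contour_integral_lmul has_contour_integral_diff I)
    show "1/2 * (?\<phi> 0 z - ?\<phi> 2 z) = PhiW n x 0 z" if "z \<in> path_image (circlepath p r)" for z
      unfolding gf[OF that, symmetric] PhiW_def by (simp add: algebra_simps)
  qed
  have c1: "contour_integral (circlepath p r) (PhiW n x 1) = \<i>/2 * (R 0 + R 2)"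
  proof (rule contour_integral_unique, rule has_contour_integral_eq)
    show "((\<lambda>z. \<i>/2 * (?\<phi> 0 z + ?\<phi> 2 z)) has_contour_integral \<i>/2 * (R 0 + R 2)) (circlepath p r)"
      by (intro has_contour_integral_lmul has_contour_integral_add I)
    show "\<i>/2 * (?\<phi> 0 z + ?\<phi> 2 z) = PhiW n x 1 z" if "z \<in> path_image (circlepath p r)" for z
      unfolding gf[OF that, symmetric] PhiW_def by (simp add: algebra_simps)
  qed
  have c2: "contour_integral (circlepath p r) (PhiW n x 2) = R 1"
  proof (rule contour_integral_unique, rule has_contour_integral_eq)
    show "(?\<phi> 1 has_contour_integral R 1) (circlepath p r)" by (rule I)
    show "?\<phi> 1 z = PhiW n x 2 z" if "z \<in> path_image (circlepath p r)" for z
      unfolding gf[OF that, symmetric] PhiW_def by simp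
  qed
  have per: "\<forall>j<3. Re (contour_integral (circlepath p r) (PhiW n x j)) = 0"
    "\<exists>j<3. contour_integral (circlepath p r) (PhiW n x j) \<noteq> 0"
    using nn r(2) i unfolding nnoid_data_def by blast+
  have re: "Re (1/2 * (R 0 - R 2)) = 0" "Re (\<i>/2 * (R 0 + R 2)) = 0" "Re (R 1) = 0"
    using per(1) unfolding c0[symmetric] c1[symmetric] c2[symmetric] by simp_all
  \<comment> \<open>The first two period conditions give equal real parts and opposite imaginary
    parts. The third makes \<open>R 1\<close> imaginary, so that \<open>R 1 * R 1\<close> is at most
    0, whereas \<open>R 0 * R 2\<close> is at least 0.\<close>
  have R2: "R 2 = cnj (R 0)" using re(1,2) by (simp add: complex_eq_iff)
  have s0: "?s p \<noteq> 0" using prodHat_nonzero[OF r(2) i(1)] r0 i(2) by simp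
  have dd: "(f has_field_derivative deriv f p) (at p)" if "f holomorphic_on UNIV" for f
    using holomorphic_derivI[OF that] by simp
  have \<rho>: "\<rho> 0 = (2 * ?B p * deriv ?B p * ?s p - (?B p)\<^sup>2 * deriv ?s p) / (?s p)\<^sup>2"
    "\<rho> 1 = ((deriv ?A p * ?B p + ?A p * deriv ?B p) * ?s p - (?A p * ?B p) * deriv ?s p) / (?s p)\<^sup>2"
    "\<rho> 2 = (2 * ?A p * deriv ?A p * ?s p - (?A p)\<^sup>2 * deriv ?s p) / (?s p)\<^sup>2"
    unfolding \<rho>_def numW_def using s0 dd[OF polyA_holomorphic[of n x]] dd[OF polyB_holomorphic[of n x]] dd[OF prodHat_holomorphic[of n x i]]
    by (auto intro!: DERIV_imp_deriv derivative_eq_intros simp: power2_eq_square algebra_simps)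
  have "\<rho> 1 * \<rho> 1 - \<rho> 0 * \<rho> 2 = (wronsk ?A ?B p)\<^sup>2 * (?s p)\<^sup>2 / ((?s p)\<^sup>2)\<^sup>2"
    unfolding \<rho> wronsk_def times_divide_times_eq diff_divide_distrib[symmetric] power2_eq_square
    by (simp add: algebra_simps)
  then have "\<rho> 1 * \<rho> 1 = \<rho> 0 * \<rho> 2" using W0 by simp
  then have "R 1 * R 1 = R 0 * R 2" unfolding R_def by simp
  then have "R 1 * R 1 = of_real ((cmod (R 0))\<^sup>2)" unfolding R2 by (simp only: complex_norm_square)
  then have "Re (R 1 * R 1) = (cmod (R 0))\<^sup>2" by simp
  then have "- (Im (R 1))\<^sup>2 = (cmod (R 0))\<^sup>2" using re(3) by (simp add: power2_eq_square)
  then have "Im (R 1) = 0" "R 0 = 0"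
    by (smt (verit) zero_le_power2 power_zero_numeral zero_eq_power2 norm_eq_zero)+
  then have "R 0 = 0" "R 1 = 0" "R 2 = 0" using re(3) R2 by (auto simp: complex_eq_iff)
  then have "contour_integral (circlepath p r) (PhiW n x j) = 0" if "j < 3" for j
  proof -
    have "j = 0 \<or> j = 1 \<or> j = 2" using that by linarith
    then show ?thesis using c0 c1 c2 \<open>R 0 = 0\<close> \<open>R 1 = 0\<close> \<open>R 2 = 0\<close> by auto
  qed
  then show False using per(2) by blast
qed

section \<open>Directional derivatives of the Weierstrass integrands and of the periods\<close>

definition dnum :: "nat \<Rightarrow> (nat \<Rightarrow> complex) \<Rightarrow> (nat \<Rightarrow> complex) \<Rightarrow> nat \<Rightarrow> complex \<Rightarrow> complex" where
  "dnum n x v k z = (if k = 0 then 2 * polyB n x z * polyB n v z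
     else if k = 1 then polyA n v z * polyB n x z + polyA n x z * polyB n v z
     else 2 * polyA n x z * polyA n v z)"

lemma dnum_holomorphic [holomorphic_intros]: "dnum n x v k holomorphic_on S"
proof -
  have "dnum n x v k = (if k = 0 then (\<lambda>z. 2 * polyB n x z * polyB n v z)
    else if k = 1 then (\<lambda>z. polyA n v z * polyB n x z + polyA n x z * polyB n v z)
    else (\<lambda>z. 2 * polyA n x z * polyA n v z))" unfolding dnum_def[abs_def] by auto
  then show ?thesis by (auto intro!: holomorphic_intros)
qed

text \<open>The derivative in the direction \<open>v\<close> of \<open>numW n x k / prodP n x\<close>, the coefficient of \<open>g\<^sup>k \<omega>\<close>.\<close>
definition dphi :: "nat \<Rightarrow> (nat \<Rightarrow> complex) \<Rightarrow> (nat \<Rightarrow> complex) \<Rightarrow> nat \<Rightarrow> complex \<Rightarrow> complex" where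
  "dphi n x v k z = dnum n x v k z / prodP n x z
     + numW n x k z / prodP n x z * (\<Sum>j<n. 2 * pt v j / (z - pt x j))"

lemma polyA_linear: "polyA n (\<lambda>j. x j + a * v j) z = polyA n x z + a * polyA n v z"
  unfolding polyA_def coef_a_def by (simp add: sum_distrib_left sum.distrib algebra_simps)

lemma polyB_linear: "polyB n (\<lambda>j. x j + a * v j) z = polyB n x z + a * polyB n v z"
  unfolding polyB_def coef_b_def by (simp add: sum_distrib_left sum.distrib algebra_simps)

lemma dphi_linear: "dphi n x (\<lambda>j. v j + a * w j) k z = dphi n x v k z + a * dphi n x w k z"
proof -
  have "(\<Sum>j<n. 2 * pt (\<lambda>j. v j + a * w j) j / (z - pt x j))
      = (\<Sum>j<n. 2 * pt v j / (z - pt x j)) + a * (\<Sum>j<n. 2 * pt w j / (z - pt x j))"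
    unfolding sum_distrib_left sum.distrib[symmetric]
    by (rule sum.cong) (auto simp: pt_def add_divide_distrib algebra_simps)
  moreover have "dnum n x (\<lambda>j. v j + a * w j) k z = dnum n x v k z + a * dnum n x w k z"
    unfolding dnum_def polyA_linear polyB_linear by (simp add: algebra_simps)
  ultimately show ?thesis unfolding dphi_def by (simp add: add_divide_distrib algebra_simps)
qed

definition PA :: "nat \<Rightarrow> (nat \<Rightarrow> complex) \<Rightarrow> complex poly" where
  "PA n x = (\<Sum>i<n. monom (coef_a x i) (n - 1 - i))"

definition PB :: "nat \<Rightarrow> (nat \<Rightarrow> complex) \<Rightarrow> complex poly" where
  "PB n x = (\<Sum>i<n. monom (coef_b x i) (n - 1 - i))"

lemma poly_PA [simp]: "poly (PA n x) z = polyA n x z"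
  unfolding PA_def polyA_def by (simp add: poly_sum poly_monom)

lemma poly_PB [simp]: "poly (PB n x) z = polyB n x z"
  unfolding PB_def polyB_def by (simp add: poly_sum poly_monom)

lemma finite_zeros_polyB:
  assumes "polyB n x p \<noteq> 0" shows "finite {z. polyB n x z = 0}"
proof -
  have "PB n x \<noteq> 0" using assms poly_PB[of n x p] by force
  then show ?thesis using poly_roots_finite[of "PB n x"] by simp
qed

text \<open>The radius in the theorem is given, so zeros of B may lie on the circle, where
  \<open>gW\<close> has the wrong value. The circle meets a finite set at finitely many parameters,
  and the integral does not see them.\<close>

lemma contour_integral_circlepath_spike:
  assumes r: "r > 0" and K: "finite K" and eq: "\<And>z. z \<notin> K \<Longrightarrow> f z = g z"
  shows "contour_integral (circlepath p r) f = contour_integral (circlepath p r) g"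
proof -
  let ?\<gamma> = "circlepath p r"
  have inj: "inj_on ?\<gamma> {0..<1}"
  proof (rule inj_onI)
    fix s t :: real assume st: "s \<in> {0..<1}" "t \<in> {0..<1}" "?\<gamma> s = ?\<gamma> t"
    then show "s = t"
      using simple_path_circlepath[of p r] r unfolding simple_path_def loop_free_def by fastforce
  qed
  \<comment> \<open>The closed path is injective only on the half-open interval, so the endpoint 1
    is put into the exceptional set by hand.\<close>
  have fin: "finite (insert 1 ({0..<1} \<inter> ?\<gamma> -` K))"
    using finite_vimage_IntI[OF K inj] by (simp add: Int_commute)
  have "integral {0..1} (\<lambda>t. f (?\<gamma> t) * vector_derivative ?\<gamma> (at t)) = integral {0..1} (\<lambda>t. g (?\<gamma> t) * vector_derivative ?\<gamma> (at t))"
  proof (rule integral_spike[OF negligible_finite[OF fin]])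
    fix t :: real assume "t \<in> {0..1} - insert 1 ({0..<1} \<inter> ?\<gamma> -` K)"
    then have "?\<gamma> t \<notin> K" by auto
    then show "g (?\<gamma> t) * vector_derivative ?\<gamma> (at t) = f (?\<gamma> t) * vector_derivative ?\<gamma> (at t)"
      using eq by simp
  qed
  then show ?thesis unfolding contour_integral_integral .
qed

definition unitv :: "nat \<Rightarrow> nat \<Rightarrow> complex" where
  "unitv s j = (if j = s then 1 else 0)"

lemma fun_upd_unitv: "x(s := t) = (\<lambda>j. x j + (t - x s) * unitv s j)"
  unfolding unitv_def by (auto simp: fun_eq_iff)

lemma circle_avoids_ends:
  assumes r: "small_radius n x r" and i: "i < n" and z: "z \<in> path_image (circlepath (pt x i) r)"
  shows "z \<notin> ends n x"
proof
  assume "z \<in> ends n x"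
  then obtain j where j: "j < n" "z = pt x j" unfolding ends_def by auto
  have r0: "r > 0" using r unfolding small_radius_def by simp
  then have d: "cmod (pt x i - pt x j) = r" using z j by (auto simp: dist_norm)
  then have "i \<noteq> j" using r0 by auto
  then show False using r i j d unfolding small_radius_def by force
qed

text \<open>For t near \<open>x s\<close> the perturbed B is still nonzero at p_i, hence not the
  zero polynomial, and has finitely many zeros. This is what the exchange of integrands on the
  circle requires.\<close>

lemma period_eventually:
  assumes k: "k < 3" and r: "small_radius n x r" and B: "polyB n x (pt x i) \<noteq> 0"
  shows "eventually (\<lambda>t. period n r x (x(s := t)) i k
     = contour_integral (circlepath (pt x i) r) (\<lambda>z. numW n (x(s := t)) k z / prodP n (x(s := t)) z)) (nhds (x s))"
proof -
  have r0: "r > 0" using r unfolding small_radius_def by simp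
  let ?p = "pt x i"
  have "((\<lambda>t. polyB n (x(s := t)) ?p) \<longlongrightarrow> polyB n x ?p + (x s - x s) * polyB n (unitv s) ?p) (nhds (x s))"
    unfolding fun_upd_unitv polyB_linear by (intro tendsto_intros) (auto simp: filterlim_ident)
  then have "eventually (\<lambda>t. polyB n (x(s := t)) ?p \<noteq> 0) (nhds (x s))"
    using B tendsto_imp_eventually_ne by force
  then show ?thesis
  proof eventually_elim
    case (elim t)
    show ?case unfolding period_def
      by (rule contour_integral_circlepath_spike[OF r0 finite_zeros_polyB[OF elim]])
         (use Weierstrass_integrand[OF k] in auto)
  qed
qed

text \<open>If \<open>s\<close> indexes a coefficient of A or B, the integrand is a quadratic
  polynomial in the increment, so the derivative can be read off. If \<open>s = 3 j + 2\<close>,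
  only the factor \<open>(z - t)^2\<close> in the denominator varies, and the period is a Cauchy
  type integral in t.\<close>

lemma deriv_period:
  assumes k: "k < 3" and r: "small_radius n x r" and i: "i < n" and B: "polyB n x (pt x i) \<noteq> 0"
    and s: "s < 3 * n"
  shows "deriv (\<lambda>t. period n r x (x(s := t)) i k) (x s)
     = contour_integral (circlepath (pt x i) r) (dphi n x (unitv s) k)"
proof -
  let ?\<gamma> = "circlepath (pt x i) r" and ?v = "unitv s"
  have r0: "r > 0" using r unfolding small_radius_def by simp
  have P0: "prodP n x z \<noteq> 0" if "z \<in> path_image ?\<gamma>" for z
    using circle_avoids_ends[OF r i that] prodP_nonzero_iff by blast
  have "deriv (\<lambda>t. period n r x (x(s := t)) i k) (x s)
     = deriv (\<lambda>t. contour_integral ?\<gamma> (\<lambda>z. numW n (x(s := t)) k z / prodP n (x(s := t)) z)) (x s)"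
    by (rule deriv_cong_ev[OF period_eventually[OF k r B]]) simp
  also have "\<dots> = contour_integral ?\<gamma> (dphi n x ?v k)"
  proof (rule DERIV_imp_deriv)
    show "((\<lambda>t. contour_integral ?\<gamma> (\<lambda>z. numW n (x(s := t)) k z / prodP n (x(s := t)) z))
       has_field_derivative contour_integral ?\<gamma> (dphi n x ?v k)) (at (x s))"
    proof (cases "s mod 3 = 2")
      case False
      have pt0: "pt ?v j = 0" for j
        using False unfolding pt_def unitv_def by simp presburger
      have pt: "pt (\<lambda>j. x j + a * ?v j) j = pt x j" for j a using pt0 unfolding pt_def by simp
      have int: "(\<lambda>z. h z / prodP n x z) contour_integrable_on ?\<gamma>" if "h holomorphic_on UNIV" for h
        by (intro contour_integrable_continuous_circlepath continuous_intros holomorphic_on_imp_continuous_on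
            holomorphic_on_subset[OF that] holomorphic_intros) (use P0 in auto)
      define I0 where "I0 = contour_integral ?\<gamma> (\<lambda>z. numW n x k z / prodP n x z)"
      define I1 where "I1 = contour_integral ?\<gamma> (\<lambda>z. dnum n x ?v k z / prodP n x z)"
      define I2 where "I2 = contour_integral ?\<gamma> (\<lambda>z. numW n ?v k z / prodP n x z)"
      have I: "((\<lambda>z. numW n x k z / prodP n x z) has_contour_integral I0) ?\<gamma>"
        "((\<lambda>z. dnum n x ?v k z / prodP n x z) has_contour_integral I1) ?\<gamma>"
        "((\<lambda>z. numW n ?v k z / prodP n x z) has_contour_integral I2) ?\<gamma>"
        unfolding I0_def I1_def I2_def
        by (intro has_contour_integral_integral int holomorphic_intros)+
      have "contour_integral ?\<gamma> (\<lambda>z. numW n (x(s := t)) k z / prodP n (x(s := t)) z)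
          = I0 + (t - x s) * I1 + (t - x s)\<^sup>2 * I2" for t
      proof (rule contour_integral_unique)
        have "((\<lambda>z. numW n x k z / prodP n x z + (t - x s) * (dnum n x ?v k z / prodP n x z)
             + (t - x s)\<^sup>2 * (numW n ?v k z / prodP n x z)) has_contour_integral I0 + (t - x s) * I1 + (t - x s)\<^sup>2 * I2) ?\<gamma>"
          by (intro has_contour_integral_add has_contour_integral_lmul I)
        moreover have "numW n x k z / prodP n x z + a * (dnum n x ?v k z / prodP n x z)
             + a\<^sup>2 * (numW n ?v k z / prodP n x z)
             = numW n (\<lambda>j. x j + a * ?v j) k z / prodP n (\<lambda>j. x j + a * ?v j) z" for a z
        proof -
          have "prodP n (\<lambda>j. x j + a * ?v j) z = prodP n x z" unfolding prodP_def pt ..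
          moreover have "numW n (\<lambda>j. x j + a * ?v j) k z = numW n x k z + a * dnum n x ?v k z + a\<^sup>2 * numW n ?v k z"
            unfolding numW_def dnum_def polyA_linear polyB_linear by (simp add: algebra_simps power2_eq_square)
          ultimately show ?thesis by (simp add: add_divide_distrib)
        qed
        ultimately show "((\<lambda>z. numW n (x(s := t)) k z / prodP n (x(s := t)) z) has_contour_integral
            I0 + (t - x s) * I1 + (t - x s)\<^sup>2 * I2) ?\<gamma>"
          unfolding fun_upd_unitv by simp
      qed
      moreover have "((\<lambda>t. I0 + (t - x s) * I1 + (t - x s)\<^sup>2 * I2) has_field_derivative I1) (at (x s))"
        by (auto intro!: derivative_eq_intros)
      moreover have "contour_integral ?\<gamma> (dphi n x ?v k) = I1"
        unfolding I1_def dphi_def[abs_def] by (simp add: pt0)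
      ultimately show ?thesis by simp
    next
      case True
      define j where "j = s div 3"
      have sj: "s = 3 * j + 2" using True unfolding j_def by presburger
      have j: "j < n" using s sj by linarith
      have AB: "polyA n ?v z = 0" "polyB n ?v z = 0" for z
        unfolding polyA_def polyB_def coef_a_def coef_b_def unitv_def sj
        by (intro sum.neutral; auto; presburger)+
      have ptv: "pt ?v l = (if l = j then 1 else 0)" for l unfolding pt_def unitv_def sj by auto
      have xs: "x s = pt x j" unfolding pt_def sj ..
      define f' where "f' = (\<lambda>z. numW n x k z / prodHat n x j z)"
      have nz: "prodHat n x j z \<noteq> 0" "z \<noteq> pt x j" if "z \<in> path_image ?\<gamma>" for z
        using P0[OF that] unfolding prodP_split[OF j] by auto
      have cf': "continuous_on (path_image ?\<gamma>) f'" unfolding f'_def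
        by (intro continuous_intros holomorphic_on_imp_continuous_on holomorphic_intros) (use nz in auto)
      have eq: "numW n (x(s := t)) k z / prodP n (x(s := t)) z = f' z / (z - t)^2" for t z
      proof -
        have "numW n (x(s := t)) k z = numW n x k z"
          unfolding fun_upd_unitv numW_def polyA_linear polyB_linear AB by simp
        moreover have "pt (x(s := t)) l = (if l = j then t else pt x l)" for l
          unfolding pt_def sj by auto
        then have "prodHat n (x(s := t)) j z = prodHat n x j z" "pt (x(s := t)) j = t"
          unfolding prodHat_def by (auto intro!: prod.cong)
        ultimately show ?thesis unfolding prodP_split[OF j] f'_def by (simp add: mult.commute)
      qed
      have w: "pt x j \<in> UNIV - path_image ?\<gamma>" using nz(2) by blast
      have int: "((\<lambda>u. f' u / (u - w)^2) has_contour_integral contour_integral ?\<gamma> (\<lambda>u. f' u / (u - w)^2)) ?\<gamma>"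
        if "w \<in> UNIV - path_image ?\<gamma>" for w
        by (intro has_contour_integral_integral contour_integrable_continuous_circlepath continuous_intros cf')
           (use that in auto)
      \<comment> \<open>The point p_j may be inside the circle (j = i) or outside. In both cases it
        is off the path, where a Cauchy type integral is differentiable; the path stays fixed while
        the end moves.\<close>
      have "((\<lambda>w. contour_integral ?\<gamma> (\<lambda>u. f' u / (u - w)^2)) has_field_derivative
         of_nat 2 * contour_integral ?\<gamma> (\<lambda>u. f' u / (u - pt x j) ^ Suc 2)) (at (pt x j))"
      proof (rule Cauchy_next_derivative(2)[OF cf' _ int _ open_UNIV _ w])
        show "cmod (vector_derivative ?\<gamma> (at t)) \<le> 2 * pi * r" if "t \<in> {0..1}" for t
          using r0 by (simp add: vector_derivative_circlepath norm_mult)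
      qed auto
      moreover have "of_nat 2 * contour_integral ?\<gamma> (\<lambda>u. f' u / (u - pt x j) ^ Suc 2) = contour_integral ?\<gamma> (dphi n x ?v k)"
      proof -
        have "of_nat 2 * contour_integral ?\<gamma> (\<lambda>u. f' u / (u - pt x j) ^ Suc 2)
          = contour_integral ?\<gamma> (\<lambda>u. of_nat 2 * (f' u / (u - pt x j) ^ Suc 2))"
          by (intro contour_integral_lmul[symmetric] contour_integrable_continuous_circlepath continuous_intros cf')
             (use nz in auto)
        also have "\<dots> = contour_integral ?\<gamma> (dphi n x ?v k)"
        proof (rule contour_integral_eq)
          fix z assume z: "z \<in> path_image ?\<gamma>"
          have "(\<Sum>l<n. 2 * pt ?v l / (z - pt x l)) = (\<Sum>l<n. if l = j then 2 / (z - pt x l) else 0)"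
            unfolding ptv by (intro sum.cong) auto
          then have "(\<Sum>l<n. 2 * pt ?v l / (z - pt x l)) = 2 / (z - pt x j)" using j by simp
          moreover have "dnum n x ?v k z = 0" unfolding dnum_def AB by simp
          ultimately show "of_nat 2 * (f' z / (z - pt x j) ^ Suc 2) = dphi n x ?v k z"
            unfolding dphi_def prodP_split[OF j] f'_def by (simp add: power2_eq_square power3_eq_cube mult_ac)
        qed
        finally show ?thesis .
      qed
      ultimately show ?thesis unfolding eq xs by simp
    qed
  qed
  finally show ?thesis .
qed

text \<open>Together with \<open>deriv_period\<close> this turns a kernel vector of the Jacobian
  into a variation whose integrands have zero integral around the first n - 1 ends.\<close>

lemma contour_integral_dphi_sum:
  assumes r: "small_radius n x r" and i: "i < n"
  shows "((\<lambda>z. dphi n x (\<lambda>j. \<Sum>s<m. c s * unitv s j) k z) has_contour_integral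
     (\<Sum>s<m. c s * contour_integral (circlepath (pt x i) r) (dphi n x (unitv s) k))) (circlepath (pt x i) r)"
proof -
  let ?\<gamma> = "circlepath (pt x i) r"
  have int: "(dphi n x v k) contour_integrable_on ?\<gamma>" for v
  proof (rule contour_integrable_continuous_circlepath)
    have P0: "prodP n x z \<noteq> 0" if "z \<in> path_image ?\<gamma>" for z
      using circle_avoids_ends[OF r i that] prodP_nonzero_iff by blast
    have z: "z - pt x j \<noteq> 0" if "z \<in> path_image ?\<gamma>" "j < n" for z j
      using circle_avoids_ends[OF r i that(1)] that(2) unfolding ends_def by auto
    have "dphi n x v k holomorphic_on path_image ?\<gamma>" unfolding dphi_def[abs_def]
      by (intro holomorphic_intros) (use P0 z in auto)
    then show "continuous_on (path_image ?\<gamma>) (dphi n x v k)" by (rule holomorphic_on_imp_continuous_on)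
  qed
  show ?thesis
  proof (induction m)
    case 0
    have "dphi n x (\<lambda>j. 0) k z = 0" for z
      unfolding dphi_def dnum_def polyA_def polyB_def coef_a_def coef_b_def pt_def by simp
    then show ?case by (simp add: has_contour_integral_0)
  next
    case (Suc m)
    have "((\<lambda>z. dphi n x (\<lambda>j. \<Sum>s<m. c s * unitv s j) k z + c m * dphi n x (unitv m) k z) has_contour_integral
     (\<Sum>s<m. c s * contour_integral ?\<gamma> (dphi n x (unitv s) k)) + c m * contour_integral ?\<gamma> (dphi n x (unitv m) k)) ?\<gamma>"
      by (intro has_contour_integral_add has_contour_integral_lmul Suc.IH has_contour_integral_integral int)
    then show ?case unfolding dphi_linear[symmetric] by simp
  qed
qed

section \<open>Primitives of the variation\<close>

text \<open>Induction on the total multiplicity. A multiple of the product Q of the other factors is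
  subtracted to make the numerator vanish at p_i; one linear factor cancels, and the multiple gives
  the term of top order there. The case R = 0 is listed separately because the zero polynomial has
  degree 0, which is not below an empty sum.\<close>

lemma partial_fractions:
  fixes p :: "nat \<Rightarrow> complex" and R :: "complex poly"
  assumes inj: "inj_on p {..<n}" and deg: "R = 0 \<or> degree R < (\<Sum>i<n. m i)"
  shows "\<exists>c. \<forall>z. z \<notin> p ` {..<n} \<longrightarrow> poly R z / (\<Prod>i<n. (z - p i) ^ m i) = (\<Sum>i<n. \<Sum>j=1..m i. c i j / (z - p i) ^ j)"
  using deg
proof (induction "\<Sum>i<n. m i" arbitrary: R m)
  case 0
  then have "R = 0" by auto
  then show ?case by (intro exI[of _ "\<lambda>_ _. 0"]) auto
next
  case (Suc N)
  then obtain i where i: "i < n" "0 < m i"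
    by (metis (no_types, lifting) Zero_not_Suc lessThan_iff neq0_conv sum.neutral)
  define Q where "Q = (\<Prod>j\<in>{..<n} - {i}. [:- p j, 1:] ^ m j)"
  have polyQ: "poly Q z = (\<Prod>j\<in>{..<n} - {i}. (z - p j) ^ m j)" for z
    unfolding Q_def by (simp add: poly_prod)
  have degQ: "degree Q + m i = Suc N"
  proof -
    have "degree Q = (\<Sum>j\<in>{..<n} - {i}. m j)" unfolding Q_def
      by (subst degree_prod_eq_sum_degree) (auto simp: degree_linear_power)
    then show ?thesis using Suc.hyps(2) i by (simp add: sum.remove[of "{..<n}" i])
  qed
  have Q0: "poly Q (p i) \<noteq> 0" unfolding polyQ using inj i(1) by (auto dest: inj_onD)
  define c where "c = poly R (p i) / poly Q (p i)"
  have "poly (R - Polynomial.smult c Q) (p i) = 0" unfolding c_def using Q0 by simp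
  then obtain R1 where R1: "R - Polynomial.smult c Q = [:- p i, 1:] * R1" by (metis dvdE poly_eq_0_iff_dvd)
  define m' where "m' = m(i := m i - 1)"
  have N: "N = (\<Sum>j<n. m' j)"
  proof -
    have "(\<Sum>j<n. m' j) = m' i + (\<Sum>j\<in>{..<n} - {i}. m' j)" using i by (simp add: sum.remove)
    also have "(\<Sum>j\<in>{..<n} - {i}. m' j) = (\<Sum>j\<in>{..<n} - {i}. m j)" unfolding m'_def by (intro sum.cong) auto
    also have "m' i + \<dots> + 1 = (\<Sum>j<n. m j)" using i unfolding m'_def by (simp add: sum.remove[of "{..<n}" i])
    finally show ?thesis using Suc.hyps(2) by simp
  qed
  have "R1 = 0 \<or> degree R1 < (\<Sum>j<n. m' j)"
  proof (cases "R1 = 0")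
    case False
    have "degree (R - Polynomial.smult c Q) = Suc (degree R1)"
      unfolding R1 using False by (subst degree_mult_eq) auto
    moreover have "degree (R - Polynomial.smult c Q) < Suc N"
    proof -
      have "degree R < Suc N" using Suc.prems Suc.hyps(2) by auto
      moreover have "degree (Polynomial.smult c Q) < Suc N" using degQ i(2) degree_smult_le[of c Q] by linarith
      ultimately show ?thesis by (rule degree_diff_less)
    qed
    ultimately show ?thesis using N by simp
  qed simp
  from Suc.hyps(1)[OF N this] obtain c' where
    c': "\<And>z. z \<notin> p ` {..<n} \<Longrightarrow> poly R1 z / (\<Prod>j<n. (z - p j) ^ m' j) = (\<Sum>l<n. \<Sum>j=1..m' l. c' l j / (z - p l) ^ j)"
    by blast
  define d where "d l j = (if l = i \<and> j = m i then c else c' l j)" for l j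
  show ?case
  proof (intro exI[of _ d] allI impI)
    fix z assume z: "z \<notin> p ` {..<n}"
    define u where "u = z - p i"
    have u: "u \<noteq> 0" using z i unfolding u_def by auto
    have Qz: "poly Q z \<noteq> 0" unfolding polyQ using z by auto
    have "m i = Suc (m i - 1)" using i by simp
    then have um: "u ^ m i = u * u ^ (m i - 1)" by (metis power_Suc)
    have P: "(\<Prod>j<n. (z - p j) ^ m j) = u ^ m i * poly Q z"
      unfolding polyQ u_def using i by (simp add: prod.remove)
    have P': "(\<Prod>j<n. (z - p j) ^ m' j) = u ^ (m i - 1) * poly Q z"
    proof -
      have "(\<Prod>j<n. (z - p j) ^ m' j) = (z - p i) ^ m' i * (\<Prod>j\<in>{..<n} - {i}. (z - p j) ^ m' j)"
        using i by (simp add: prod.remove)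
      also have "(\<Prod>j\<in>{..<n} - {i}. (z - p j) ^ m' j) = poly Q z"
        unfolding polyQ m'_def by (intro prod.cong) auto
      finally show ?thesis unfolding m'_def u_def by simp
    qed
    have "poly R z = poly (R - Polynomial.smult c Q) z + c * poly Q z" by simp
    also have "\<dots> = u * poly R1 z + c * poly Q z" unfolding R1 u_def by (simp add: algebra_simps)
    finally have "poly R z / (\<Prod>j<n. (z - p j) ^ m j) = poly R1 z / (\<Prod>j<n. (z - p j) ^ m' j) + c / u ^ m i"
      unfolding P P' um using u Qz by (simp add: add_divide_distrib)
    also have "\<dots> = (\<Sum>l<n. \<Sum>j=1..m' l. c' l j / (z - p l) ^ j) + c / u ^ m i" using c'[OF z] by simp
    also have "\<dots> = (\<Sum>l<n. \<Sum>j=1..m l. d l j / (z - p l) ^ j)"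
    proof -
      have "(\<Sum>l\<in>{..<n} - {i}. \<Sum>j=1..m' l. c' l j / (z - p l) ^ j) = (\<Sum>l\<in>{..<n} - {i}. \<Sum>j=1..m l. d l j / (z - p l) ^ j)"
        unfolding m'_def d_def by (intro sum.cong) auto
      moreover have "(\<Sum>j=1..m i. d i j / (z - p i) ^ j) = (\<Sum>j=1..m' i. c' i j / (z - p i) ^ j) + c / u ^ m i"
      proof -
        have "{1..m i} = insert (m i) {1..m i - 1}" using i by auto
        then have "(\<Sum>j=1..m i. d i j / (z - p i) ^ j) = d i (m i) / (z - p i) ^ m i + (\<Sum>j=1..m i - 1. d i j / (z - p i) ^ j)"
          using i by simp
        also have "(\<Sum>j=1..m i - 1. d i j / (z - p i) ^ j) = (\<Sum>j=1..m i - 1. c' i j / (z - p i) ^ j)"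
          unfolding d_def using i by (intro sum.cong) auto
        finally show ?thesis unfolding d_def m'_def u_def by simp
      qed
      ultimately show ?thesis using i by (simp add: sum.remove[of "{..<n}" i])
    qed
    finally show "poly R z / (\<Prod>j<n. (z - p j) ^ m j) = (\<Sum>l<n. \<Sum>j=1..m l. d l j / (z - p l) ^ j)" .
  qed
qed

lemma degree_PA: "degree (PA n x) \<le> n - 1" and degree_PB: "degree (PB n x) \<le> n - 1"
  unfolding PA_def PB_def by (intro degree_sum_le; auto intro: order.trans[OF degree_monom_le])+

lemma decay_simple_fraction:
  fixes p :: complex
  shows "((\<lambda>z. z * (1 / (z - p) ^ Suc (Suc j))) \<longlongrightarrow> 0) at_infinity"
    and "((\<lambda>z. z * (1 / (z - p))) \<longlongrightarrow> 1) at_infinity"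
proof -
  have "((\<lambda>z. poly [:0, 1:] z / poly ([:- p, 1:] ^ Suc (Suc j)) z) \<longlongrightarrow> 0) at_infinity"
    by (rule poly_divide_tendsto_0_at_infinity) (simp only: degree_linear_power, simp)
  then show "((\<lambda>z. z * (1 / (z - p) ^ Suc (Suc j))) \<longlongrightarrow> 0) at_infinity"
    by (simp only: poly_power poly_pCons poly_0 mult_zero_right add_0_right mult_1_right diff_conv_add_uminus add.commute
        times_divide_eq_right add_0_left)
  have "((\<lambda>z. poly [:p:] z / poly [:- p, 1:] z) \<longlongrightarrow> 0) at_infinity"
    by (rule poly_divide_tendsto_0_at_infinity) simp
  then have "((\<lambda>z. 1 + p / (z - p)) \<longlongrightarrow> 1 + 0) at_infinity" by (intro tendsto_intros) simp
  moreover have "eventually (\<lambda>z. 1 + p / (z - p) = z * (1 / (z - p))) at_infinity"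
    unfolding eventually_at_infinity
  proof (rule exI[of _ "cmod p + 1"], intro allI impI)
    fix z assume "cmod p + 1 \<le> cmod z"
    then have "z - p \<noteq> 0" by auto
    then show "1 + p / (z - p) = z * (1 / (z - p))" by (simp add: field_simps)
  qed
  ultimately show "((\<lambda>z. z * (1 / (z - p))) \<longlongrightarrow> 1) at_infinity"
    by (simp add: Lim_transform_eventually)
qed

text \<open>Moving an end raises its pole to order three. The sum of the simple coefficients is the
  limit of \<open>z * dphi\<close> at infinity, and this limit is 0: the residue theorem for a form
  that is regular at infinity.\<close>

lemma dphi_partial_fractions:
  assumes inj: "inj_on (pt x) {..<n}" and n: "2 \<le> n"
  shows "\<exists>c. (\<forall>z. z \<notin> ends n x \<longrightarrow> dphi n x v k z = (\<Sum>i<n. c i 1 / (z - pt x i) + c i 2 / (z - pt x i)\<^sup>2 + c i 3 / (z - pt x i)^3))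
      \<and> (\<Sum>i<n. c i (1::nat)) = 0"
proof -
  let ?p = "pt x"
  define N where "N = (if k = 0 then PB n x * PB n x else if k = 1 then PA n x * PB n x else PA n x * PA n x)"
  define dN where "dN = (if k = 0 then Polynomial.smult 2 (PB n x * PB n v)
     else if k = 1 then PA n v * PB n x + PA n x * PB n v else Polynomial.smult 2 (PA n x * PA n v))"
  have N: "poly N z = numW n x k z" and dN: "poly dN z = dnum n x v k z" for z
    unfolding N_def dN_def numW_def dnum_def by (auto simp: power2_eq_square)
  have m: "degree (f * g) \<le> 2 * n - 2" if "degree f \<le> n - 1" "degree g \<le> n - 1" for f g :: "complex poly"
    using degree_mult_le[of f g] that by linarith
  have degN: "degree N \<le> 2 * n - 2" unfolding N_def by (auto intro!: m degree_PA degree_PB)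
  have degdN: "degree dN \<le> 2 * n - 2" unfolding dN_def
    by (auto intro!: m degree_PA degree_PB degree_add_le order.trans[OF degree_smult_le])
  define P1 where "P1 = (\<Prod>l<n. [:- ?p l, 1:])"
  define H1 where "H1 j = (\<Prod>l\<in>{..<n} - {j}. [:- ?p l, 1:])" for j
  have degP1: "degree P1 = n" unfolding P1_def by (subst degree_prod_eq_sum_degree) auto
  have degH1: "degree (H1 j) \<le> n" for j unfolding H1_def
    by (subst degree_prod_eq_sum_degree) (auto intro: order.trans[OF card_mono[of "{..<n}"]])
  define R where "R = dN * P1 + N * (\<Sum>j<n. Polynomial.smult (2 * pt v j) (H1 j))"
  have degR: "degree R \<le> 3 * n - 2"
  proof -
    have "degree (dN * P1) \<le> 3 * n - 2" using degree_mult_le[of dN P1] degP1 degdN n by linarith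
    moreover have "degree (\<Sum>j<n. Polynomial.smult (2 * pt v j) (H1 j)) \<le> n"
      by (intro degree_sum_le) (auto intro: order.trans[OF degree_smult_le] degH1)
    then have "degree (N * (\<Sum>j<n. Polynomial.smult (2 * pt v j) (H1 j))) \<le> 3 * n - 2"
      using degree_mult_le[of N "\<Sum>j<n. Polynomial.smult (2 * pt v j) (H1 j)"] degN n by linarith
    ultimately show ?thesis unfolding R_def by (rule degree_add_le)
  qed
  have "degree R < (\<Sum>i<n. 3)" using degR n by simp
  from partial_fractions[OF inj disjI2[OF this]] obtain c where
    c: "\<And>z. z \<notin> ends n x \<Longrightarrow> poly R z / (\<Prod>i<n. (z - ?p i) ^ 3) = (\<Sum>i<n. \<Sum>j=1..3. c i j / (z - ?p i) ^ j)"
    unfolding ends_def by blast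
  have RP: "poly R z / (\<Prod>i<n. (z - ?p i) ^ 3) = dphi n x v k z" if z: "z \<notin> ends n x" for z
  proof -
    have z': "z - ?p l \<noteq> 0" if "l < n" for l using z that unfolding ends_def by auto
    define q where "q = poly P1 z"
    have q: "q = (\<Prod>l<n. (z - ?p l))" unfolding q_def P1_def by (simp add: poly_prod)
    have q0: "q \<noteq> 0" unfolding q using z' by auto
    have 3: "(\<Prod>i<n. (z - ?p i) ^ 3) = q ^ 3" unfolding q by (simp add: prod_power_distrib)
    have 2: "prodP n x z = q ^ 2" unfolding q prodP_def by (simp add: prod_power_distrib)
    have "poly (H1 j) z = q / (z - ?p j)" if "j < n" for j
    proof -
      have "q = (z - ?p j) * poly (H1 j) z" unfolding q H1_def using that by (simp add: poly_prod prod.remove)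
      then show ?thesis using z'[OF that] by (simp add: field_simps)
    qed
    then have "poly R z = dnum n x v k z * q + numW n x k z * (\<Sum>j<n. 2 * pt v j * (q / (z - ?p j)))"
      unfolding R_def by (simp add: poly_sum N dN q_def)
    also have "(\<Sum>j<n. 2 * pt v j * (q / (z - ?p j))) = q * (\<Sum>j<n. 2 * pt v j / (z - ?p j))"
      unfolding sum_distrib_left by (intro sum.cong) auto
    finally show ?thesis unfolding dphi_def 2 3 using q0
      by (simp add: field_simps power2_eq_square power3_eq_cube)
  qed
  have s3: "(\<Sum>j=1..3. f j) = f 1 + f 2 + f 3" for f :: "nat \<Rightarrow> complex"
  proof -
    have "{1..3} = {1, 2, 3::nat}" by auto
    then show ?thesis by (simp add: add.assoc)
  qed
  have eq: "dphi n x v k z = (\<Sum>i<n. c i 1 / (z - ?p i) + c i 2 / (z - ?p i)\<^sup>2 + c i 3 / (z - ?p i)^3)"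
    if "z \<notin> ends n x" for z
    using c[OF that] unfolding RP[OF that] s3 by simp
  \<comment> \<open>A, B and their variations have degree at most n - 1, so R has degree at most (2n
    - 2) + n = 3n - 2. Even \<open>z * R\<close> stays below the degree 3n of the
    denominator.\<close>
  have "((\<lambda>z. poly (pCons 0 R) z / poly (\<Prod>i<n. [:- ?p i, 1:] ^ 3) z) \<longlongrightarrow> 0) at_infinity"
  proof (rule poly_divide_tendsto_0_at_infinity)
    have "degree (\<Prod>i<n. [:- ?p i, 1:] ^ 3) = 3 * n"
      by (subst degree_prod_eq_sum_degree) (auto simp: degree_linear_power simp del: power_Suc)
    moreover have "degree (pCons 0 R) \<le> Suc (degree R)" by (simp add: degree_pCons_le)
    ultimately show "degree (pCons 0 R) < degree (\<Prod>i<n. [:- ?p i, 1:] ^ 3)" using degR n by linarith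
  qed
  then have L0: "((\<lambda>z. z * (poly R z / (\<Prod>i<n. (z - ?p i) ^ 3))) \<longlongrightarrow> 0) at_infinity"
    by (simp add: poly_prod)
  have L1: "((\<lambda>z. \<Sum>i<n. (c i 1 * (z * (1 / (z - ?p i))) + c i 2 * (z * (1 / (z - ?p i) ^ Suc (Suc 0)))
      + c i 3 * (z * (1 / (z - ?p i) ^ Suc (Suc 1))))) \<longlongrightarrow> (\<Sum>i<n. (c i 1 * 1 + c i 2 * 0 + c i 3 * 0))) at_infinity"
    by (intro tendsto_intros decay_simple_fraction)
  have "eventually (\<lambda>z. z \<notin> ends n x) at_infinity"
  proof -
    obtain b where "\<forall>p\<in>ends n x. cmod p < b"
      using finite_imp_bounded[OF finite_ends[of n x]] unfolding bounded_pos_less by auto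
    then show ?thesis unfolding eventually_at_infinity by (intro exI[of _ b]) force
  qed
  then have "eventually (\<lambda>z. (\<Sum>i<n. (c i 1 * (z * (1 / (z - ?p i))) + c i 2 * (z * (1 / (z - ?p i) ^ Suc (Suc 0)))
      + c i 3 * (z * (1 / (z - ?p i) ^ Suc (Suc 1))))) = z * (poly R z / (\<Prod>i<n. (z - ?p i) ^ 3))) at_infinity"
  proof eventually_elim
    case (elim z)
    show ?case unfolding RP[OF elim] eq[OF elim] sum_distrib_left
      by (intro sum.cong) (auto simp: algebra_simps power2_eq_square power3_eq_cube)
  qed
  from Lim_transform_eventually[OF L1 this]
  have "(\<Sum>i<n. (c i 1 * 1 + c i 2 * 0 + c i 3 * 0)) = 0"
    using L0 tendsto_unique trivial_limit_at_infinity by blast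
  then have "(\<Sum>i<n. c i 1) = 0" by simp
  with eq show ?thesis by blast
qed

text \<open>The vector \<open>numW\<close> = (B^2, AB, A^2) is annihilated by \<open>Qfun\<close>,
  and so is its variation \<open>dnum\<close>. The contribution of the moving ends is a scalar
  multiple of \<open>numW\<close>.\<close>

lemma Qfun_dphi: "Qfun (polyA n x) (polyB n x) (dphi n x v) z = 0"
  unfolding Qfun_def dphi_def dnum_def numW_def
  by (simp add: add_divide_distrib algebra_simps power2_eq_square)

text \<open>The triple pole is caused by the motion of p_i alone. The formula serves twice: it makes
  the leading coefficient of the primitive tangential, and it recovers \<open>pt v i\<close> when
  the variation vanishes.\<close>

lemma dphi_leading_limit:
  assumes r: "small_radius n x r" and i: "i < n"
  shows "((\<lambda>z. (z - pt x i)^3 * dphi n x v k z) \<longlongrightarrow> 2 * pt v i * numW n x k (pt x i) / prodHat n x i (pt x i)) (at (pt x i))"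
proof -
  let ?p = "pt x i"
  have r0: "r > 0" using r unfolding small_radius_def by simp
  have H: "prodHat n x i ?p \<noteq> 0" using prodHat_nonzero[OF r i, of ?p] r0 by simp
  have cont: "isCont f ?p" if "f holomorphic_on UNIV" for f
    using that by (meson UNIV_I continuous_on_eq_continuous_at holomorphic_on_imp_continuous_on open_UNIV)
  have cs: "isCont (dnum n x v k) ?p" "isCont (numW n x k) ?p" "isCont (prodHat n x i) ?p"
    by (intro cont holomorphic_intros)+
  have ne: "?p - pt x l \<noteq> 0" if "l \<in> {..<n} - {i}" for l
    using r i that unfolding small_radius_def by fastforce
  define g where "g z = (z - ?p) * dnum n x v k z / prodHat n x i z
    + numW n x k z / prodHat n x i z * (2 * pt v i + (z - ?p) * (\<Sum>l\<in>{..<n} - {i}. 2 * pt v l / (z - pt x l)))" for z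
  have "isCont g ?p" unfolding g_def[abs_def]
    by (intro continuous_intros cs) (use H ne in auto)
  then have "(g \<longlongrightarrow> g ?p) (at ?p)" by (simp add: isContD)
  moreover have "g ?p = 2 * pt v i * numW n x k ?p / prodHat n x i ?p" unfolding g_def by simp
  moreover have "eventually (\<lambda>z. g z = (z - ?p)^3 * dphi n x v k z) (at ?p)"
    unfolding eventually_at
  proof (intro exI[of _ r] conjI ballI impI r0)
    fix z assume z: "z \<noteq> ?p \<and> dist z ?p < r"
    obtain u where u: "z - ?p = u" by blast
    then have u0: "u \<noteq> 0" using z by auto
    have S: "(\<Sum>l<n. 2 * pt v l / (z - pt x l)) = 2 * pt v i / u + (\<Sum>l\<in>{..<n} - {i}. 2 * pt v l / (z - pt x l))"
      using i by (simp add: sum.remove u)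
    have "u^3 * (a / (u\<^sup>2 * b) * c) = a / b * (u * c)" for a b c
      using u0 by (simp add: power2_eq_square power3_eq_cube)
    from this[of "dnum n x v k z" "prodHat n x i z" 1]
      this[of "numW n x k z" "prodHat n x i z" "\<Sum>l<n. 2 * pt v l / (z - pt x l)"]
    have "u^3 * dphi n x v k z = dnum n x v k z / prodHat n x i z * u
        + numW n x k z / prodHat n x i z * (u * (\<Sum>l<n. 2 * pt v l / (z - pt x l)))"
      unfolding dphi_def prodP_split[OF i] u by (simp add: distrib_left)
    moreover have "u * (\<Sum>l<n. 2 * pt v l / (z - pt x l))
        = 2 * pt v i + u * (\<Sum>l\<in>{..<n} - {i}. 2 * pt v l / (z - pt x l))"
      unfolding S using u0 by (simp add: distrib_left)
    ultimately show "g z = (z - ?p)^3 * dphi n x v k z"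
      unfolding g_def u by (simp add: mult.commute)
  qed
  ultimately show ?thesis using Lim_transform_eventually by fastforce
qed

text \<open>Without simple poles the partial fractions have a rational primitive. The degree bound
  2n on its numerator leaves room for a constant, whose numerator over \<open>prodP\<close> has
  degree 2n; it later bounds the degree of the vector field.\<close>

lemma dphi_primitive:
  assumes inj: "inj_on (pt x) {..<n}" and n: "2 \<le> n" and r: "small_radius n x r"
    and van: "\<And>i k. i < n - 1 \<Longrightarrow> k < 3 \<Longrightarrow> (dphi n x v k has_contour_integral 0) (circlepath (pt x i) r)"
  obtains E where "admissible n x E"
    and "\<And>k z. k < 3 \<Longrightarrow> z \<notin> ends n x \<Longrightarrow> (E k has_field_derivative dphi n x v k z) (at z)"
    and "\<And>k. \<exists>e. degree e \<le> 2 * n \<and> (\<forall>z. z \<notin> ends n x \<longrightarrow> E k z = poly e z / prodP n x z)"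
proof -
  let ?p = "pt x"
  have r0: "r > 0" using r unfolding small_radius_def by simp
  have pe: "z - ?p i \<noteq> 0" if "z \<notin> ends n x" "i < n" for z i using that unfolding ends_def by auto
  have "\<forall>k. \<exists>c. (\<forall>z. z \<notin> ends n x \<longrightarrow> dphi n x v k z = (\<Sum>i<n. c i 1 / (z - ?p i) + c i 2 / (z - ?p i)\<^sup>2 + c i 3 / (z - ?p i)^3))
      \<and> (\<Sum>i<n. c i (1::nat)) = 0"
    using dphi_partial_fractions[OF inj n] by blast
  from choice[OF this] obtain C where C0: "\<forall>k. (\<forall>z. z \<notin> ends n x \<longrightarrow> dphi n x v k z = (\<Sum>i<n. C k i 1 / (z - ?p i) + C k i 2 / (z - ?p i)\<^sup>2 + C k i 3 / (z - ?p i)^3))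
      \<and> (\<Sum>i<n. C k i (1::nat)) = 0" ..
  have C: "\<And>k z. z \<notin> ends n x \<Longrightarrow> dphi n x v k z = (\<Sum>i<n. C k i 1 / (z - ?p i) + C k i 2 / (z - ?p i)\<^sup>2 + C k i 3 / (z - ?p i)^3)"
      and Csum: "\<And>k. (\<Sum>i<n. C k i (1::nat)) = 0" using C0 by blast+
  \<comment> \<open>Termwise primitive of the double and triple poles. It vanishes at infinity, so
    regularity there is immediate.\<close>
  define E where "E k z = (\<Sum>i<n. - (C k i 2 / (z - ?p i)) - C k i 3 / 2 / (z - ?p i)\<^sup>2)" for k z
  have dE: "(E k has_field_derivative (\<Sum>i<n. C k i 2 / (z - ?p i)\<^sup>2 + C k i 3 / (z - ?p i)^3)) (at z)"
    if z: "z \<notin> ends n x" for k z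
    unfolding E_def[abs_def]
  proof (rule DERIV_sum)
    fix i assume i: "i \<in> {..<n}"
    obtain u where u: "z - ?p i = u" by blast
    have u0: "u \<noteq> 0" using pe[OF z] i u by auto
    have "((\<lambda>z. - (C k i 2 / (z - ?p i)) - C k i 3 / 2 / (z - ?p i)\<^sup>2) has_field_derivative
       C k i 2 / (z - ?p i) / (z - ?p i) + C k i 3 / 2 * (2 * (z - ?p i)) / ((z - ?p i)\<^sup>2 * (z - ?p i)\<^sup>2)) (at z)"
      using u0 u by (auto intro!: derivative_eq_intros simp del: right_diff_distrib_numeral)
    then show "((\<lambda>z. - (C k i 2 / (z - ?p i)) - C k i 3 / 2 / (z - ?p i)\<^sup>2) has_field_derivative
       C k i 2 / (z - ?p i)\<^sup>2 + C k i 3 / (z - ?p i)^3) (at z)"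
      by (rule DERIV_cong) (use u0 in \<open>simp add: u field_simps power2_eq_square power3_eq_cube\<close>)
  qed
  have res: "C k i 1 = 0" if k: "k < 3" and i: "i < n - 1" for k i
  proof -
    let ?\<gamma> = "circlepath (?p i) r"
    have i': "i < n" using i by simp
    have im: "z \<notin> ends n x" if "z \<in> path_image ?\<gamma>" for z using circle_avoids_ends[OF r i' that] .
    have "((\<lambda>z. \<Sum>i<n. C k i 2 / (z - ?p i)\<^sup>2 + C k i 3 / (z - ?p i)^3) has_contour_integral 0) ?\<gamma>"
      by (rule Cauchy_theorem_primitive[of "- ends n x" "E k"])
         (use im dE in \<open>auto intro: has_field_derivative_at_within\<close>)
    moreover have "((\<lambda>z. \<Sum>l<n. C k l 1 * (1 / (z - ?p l))) has_contour_integral (\<Sum>l<n. C k l 1 * (if l = i then 2 * of_real pi * \<i> else 0))) ?\<gamma>"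
    proof (intro has_contour_integral_sum has_contour_integral_lmul)
      fix l assume l: "l \<in> {..<n}"
      show "((\<lambda>z. 1 / (z - ?p l)) has_contour_integral (if l = i then 2 * of_real pi * \<i> else 0)) ?\<gamma>"
      proof (cases "l = i")
        case True
        have "(\<lambda>z. 1 / (z - ?p i)) contour_integrable_on ?\<gamma>"
          by (intro contour_integrable_continuous_circlepath continuous_intros) (use im pe i' in auto)
        then show ?thesis using True contour_integral_circlepath[OF r0, of "?p i"] has_contour_integral_integral by fastforce
      next
        case False
        then have "cmod (?p i - ?p l) > r" using r i' l unfolding small_radius_def by auto
        then have "(\<lambda>z. 1 / (z - ?p l)) holomorphic_on cball (?p i) r"
          by (intro holomorphic_intros) (auto simp: dist_norm)
        then have "((\<lambda>z. 1 / (z - ?p l)) has_contour_integral 0) ?\<gamma>"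
          by (rule Cauchy_theorem_convex_simple) (use r0 in auto)
        then show ?thesis using False by simp
      qed
    qed auto
    ultimately have "((\<lambda>z. (\<Sum>i<n. C k i 2 / (z - ?p i)\<^sup>2 + C k i 3 / (z - ?p i)^3) + (\<Sum>l<n. C k l 1 * (1 / (z - ?p l))))
       has_contour_integral 0 + (\<Sum>l<n. C k l 1 * (if l = i then 2 * of_real pi * \<i> else 0))) ?\<gamma>"
      by (rule has_contour_integral_add)
    then have "(dphi n x v k has_contour_integral 0 + (\<Sum>l<n. C k l 1 * (if l = i then 2 * of_real pi * \<i> else 0))) ?\<gamma>"
    proof (rule has_contour_integral_eq)
      fix z assume "z \<in> path_image ?\<gamma>"
      then show "(\<Sum>i<n. C k i 2 / (z - ?p i)\<^sup>2 + C k i 3 / (z - ?p i)^3) + (\<Sum>l<n. C k l 1 * (1 / (z - ?p l))) = dphi n x v k z"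
        unfolding C[OF im[OF \<open>z \<in> path_image ?\<gamma>\<close>]] sum.distrib[symmetric] by (simp add: algebra_simps)
    qed
    moreover have "(\<Sum>l<n. C k l 1 * (if l = i then 2 * of_real pi * \<i> else 0)) = C k i 1 * (2 * of_real pi * \<i>)"
    proof -
      have "(\<Sum>l<n. C k l 1 * (if l = i then 2 * of_real pi * \<i> else 0)) = (\<Sum>l<n. if l = i then C k l 1 * (2 * of_real pi * \<i>) else 0)"
        by (intro sum.cong) auto
      then show ?thesis using i' by simp
    qed
    ultimately have "C k i 1 * (2 * of_real pi * \<i>) = 0"
      using has_contour_integral_unique[OF van[OF i k]] by fastforce
    then show ?thesis by simp
  qed
  \<comment> \<open>The last end has no hypothesis of its own; its coefficient is 0 because all of
    them add up to 0.\<close>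
  have res': "C k i 1 = 0" if k: "k < 3" and i: "i < n" for k i
  proof (cases "i < n - 1")
    case False
    then have "i = n - 1" using i by simp
    moreover have "(\<Sum>i<n. C k i 1) = C k (n - 1) 1"
    proof -
      obtain m where m: "n = Suc m" using n by (cases n) auto
      have "(\<Sum>i<m. C k i 1) = 0" using res[OF k] m by (intro sum.neutral) auto
      then show ?thesis unfolding m by simp
    qed
    ultimately show ?thesis using Csum by simp
  qed (use res k in auto)
  have dphi: "dphi n x v k z = (\<Sum>i<n. C k i 2 / (z - ?p i)\<^sup>2 + C k i 3 / (z - ?p i)^3)"
    if "k < 3" "z \<notin> ends n x" for k z
    unfolding C[OF that(2)] using res'[OF that(1)] by (intro sum.cong) auto
  have D: "(E k has_field_derivative dphi n x v k z) (at z)" if "k < 3" "z \<notin> ends n x" for k z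
    unfolding dphi[OF that] by (rule dE[OF that(2)])
  have C3: "C k i 3 = 2 * pt v i * numW n x k (?p i) / prodHat n x i (?p i)" if k: "k < 3" and i: "i < n" for k i
  proof -
    have ne: "?p i - ?p l \<noteq> 0" if "l \<in> {..<n} - {i}" for l
      using inj i that by (auto dest: inj_onD)
    define g where "g z = (z - ?p i) * C k i 2 + C k i 3
       + (z - ?p i)^3 * (\<Sum>l\<in>{..<n} - {i}. C k l 2 / (z - ?p l)\<^sup>2 + C k l 3 / (z - ?p l)^3)" for z
    have "isCont g (?p i)" unfolding g_def[abs_def] by (intro continuous_intros) (use ne in auto)
    then have "(g \<longlongrightarrow> g (?p i)) (at (?p i))" by (simp add: isContD)
    moreover have "g (?p i) = C k i 3" unfolding g_def by simp
    moreover have "eventually (\<lambda>z. z \<in> (- (ends n x - {?p i})) - {?p i}) (at (?p i))"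
      by (intro eventually_at_in_open open_Compl finite_imp_closed finite_Diff finite_ends) auto
    then have "eventually (\<lambda>z. g z = (z - ?p i)^3 * dphi n x v k z) (at (?p i))"
    proof eventually_elim
      case (elim z)
      then have z: "z \<notin> ends n x" by auto
      obtain u where u: "z - ?p i = u" by blast
      have u0: "u \<noteq> 0" using pe[OF z i] u by auto
      define s where "s = (\<Sum>l\<in>{..<n} - {i}. C k l 2 / (z - ?p l)\<^sup>2 + C k l 3 / (z - ?p l)^3)"
      have "(\<Sum>l<n. C k l 2 / (z - ?p l)\<^sup>2 + C k l 3 / (z - ?p l)^3) = C k i 2 / u\<^sup>2 + C k i 3 / u^3 + s"
        unfolding s_def u[symmetric] using i by (intro sum.remove) auto
      then show ?case unfolding dphi[OF k z] g_def u s_def[symmetric] using u0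
        by (simp add: field_simps power2_eq_square power3_eq_cube)
    qed
    ultimately have "((\<lambda>z. (z - ?p i)^3 * dphi n x v k z) \<longlongrightarrow> C k i 3) (at (?p i))"
      using Lim_transform_eventually by fastforce
    then show ?thesis using dphi_leading_limit[OF r i] tendsto_unique trivial_limit_at by blast
  qed
  have holE: "E k holomorphic_on - ends n x" for k
    using dE by (auto simp: holomorphic_on_open)
  have nd: "null_deriv (- ends n x) (polyA n x) (polyB n x) E"
    unfolding null_deriv_def
  proof (intro conjI ballI allI impI holE holomorphic_intros)
    fix z assume "z \<in> - ends n x"
    then have "deriv (E k) z = dphi n x v k z" if "k < 3" for k
      using D[OF that] DERIV_imp_deriv by auto
    then have "Qfun (polyA n x) (polyB n x) (\<lambda>k. deriv (E k)) z = Qfun (polyA n x) (polyB n x) (dphi n x v) z"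
      unfolding Qfun_def by simp
    then show "Qfun (polyA n x) (polyB n x) (\<lambda>k. deriv (E k)) z = 0" by (simp add: Qfun_dphi)
  qed
  have "regular_at n x E p" if p_end: "p \<in> ends n x" for p
  proof -
    obtain i where i: "i < n" "p = ?p i" using p_end unfolding ends_def by auto
    define \<epsilon> where "\<epsilon> k z = - (z - ?p i) * C k i 2 - C k i 3 / 2
       + (z - ?p i)\<^sup>2 * (\<Sum>l\<in>{..<n} - {i}. - (C k l 2 / (z - ?p l)) - C k l 3 / 2 / (z - ?p l)\<^sup>2)" for k z
    have ne: "z - ?p l \<noteq> 0" if "l \<in> {..<n} - {i}" "z \<in> ball (?p i) r" for l z
    proof
      assume "z - ?p l = 0"
      then have "cmod (?p i - ?p l) < r" using that(2) by (simp add: dist_norm)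
      then show False using r i(1) that(1) unfolding small_radius_def by force
    qed
    have h: "\<epsilon> k holomorphic_on ball p r" for k
      unfolding \<epsilon>_def[abs_def] i(2) by (intro holomorphic_intros) (use ne in auto)
    have e: "E k z = \<epsilon> k z / (z - p)\<^sup>2" if "z \<in> ball p r - {p}" for k z
    proof -
      obtain u where u: "z - ?p i = u" by blast
      have u0: "u \<noteq> 0" using that u i by auto
      define s where "s = (\<Sum>l\<in>{..<n} - {i}. - (C k l 2 / (z - ?p l)) - C k l 3 / 2 / (z - ?p l)\<^sup>2)"
      have "E k z = - (C k i 2 / u) - C k i 3 / 2 / u\<^sup>2 + s"
        unfolding E_def s_def u[symmetric] using i(1) by (intro sum.remove) auto
      then show ?thesis unfolding \<epsilon>_def i(2) u s_def[symmetric] using u0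
        by (simp add: field_simps power2_eq_square)
    qed
    \<comment> \<open>The leading coefficient is \<open>- C k i 3 / 2\<close>. Its factor in front
      of \<open>numW\<close> does not depend on k, which is the form that \<open>regular_at\<close>
      prescribes.\<close>
    have p: "\<epsilon> k p = - pt v i / prodHat n x i p * numW n x k p" if "k < 3" for k
      unfolding \<epsilon>_def i(2) using C3[OF that i(1)] by simp
    show ?thesis unfolding regular_at_def
    proof (rule exI[of _ r], rule conjI[OF r0], rule exI[of _ \<epsilon>], rule exI[of _ "- pt v i / prodHat n x i p"], intro conjI allI impI ballI)
      show "\<epsilon> 0 p = - pt v i / prodHat n x i p * (polyB n x p)\<^sup>2" using p[of 0] unfolding numW_def by simp
      show "\<epsilon> 1 p = - pt v i / prodHat n x i p * (polyA n x p * polyB n x p)" using p[of 1] unfolding numW_def by simp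
      show "\<epsilon> 2 p = - pt v i / prodHat n x i p * (polyA n x p)\<^sup>2" using p[of 2] unfolding numW_def by simp
    qed (use h e in auto)
  qed
  moreover have "regular_at_infinity E"
  proof -
    obtain b where b: "b > 0" "\<forall>p\<in>ends n x. cmod p < b"
      using finite_imp_bounded[OF finite_ends[of n x]] unfolding bounded_pos_less by auto
    define \<epsilon> where "\<epsilon> k w = (\<Sum>i<n. - (C k i 2 * w / (1 - ?p i * w)) - C k i 3 / 2 * w\<^sup>2 / (1 - ?p i * w)\<^sup>2)" for k w
    have ne: "1 - ?p i * w \<noteq> 0" if "i < n" "w \<in> ball 0 (1 / b)" for i w
    proof
      assume "1 - ?p i * w = 0"
      then have "cmod (?p i) * cmod w = 1" by (metis eq_iff_diff_eq_0 norm_mult norm_one)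
      moreover have "cmod (?p i) * cmod w \<le> b * cmod w"
        using b(2) that(1) unfolding ends_def by (intro mult_right_mono) (auto intro: less_imp_le)
      moreover have "b * cmod w < 1" using that(2) b(1) by (simp add: field_simps)
      ultimately show False by simp
    qed
    show ?thesis unfolding regular_at_infinity_def
    proof (rule exI[of _ "1 / b"], rule conjI, use b in simp, rule exI[of _ \<epsilon>], intro allI impI conjI ballI)
      show "\<epsilon> k holomorphic_on ball 0 (1 / b)" for k
        unfolding \<epsilon>_def[abs_def] by (intro holomorphic_intros) (use ne in auto)
      fix k w assume w: "w \<in> ball 0 (1 / b) - {0::complex}"
      show "E k (1 / w) = \<epsilon> k w" unfolding E_def \<epsilon>_def
      proof (intro sum.cong refl)
        fix i assume i: "i \<in> {..<n}"
        have w0: "w \<noteq> 0" using w by simp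
        then have e: "1 / w - ?p i = (1 - ?p i * w) / w" by (simp add: field_simps)
        show "- (C k i 2 / (1 / w - ?p i)) - C k i 3 / 2 / (1 / w - ?p i)\<^sup>2
          = - (C k i 2 * w / (1 - ?p i * w)) - C k i 3 / 2 * w\<^sup>2 / (1 - ?p i * w)\<^sup>2"
          unfolding e power_divide by simp
      qed
    qed
  qed
  ultimately have "admissible n x E" using nd unfolding admissible_def by blast
  moreover have "\<exists>e. degree e \<le> 2 * n \<and> (\<forall>z. z \<notin> ends n x \<longrightarrow> E k z = poly e z / prodP n x z)" for k
  proof -
    define H where "H i = (\<Prod>j\<in>{..<n} - {i}. [:- ?p j, 1:] ^ 2)" for i
    have H: "poly (H i) z = prodHat n x i z" for i z unfolding H_def prodHat_def by (simp add: poly_prod)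
    have degH: "degree (H i) + 2 = 2 * n" if "i < n" for i
    proof -
      have "degree (H i) = (\<Sum>j\<in>{..<n} - {i}. 2)" unfolding H_def
        by (subst degree_prod_eq_sum_degree) (auto simp: degree_linear_power simp del: power_Suc)
      then show ?thesis using that n by simp
    qed
    define e where "e = (\<Sum>i<n. Polynomial.smult (- C k i 2) ([:- ?p i, 1:] * H i) - Polynomial.smult (C k i 3 / 2) (H i))"
    have "degree e \<le> 2 * n" unfolding e_def
    proof (intro degree_sum_le degree_diff_le)
      fix i assume "i \<in> {..<n}"
      then have d: "degree (H i) + 2 = 2 * n" using degH by simp
      show "degree (Polynomial.smult (C k i 3 / 2) (H i)) \<le> 2 * n"
        using degree_smult_le[of "C k i 3 / 2" "H i"] d by linarith
      have "degree ([:- ?p i, 1:] * H i) \<le> 1 + degree (H i)"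
        using degree_mult_le[of "[:- ?p i, 1:]" "H i"] by simp
      then show "degree (Polynomial.smult (- C k i 2) ([:- ?p i, 1:] * H i)) \<le> 2 * n"
        using degree_smult_le[of "- C k i 2" "[:- ?p i, 1:] * H i"] d by linarith
    qed auto
    moreover have "E k z = poly e z / prodP n x z" if z: "z \<notin> ends n x" for z
    proof -
      have "poly e z / prodP n x z = (\<Sum>i<n. (- C k i 2 * ((z - ?p i) * prodHat n x i z) - C k i 3 / 2 * prodHat n x i z) / prodP n x z)"
        unfolding e_def poly_sum sum_divide_distrib by (intro sum.cong) (auto simp: H algebra_simps)
      also have "\<dots> = E k z" unfolding E_def
      proof (intro sum.cong refl)
        fix i assume i: "i \<in> {..<n}"
        obtain u where u: "z - ?p i = u" by blast
        have u0: "u \<noteq> 0" using pe[OF z] i u by auto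
        have "prodHat n x i z \<noteq> 0" using prodP_nonzero_iff[of n x z] z prodP_split[of i n x z] i by auto
        then show "(- C k i 2 * ((z - ?p i) * prodHat n x i z) - C k i 3 / 2 * prodHat n x i z) / prodP n x z
          = - (C k i 2 / (z - ?p i)) - C k i 3 / 2 / (z - ?p i)\<^sup>2"
          using i u0 by (simp add: prodP_split u field_simps power2_eq_square)
      qed
      finally show ?thesis by simp
    qed
    ultimately show ?thesis by blast
  qed
  ultimately show ?thesis using D that by blast
qed

section \<open>The kernel of the period map\<close>

lemma poly_eq_0_on_open:
  fixes f :: "complex poly"
  assumes "open U" "z \<in> U" "\<And>y. y \<in> U \<Longrightarrow> poly f y = 0"
  shows "f = 0"
proof (rule ccontr)
  assume "f \<noteq> 0"
  then have "finite {y. poly f y = 0}" by (rule poly_roots_finite)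
  moreover have "U \<subseteq> {y. poly f y = 0}" using assms(3) by blast
  ultimately have "finite U" using finite_subset by blast
  then show False using assms(1,2) finite_imp_not_open by blast
qed

lemma coprime_if_no_common_root:
  fixes f g :: "complex poly"
  assumes "\<And>z. \<not> (poly f z = 0 \<and> poly g z = 0)"
  shows "coprime f g"
proof (rule coprimeI)
  fix d assume d: "d dvd f" "d dvd g"
  have "d \<noteq> 0" using assms[of 0] d by auto
  moreover have "degree d = 0"
  proof (rule ccontr)
    assume "degree d \<noteq> 0"
    then have "\<not> constant (poly d)" by (simp add: constant_degree)
    then obtain z where "poly d z = 0" using fundamental_theorem_of_algebra by blast
    then show False using assms[of z] d by (auto elim!: dvdE)
  qed
  ultimately show "is_unit d" by (simp add: is_unit_iff_degree)
qed

text \<open>Coprimality lets \<open>b\<close> be divided out of \<open>e0\<close> twice. Over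
  \<open>prodP\<close> the common factor \<open>h\<close> is the vector field with E_k = h g^k
  \<omega>.\<close>

lemma common_factor_of_proportional:
  fixes a b e0 e1 e2 :: "complex poly"
  assumes cop: "coprime a b" and b: "b \<noteq> 0" and 1: "a * e0 = b * e1" and 2: "a * e1 = b * e2"
  obtains h where "e0 = b * b * h" "e1 = a * b * h" "e2 = a * a * h"
proof -
  have "b dvd a * e0" using 1 by simp
  then have "b dvd e0" using cop coprime_commute coprime_dvd_mult_right_iff by blast
  then obtain f where f: "e0 = b * f" by (elim dvdE)
  have "b * (a * f) = b * e1" using 1 unfolding f by (simp add: algebra_simps)
  then have e1: "e1 = a * f" using b by simp
  have "b dvd a * (a * f)" using 2 unfolding e1 by simp
  then have "b dvd f" using cop coprime_commute coprime_dvd_mult_right_iff by blast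
  then obtain h where h: "f = b * h" by (elim dvdE)
  have "b * (a * a * h) = b * e2" using 2 unfolding e1 h by (simp add: algebra_simps)
  then have "e2 = a * a * h" using b by simp
  moreover have "e0 = b * b * h" "e1 = a * b * h" unfolding f e1 h by (simp_all add: mult.assoc)
  ultimately show ?thesis by (intro that)
qed

lemma coeff_PA: "i < n \<Longrightarrow> poly.coeff (PA n x) (n - 1 - i) = coef_a x i"
  and coeff_PB: "i < n \<Longrightarrow> poly.coeff (PB n x) (n - 1 - i) = coef_b x i"
proof -
  have *: "(\<Sum>j<n. if n - 1 - j = n - 1 - i then f j else 0) = f i" if "i < n" for f :: "nat \<Rightarrow> complex"
  proof -
    have "(\<Sum>j<n. if n - 1 - j = n - 1 - i then f j else 0) = (\<Sum>j<n. if j = i then f j else 0)"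
      using that by (intro sum.cong) auto
    then show ?thesis using that by simp
  qed
  show "i < n \<Longrightarrow> poly.coeff (PA n x) (n - 1 - i) = coef_a x i"
    "i < n \<Longrightarrow> poly.coeff (PB n x) (n - 1 - i) = coef_b x i"
    unfolding PA_def PB_def coeff_sum coeff_monom using * by auto
qed

text \<open>The triple poles give \<open>pt v i = 0\<close>, as B is nonzero at the ends. Then
  \<open>dnum\<close> vanishes, that is, the products of B and A with their own variations are zero
  polynomials, and neither B nor A is zero.\<close>

lemma dphi_zero_imp_zero:
  assumes nn: "nnoid_data n x" and r: "small_radius n x r"
    and F: "\<And>k z. k < 3 \<Longrightarrow> z \<notin> ends n x \<Longrightarrow> dphi n x v k z = 0"
    and s: "s < 3 * n"
  shows "v s = 0"
proof -
  have r0: "r > 0" using r unfolding small_radius_def by simp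
  have pt0: "pt v i = 0" if i: "i < n" for i
  proof -
    let ?p = "pt x i"
    have "eventually (\<lambda>z. z \<in> (- (ends n x - {?p})) - {?p}) (at ?p)"
      by (intro eventually_at_in_open open_Compl finite_imp_closed finite_Diff finite_ends) auto
    then have "eventually (\<lambda>z. (z - ?p)^3 * dphi n x v 0 z = 0) (at ?p)"
      by eventually_elim (use F in auto)
    then have "((\<lambda>z. (z - ?p)^3 * dphi n x v 0 z) \<longlongrightarrow> 0) (at ?p)"
      by (rule tendsto_eventually)
    then have "2 * pt v i * numW n x 0 ?p / prodHat n x i ?p = 0"
      using dphi_leading_limit[OF r i] tendsto_unique trivial_limit_at by blast
    moreover have "prodHat n x i ?p \<noteq> 0" using prodHat_nonzero[OF r i] r0 by simp
    moreover have "numW n x 0 ?p \<noteq> 0"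
      using nnoid_dataD(5)[OF nn, of ?p] i unfolding numW_def ends_def by auto
    ultimately show ?thesis by simp
  qed
  have num: "dnum n x v k z = 0" if "k < 3" "z \<notin> ends n x" for k z
    using F[OF that] pt0 prodP_nonzero_iff[of n x z] that(2) unfolding dphi_def by simp
  obtain y where y: "y \<in> - ends n x"
    using finite_ends[of n x] by (metis ex_new_if_finite infinite_UNIV_char_0 ComplI)
  have p0: "pt x 0 \<in> ends n x" using nnoid_dataD(1)[OF nn] unfolding ends_def by auto
  have AB: "PA n x \<noteq> 0" "PB n x \<noteq> 0"
    using nnoid_dataD(5)[OF nn p0] poly_PA[of n x "pt x 0"] poly_PB[of n x "pt x 0"] by force+
  have "PB n x * PB n v = 0"
    by (rule poly_eq_0_on_open[OF open_compl_ends y]) (use num[of 0] in \<open>auto simp: dnum_def\<close>)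
  then have B: "PB n v = 0" using AB by simp
  have "PA n x * PA n v = 0"
    by (rule poly_eq_0_on_open[OF open_compl_ends y]) (use num[of 2] in \<open>auto simp: dnum_def\<close>)
  then have A: "PA n v = 0" using AB by simp
  define i where "i = s div 3"
  have i: "i < n" using s unfolding i_def by linarith
  have "s = 3 * i \<or> s = 3 * i + 1 \<or> s = 3 * i + 2" unfolding i_def by presburger
  moreover have "v (3 * i) = 0" using coeff_PA[OF i, of v] A unfolding coef_a_def by simp
  moreover have "v (3 * i + 1) = 0" using coeff_PB[OF i, of v] B unfolding coef_b_def by simp
  moreover have "v (3 * i + 2) = 0" using pt0[OF i] unfolding pt_def by simp
  ultimately show ?thesis by auto
qed

text \<open>The condition \<open>V\<close> concerns the variation of g = A / B multiplied by
  \<open>B^2\<close>, so that it also makes sense at a pole of g.\<close>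

lemma variation_zero:
  assumes nn: "nnoid_data n x" and r: "small_radius n x r"
    and dim: "real_fun_dim (bounded_jacobi_fields n x) = 3"
    and van: "\<And>i k. i < n - 1 \<Longrightarrow> k < 3 \<Longrightarrow> (dphi n x v k has_contour_integral 0) (circlepath (pt x i) r)"
    and Z: "card Z = 3" "\<And>z. z \<in> Z \<Longrightarrow> z \<notin> ends n x" "\<And>z. z \<in> Z \<Longrightarrow> wronsk (polyA n x) (polyB n x) z \<noteq> 0"
    and V: "\<And>z. z \<in> Z \<Longrightarrow> polyA n v z * polyB n x z - polyA n x z * polyB n v z = 0"
    and s: "s < 3 * n"
  shows "v s = 0"
proof -
  let ?A = "polyA n x" and ?B = "polyB n x" and ?W = "wronsk (polyA n x) (polyB n x)" and ?S = "- ends n x"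
  note n = nnoid_dataD(1)[OF nn]
  obtain E where E: "admissible n x E"
    and dE: "\<And>k z. k < 3 \<Longrightarrow> z \<notin> ends n x \<Longrightarrow> (E k has_field_derivative dphi n x v k z) (at z)"
    and eE: "\<And>k. \<exists>e. degree e \<le> 2 * n \<and> (\<forall>z. z \<notin> ends n x \<longrightarrow> E k z = poly e z / prodP n x z)"
    using dphi_primitive[OF nnoid_dataD(2)[OF nn] n r van] by metis
  obtain z0 where z0: "z0 \<in> Z" using Z(1) by fastforce
  note Wp = wronsk_nonzero_at_end[OF nn]
  obtain c where c: "\<And>y. y \<notin> ends n x \<Longrightarrow> support_fun ?A ?B (\<lambda>k z. E k z - c k) y = 0"
    using support_fun_translation[OF nn Z(2)[OF z0] Z(3)[OF z0] Wp dim E] by blast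
  define E' where "E' = (\<lambda>k z. E k z - c k)"
  have nd: "null_deriv ?S ?A ?B E'"
    using null_deriv_linear[of ?S ?A ?B E "\<lambda>k z. c k" 1 "-1"] E admissible_const[of n x c]
    unfolding admissible_def E'_def by simp
  define U where "U = ?S \<inter> ?W -` (- {0})"
  have "?W holomorphic_on ?S" unfolding wronsk_def[abs_def] by (intro holomorphic_intros open_compl_ends)
  then have U: "open U" unfolding U_def
    by (intro continuous_open_preimage holomorphic_on_imp_continuous_on open_compl_ends) auto
  have z0U: "z0 \<in> U" unfolding U_def using Z z0 by simp
  have eq: "?A z * E' 1 z = ?B z * E' 2 z" "?A z * E' 0 z = ?B z * E' 1 z" if "z \<in> U" for z
    using support_fun_vanish[OF nd open_compl_ends nnoid_dataD(3)[OF nn], of z] c that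
    unfolding U_def E'_def by auto
  obtain e where e: "\<And>k. degree (e k) \<le> 2 * n" "\<And>k z. z \<notin> ends n x \<Longrightarrow> E k z = poly (e k) z / prodP n x z"
    using eE by metis
  define PP where "PP = (\<Prod>j<n. [:- pt x j, 1:] ^ 2)"
  have PP: "poly PP z = prodP n x z" for z unfolding PP_def prodP_def by (simp add: poly_prod)
  have degPP: "degree PP = 2 * n" unfolding PP_def
    by (subst degree_prod_eq_sum_degree) (auto simp: degree_linear_power simp del: power_Suc)
  define e' where "e' k = e k - Polynomial.smult (c k) PP" for k
  have dege': "degree (e' k) \<le> 2 * n" for k unfolding e'_def
    using e(1)[of k] degPP degree_smult_le[of "c k" PP] by (intro degree_diff_le) auto
  have e': "E' k z = poly (e' k) z / prodP n x z" if "z \<notin> ends n x" for k z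
    unfolding E'_def e'_def using e(2)[OF that] prodP_nonzero_iff[of n x z] that by (simp add: PP field_simps)
  have US: "z \<notin> ends n x" if "z \<in> U" for z using that unfolding U_def by auto
  have p0: "pt x 0 \<in> ends n x" using n unfolding ends_def by auto
  have PB0: "PB n x \<noteq> 0" using nnoid_dataD(5)[OF nn p0] poly_PB[of n x "pt x 0"] by force
  have "PA n x * e' 1 - PB n x * e' 2 = 0"
  proof (rule poly_eq_0_on_open[OF U z0U])
    fix z assume z: "z \<in> U"
    show "poly (PA n x * e' 1 - PB n x * e' 2) z = 0"
      using eq(1)[OF z] prodP_nonzero_iff[of n x z] US[OF z] by (simp add: e'[OF US[OF z]])
  qed
  moreover have "PA n x * e' 0 - PB n x * e' 1 = 0"
  proof (rule poly_eq_0_on_open[OF U z0U])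
    fix z assume z: "z \<in> U"
    show "poly (PA n x * e' 0 - PB n x * e' 1) z = 0"
      using eq(2)[OF z] prodP_nonzero_iff[of n x z] US[OF z] by (simp add: e'[OF US[OF z]])
  qed
  moreover have "coprime (PA n x) (PB n x)"
    by (rule coprime_if_no_common_root) (use nnoid_dataD(3)[OF nn] in auto)
  ultimately obtain h where h: "e' 0 = PB n x * PB n x * h" "e' 1 = PA n x * PB n x * h" "e' 2 = PA n x * PA n x * h"
    using common_factor_of_proportional[OF _ PB0, of "PA n x" "e' 0" "e' 1" "e' 2"] by auto
  \<comment> \<open>One of A, B has degree exactly n - 1, and its square times h has degree at most
    2n. In the chart 1/z this means that the vector field h is holomorphic at infinity.\<close>
  have degh: "degree h \<le> 2"
  proof (cases "h = 0")
    case False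
    have d: "degree h \<le> 2" if "q \<noteq> 0" "n - 1 \<le> degree q" "degree (q * q * h) \<le> 2 * n" for q
      using that False n by (simp add: degree_mult_eq)
    have "coef_a x 0 \<noteq> 0 \<or> coef_b x 0 \<noteq> 0" by (rule nnoid_dataD(4)[OF nn])
    then show ?thesis
    proof
      assume "coef_a x 0 \<noteq> 0"
      then have "poly.coeff (PA n x) (n - 1) \<noteq> 0" using coeff_PA[of 0 n x] n by simp
      then show ?thesis using d[of "PA n x"] dege'[of 2] le_degree unfolding h(3) by fastforce
    next
      assume "coef_b x 0 \<noteq> 0"
      then have "poly.coeff (PB n x) (n - 1) \<noteq> 0" using coeff_PB[of 0 n x] n by simp
      then show ?thesis using d[of "PB n x"] dege'[of 0] le_degree unfolding h(1) by fastforce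
    qed
  qed simp
  have Eh: "E' 0 z = ?B z * ?B z * poly h z / prodP n x z" "E' 1 z = ?A z * ?B z * poly h z / prodP n x z"
    "E' 2 z = ?A z * ?A z * poly h z / prodP n x z" if "z \<notin> ends n x" for z
    using e'[OF that] h by simp_all
  have dE': "(E' k has_field_derivative dphi n x v k z) (at z)" if "k < 3" "z \<notin> ends n x" for k z
    unfolding E'_def using dE[OF that] by (auto intro!: derivative_eq_intros)
  \<comment> \<open>Divided by \<open>B^2\<close>: the variation of g is h g', as for a
    reparametrization along h.\<close>
  have Vh: "poly h z * ?W z = polyA n v z * ?B z - ?A z * polyB n v z" if z: "z \<notin> ends n x" for z
  proof -
    have P: "prodP n x z \<noteq> 0" using prodP_nonzero_iff z by blast
    have dA: "(?A has_field_derivative deriv ?A z) (at z)" "(?B has_field_derivative deriv ?B z) (at z)"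
      by (rule holomorphic_derivI[where S=UNIV]; auto intro: holomorphic_intros)+
    have zero: "d = 0" if "((\<lambda>z. f z - g z) has_field_derivative d) (at z)" "\<And>z. z \<notin> ends n x \<Longrightarrow> f z = g z"
      for f g :: "complex \<Rightarrow> complex" and d
    proof -
      have "((\<lambda>_. 0) has_field_derivative d) (at z)"
        by (rule has_field_derivative_transform_within_open[OF that(1) open_compl_ends[of n x]]) (use z that(2) in auto)
      then show ?thesis using DERIV_unique DERIV_const by blast
    qed
    have lin: "X = - Y" if "p + q - (r + s) = 0" "q - s = X" "p - r = Y" for p q r s X Y :: complex
    proof -
      have "X + Y = p + q - (r + s)" unfolding that(2,3)[symmetric] by simp
      then show ?thesis using that(1) by (simp add: eq_neg_iff_add_eq_0)
    qed
    \<comment> \<open>\<open>B E' 1 - A E' 0\<close> vanishes identically, so its derivative does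
      too; this gives B times the claim. \<open>A E' 1 - B E' 2\<close> gives A times the claim, and
      at each point A or B can be cancelled.\<close>
    have "((\<lambda>z. ?B z * E' 1 z - ?A z * E' 0 z) has_field_derivative
       (deriv ?B z * E' 1 z + ?B z * dphi n x v 1 z - (deriv ?A z * E' 0 z + ?A z * dphi n x v 0 z))) (at z)"
      using dE'[of 1 z] dE'[of 0 z] z dA by (auto intro!: derivative_eq_intros simp: algebra_simps)
    then have "deriv ?B z * E' 1 z + ?B z * dphi n x v 1 z - (deriv ?A z * E' 0 z + ?A z * dphi n x v 0 z) = 0"
      by (rule zero) (simp add: Eh del: One_nat_def)
    moreover have "?B z * dphi n x v 1 z - ?A z * dphi n x v 0 z = ?B z * (polyA n v z * ?B z - ?A z * polyB n v z) / prodP n x z"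
      unfolding dphi_def dnum_def numW_def using P by (simp add: field_simps power2_eq_square)
    moreover have "deriv ?B z * E' 1 z - deriv ?A z * E' 0 z = - ?B z * (poly h z * ?W z) / prodP n x z"
      unfolding Eh[OF z] wronsk_def using P by (simp add: field_simps)
    ultimately have "?B z * (polyA n v z * ?B z - ?A z * polyB n v z) / prodP n x z = - (- ?B z * (poly h z * ?W z) / prodP n x z)"
      by (rule lin)
    then have b: "?B z * (polyA n v z * ?B z - ?A z * polyB n v z) = ?B z * (poly h z * ?W z)" using P by simp
    have "((\<lambda>z. ?A z * E' 1 z - ?B z * E' 2 z) has_field_derivative
       (deriv ?A z * E' 1 z + ?A z * dphi n x v 1 z - (deriv ?B z * E' 2 z + ?B z * dphi n x v 2 z))) (at z)"
      using dE'[of 1 z] dE'[of 2 z] z dA by (auto intro!: derivative_eq_intros simp: algebra_simps)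
    then have "deriv ?A z * E' 1 z + ?A z * dphi n x v 1 z - (deriv ?B z * E' 2 z + ?B z * dphi n x v 2 z) = 0"
      by (rule zero) (simp add: Eh del: One_nat_def)
    moreover have "?A z * dphi n x v 1 z - ?B z * dphi n x v 2 z = - ?A z * (polyA n v z * ?B z - ?A z * polyB n v z) / prodP n x z"
      unfolding dphi_def dnum_def numW_def using P by (simp add: field_simps power2_eq_square)
    moreover have "deriv ?A z * E' 1 z - deriv ?B z * E' 2 z = ?A z * (poly h z * ?W z) / prodP n x z"
      unfolding Eh[OF z] wronsk_def using P by (simp add: field_simps)
    ultimately have "- ?A z * (polyA n v z * ?B z - ?A z * polyB n v z) / prodP n x z = - (?A z * (poly h z * ?W z) / prodP n x z)"
      by (rule lin)
    then have a: "?A z * (polyA n v z * ?B z - ?A z * polyB n v z) = ?A z * (poly h z * ?W z)" using P by simp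
    show ?thesis using a b nnoid_dataD(3)[OF nn, of z] by (metis mult_left_cancel)
  qed
  have "poly h z = 0" if "z \<in> Z" for z
    using Vh[OF Z(2)[OF that]] V[OF that] Z(3)[OF that] by simp
  then have "Z \<subseteq> {z. poly h z = 0}" by auto
  have h0: "h = 0"
  proof (rule ccontr)
    assume "h \<noteq> 0"
    then have "card {z. poly h z = 0} \<le> 2" using card_poly_roots_bound[of h] degh by simp
    moreover have "card Z \<le> card {z. poly h z = 0}"
      using \<open>Z \<subseteq> _\<close> poly_roots_finite[OF \<open>h \<noteq> 0\<close>] by (rule card_mono[rotated])
    ultimately show False using Z(1) by simp
  qed
  have "dphi n x v k z = 0" if k: "k < 3" and z: "z \<notin> ends n x" for k z
  proof -
    have E0: "E' k y = 0" if "y \<notin> ends n x" for y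
    proof -
      have "k = 0 \<or> k = 1 \<or> k = 2" using k by linarith
      then show ?thesis using Eh[OF that] h0 by auto
    qed
    have "((\<lambda>_. 0) has_field_derivative dphi n x v k z) (at z)"
      by (rule has_field_derivative_transform_within_open[OF dE'[OF k z] open_compl_ends[of n x]]) (use z E0 in auto)
    then show ?thesis using DERIV_unique DERIV_const by blast
  qed
  then show ?thesis by (rule dphi_zero_imp_zero[OF nn r _ s])
qed

section \<open>Rank by bordering, and assembly of the proof\<close>

lemma rank_eq_rows_if_surjective:
  fixes M :: "'a::field Matrix.mat"
  assumes M: "M \<in> carrier_mat m N"
    and surj: "\<And>y. y \<in> carrier_vec m \<Longrightarrow> \<exists>w \<in> carrier_vec N. M *\<^sub>v w = y"
  shows "vec_space.rank m M = m"
proof -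
  interpret V: vec_space "TYPE('a)" m .
  have "V.col_space M = carrier_vec m"
    unfolding V.col_space_eq[OF M] using M surj by auto
  then have "V.span (set (cols M)) = carrier_vec m" unfolding V.col_space_def .
  then have "V.span_vs (set (cols M)) = V.V"
    by (simp add: module_vec_def)
  then show ?thesis unfolding V.rank_def by (simp add: V.dim_is_n)
qed

lemma rank_eq_rows_if_bordered_injective:
  fixes M :: "'a::field Matrix.mat" and b :: "nat \<Rightarrow> nat \<Rightarrow> 'a"
  assumes M: "M \<in> carrier_mat m N" and mN: "m \<le> N"
    and inj: "\<And>c. (\<And>a. a < m \<Longrightarrow> (\<Sum>s<N. M $$ (a, s) * c s) = 0) \<Longrightarrow> (\<And>j. j < N - m \<Longrightarrow> (\<Sum>s<N. b j s * c s) = 0)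
        \<Longrightarrow> (\<And>s. s < N \<Longrightarrow> c s = 0)"
  shows "vec_space.rank m M = m"
proof (rule rank_eq_rows_if_surjective[OF M])
  define M' where "M' = Matrix.mat N N (\<lambda>(a, s). if a < m then M $$ (a, s) else b (a - m) s)"
  have M': "M' \<in> carrier_mat N N" unfolding M'_def by simp
  have row: "(M' *\<^sub>v w) $ a = (\<Sum>s<N. (if a < m then M $$ (a, s) else b (a - m) s) * w $ s)"
    if "a < N" "w \<in> carrier_vec N" for a w
    using that unfolding M'_def by (simp add: scalar_prod_def lessThan_atLeast0)
  have "Determinant.det M' \<noteq> 0"
  proof
    assume "Determinant.det M' = 0"
    then obtain w where w: "w \<in> carrier_vec N" "w \<noteq> 0\<^sub>v N" "M' *\<^sub>v w = 0\<^sub>v N"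
      using det_0_iff_vec_prod_zero_field[OF M'] by auto
    have 0: "(\<Sum>s<N. (if a < m then M $$ (a, s) else b (a - m) s) * w $ s) = 0" if "a < N" for a
      using row[OF that w(1)] w(3) that by simp
    have "w $ s = 0" if "s < N" for s
    proof (rule inj[of "\<lambda>s. w $ s", OF _ _ that])
      show "(\<Sum>s<N. M $$ (a, s) * w $ s) = 0" if "a < m" for a using 0[of a] that mN by simp
      show "(\<Sum>s<N. b j s * w $ s) = 0" if "j < N - m" for j using 0[of "j + m"] that by simp
    qed
    then have "w = 0\<^sub>v N" using w(1) by auto
    then show False using w(2) by simp
  qed
  then have "M' \<in> Units (ring_mat TYPE('a) N ())" by (rule det_non_zero_imp_unit[OF M'])
  then obtain B where B: "B \<in> carrier_mat N N" "M' * B = 1\<^sub>m N"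
    unfolding Units_def ring_mat_def by auto
  fix y :: "'a Matrix.vec" assume y: "y \<in> carrier_vec m"
  \<comment> \<open>Zeros in the bordering coordinates: any extension of \<open>y\<close> would do,
    since only the first m coordinates of \<open>M' w\<close> are compared.\<close>
  define y' where "y' = Matrix.vec N (\<lambda>a. if a < m then y $ a else 0)"
  have y': "y' \<in> carrier_vec N" unfolding y'_def by simp
  define w where "w = B *\<^sub>v y'"
  have w: "w \<in> carrier_vec N" unfolding w_def using B y' by auto
  have "M' *\<^sub>v w = y'" unfolding w_def using assoc_mult_mat_vec[OF M' B(1) y'] B(2) y' by simp
  then have *: "(M' *\<^sub>v w) $ a = y $ a" if "a < m" for a using that mN unfolding y'_def by simp
  have "M *\<^sub>v w = y"
  proof (rule eq_vecI)
    fix a assume "a < dim_vec y"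
    then have a: "a < m" using y by simp
    have "(M *\<^sub>v w) $ a = (\<Sum>s<N. M $$ (a, s) * w $ s)"
      using a M w by (auto simp: scalar_prod_def lessThan_atLeast0 intro!: sum.cong)
    also have "\<dots> = (M' *\<^sub>v w) $ a" using row[of a w] a mN w by simp
    finally show "(M *\<^sub>v w) $ a = y $ a" using *[OF a] by simp
  qed (use M y in auto)
  then show "\<exists>w \<in> carrier_vec N. M *\<^sub>v w = y" using w by blast
qed

lemma polyA_sum: "polyA n (\<lambda>j. \<Sum>s<m. c s * unitv s j) z = (\<Sum>s<m. c s * polyA n (unitv s) z)"
proof (induction m)
  case 0 then show ?case by (simp add: polyA_def coef_a_def)
next
  case (Suc m) then show ?case using polyA_linear[of n "\<lambda>j. \<Sum>s<m. c s * unitv s j" "c m" "unitv m" z] by simp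
qed

lemma polyB_sum: "polyB n (\<lambda>j. \<Sum>s<m. c s * unitv s j) z = (\<Sum>s<m. c s * polyB n (unitv s) z)"
proof (induction m)
  case 0 then show ?case by (simp add: polyB_def coef_b_def)
next
  case (Suc m) then show ?case using polyB_linear[of n "\<lambda>j. \<Sum>s<m. c s * unitv s j" "c m" "unitv m" z] by simp
qed

text \<open>\<open>wronsk\<close> is nonzero at the ends, hence on a nonempty open set, which is
  infinite even after the ends are removed.\<close>

lemma exists_wronsk_nonzero_points:
  assumes nn: "nnoid_data n x"
  obtains z where "inj_on z {..<3::nat}" "\<And>j. j < 3 \<Longrightarrow> z j \<notin> ends n x"
    "\<And>j. j < 3 \<Longrightarrow> wronsk (polyA n x) (polyB n x) (z j) \<noteq> 0"
proof -
  let ?W = "wronsk (polyA n x) (polyB n x)"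
  define U where "U = UNIV \<inter> ?W -` (- {0})"
  have "?W holomorphic_on UNIV" unfolding wronsk_def[abs_def] by (intro holomorphic_intros open_UNIV)
  then have "open U" unfolding U_def
    by (intro continuous_open_preimage holomorphic_on_imp_continuous_on) auto
  moreover have "pt x 0 \<in> U"
    using wronsk_nonzero_at_end[OF nn, of "pt x 0"] nnoid_dataD(1)[OF nn] unfolding U_def ends_def by auto
  ultimately have "infinite U" using finite_imp_not_open by blast
  then have "infinite (U - ends n x)" by simp
  then obtain Z where Z: "Z \<subseteq> U - ends n x" "finite Z" "card Z = 3"
    using infinite_arbitrarily_large by blast
  then obtain z where "bij_betw z {..<3::nat} Z"
    using ex_bij_betw_nat_finite[of Z] by (auto simp: lessThan_atLeast0)
  then have "inj_on z {..<3}" "z j \<in> Z" if "j < 3" for j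
    using that by (auto simp: bij_betw_def)
  then show ?thesis using that[of z] Z(1) \<open>bij_betw z {..<3::nat} Z\<close>
    unfolding bij_betw_def U_def by blast
qed

theorem theorem2:
  fixes n :: nat and x0 :: "nat \<Rightarrow> complex" and r :: real
  assumes "nnoid_data n x0"
    and "small_radius n x0 r"
    and "real_fun_dim (bounded_jacobi_fields n x0) = 3"
  shows "complex_rank (3 * (n - 1)) (period_jacobian n r x0) = 3 * n - 3"
proof -
  note nn = assms(1) and r = assms(2)
  note n = nnoid_dataD(1)[OF nn]
  let ?A = "polyA n x0" and ?B = "polyB n x0"
  obtain z where z: "inj_on z {..<3::nat}" "\<And>j. j < 3 \<Longrightarrow> z j \<notin> ends n x0"
    "\<And>j. j < 3 \<Longrightarrow> wronsk ?A ?B (z j) \<noteq> 0"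
    using exists_wronsk_nonzero_points[OF nn] by blast
  define M where "M = period_jacobian n r x0"
  have M: "M \<in> carrier_mat (3 * (n - 1)) (3 * n)" unfolding M_def period_jacobian_def by simp
  \<comment> \<open>The bordering rows: the variation of g at \<open>z j\<close>, times
    \<open>B^2\<close>, for the coordinate direction \<open>s\<close>.\<close>
  define b where "b j s = polyA n (unitv s) (z j) * ?B (z j) - ?A (z j) * polyB n (unitv s) (z j)" for j s
  have entry: "M $$ (3 * i + k, s) = contour_integral (circlepath (pt x0 i) r) (dphi n x0 (unitv s) k)"
    if i: "i < n - 1" and k: "k < 3" and s: "s < 3 * n" for i k s
  proof -
    have a: "3 * i + k < 3 * (n - 1)" using i k by linarith
    have "(3 * i + k) div 3 = i" "(3 * i + k) mod 3 = k" using k by auto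
    then have "M $$ (3 * i + k, s) = deriv (\<lambda>t. period n r x0 (x0(s := t)) i k) (x0 s)"
      unfolding M_def period_jacobian_def period_map_def using a s by simp
    also have "\<dots> = contour_integral (circlepath (pt x0 i) r) (dphi n x0 (unitv s) k)"
    proof (rule deriv_period[OF k r _ _ s])
      show "i < n" using i by simp
      then show "?B (pt x0 i) \<noteq> 0" using nnoid_dataD(5)[OF nn, of "pt x0 i"] unfolding ends_def by auto
    qed
    finally show ?thesis .
  qed
  have "vec_space.rank (3 * (n - 1)) M = 3 * (n - 1)"
  proof (rule rank_eq_rows_if_bordered_injective[OF M, of b])
    fix c :: "nat \<Rightarrow> complex" and s
    assume ker: "\<And>a. a < 3 * (n - 1) \<Longrightarrow> (\<Sum>s<3 * n. M $$ (a, s) * c s) = 0"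
      and bord: "\<And>j. j < 3 * n - 3 * (n - 1) \<Longrightarrow> (\<Sum>s<3 * n. b j s * c s) = 0" and s: "s < 3 * n"
    \<comment> \<open>\<open>c\<close> may have any values from index 3n on. \<open>v\<close>
      truncates it and is a sum of coordinate directions, the form in which the linearity lemmas
      apply.\<close>
    define v where "v = (\<lambda>j. \<Sum>s<3 * n. c s * unitv s j)"
    have "v s = 0"
    proof (rule variation_zero[OF nn r assms(3) _ _ _ _ _ s, where Z = "z ` {..<3}"])
      fix i k :: nat assume i: "i < n - 1" and k: "k < 3"
      have "(dphi n x0 v k has_contour_integral
         (\<Sum>s<3 * n. c s * contour_integral (circlepath (pt x0 i) r) (dphi n x0 (unitv s) k))) (circlepath (pt x0 i) r)"
        using contour_integral_dphi_sum[OF r, of i c "3 * n" k] i unfolding v_def by simp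
      moreover have "(\<Sum>s<3 * n. c s * contour_integral (circlepath (pt x0 i) r) (dphi n x0 (unitv s) k))
         = (\<Sum>s<3 * n. M $$ (3 * i + k, s) * c s)"
        using entry[OF i k] by (intro sum.cong) auto
      moreover have "\<dots> = 0" by (rule ker) (use i k in linarith)
      ultimately show "(dphi n x0 v k has_contour_integral 0) (circlepath (pt x0 i) r)" by simp
    next
      show "card (z ` {..<3}) = 3" using z(1) by (simp add: card_image)
    next
      fix y assume "y \<in> z ` {..<3}"
      then obtain j where j: "j < 3" "y = z j" by auto
      have "polyA n v y * ?B y - ?A y * polyB n v y = (\<Sum>s<3 * n. b j s * c s)"
        unfolding v_def polyA_sum polyB_sum b_def j(2)
        by (simp add: sum_distrib_left sum_distrib_right sum_subtractf algebra_simps)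
      \<comment> \<open>For n at least 1 the number of bordering rows is 3n - 3(n - 1) = 3, so
        \<open>j < 3\<close> is in range.\<close>
      also have "\<dots> = 0" by (rule bord) (use j n in simp)
      finally show "polyA n v y * ?B y - ?A y * polyB n v y = 0" .
    qed (use z in auto)
    moreover have "v s = c s"
    proof -
      have "v s = (\<Sum>t<3 * n. if t = s then c t else 0)" unfolding v_def unitv_def by (intro sum.cong) auto
      then show ?thesis using s by simp
    qed
    ultimately show "c s = 0" by simp
  qed simp
  then show ?thesis unfolding complex_rank_def M_def using n by simp
qed

end
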